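(* Consider the standard point target model with Poisson birth (as specified in the context). Let $\xi\le\chi$ and $\alpha\le\gamma$ be time steps, let measurement sets $\mathbf{Z}_{\xi},\ldots,\mathbf{Z}_{\chi}$ be given, and let $\mathbf{C}=\{(k_i,\mathcal{C}_i)\}_{i\in\mathbb{I}}$ be any set of spatiotemporal trajectory constraints, interpreted either as a set of conjunct constraints or as a set of disjunct constraints. Let $f^{\mathbf{C}}_{\alpha:\gamma|\xi:\chi}$ denote the multi-trajectory density, conditioned on the measurement sets in the time interval $\xi:\chi$, of the set of trajectories in the time interval $\alpha:\gamma$ that satisfy the set of constraints $\mathbf{C}$. Then $f^{\mathbf{C}}_{\alpha:\gamma|\xi:\chi}$ is exactly a Poisson multi-Bernoulli mixture (PMBM) density. This holds for any time intervals $\xi:\chi$ and $\alpha:\gamma$ (no relation between them is assumed), and for any set of constraints $\mathbf{C}$, conjunct or disjunct.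
   Context: **Time.** Time is discrete. For $\alpha\le\gamma$, $\alpha:\gamma$ denotes the sequence $(\alpha,\alpha+1,\ldots,\gamma)$ and $\mathbb{N}_\alpha^\gamma=\{\alpha,\alpha+1,\ldots,\gamma\}$. Time steps are nonnegative integers, and no targets exist before time $0$. **Standard point target model.** $\mathcal{X}$ is the target state space and $\mathcal{Z}$ is the measurement space; both carry reference measures, denoted $\mathrm{d}x$ and $\mathrm{d}z$, and all functions below are measurable. - Dynamics: at each time $k$, new targets appear according to a Poisson point process (PPP) on $\mathcal{X}$ with integrable intensity $\lambda^{\mathrm b}(x_k)$, independently over time and of existing targets. A target with state $x_{k-1}$ at time $k-1$ survives to time $k$ with probability $P^{\mathrm S}(x_{k-1})$, independently of everything else, and if it survives its state at time $k$ has the transition density $\pi^x(x_k|x_{k-1})$. A target that does not survive never reappears. - Measurements: at each time $k$, each target alive with state $x_k$ is detected with probability $P^{\mathrm D}(x_k)$, independently, and if detected it generates exactly one measurement with density $\varphi^z(z_k|x_k)$; otherwise it generates none. Each measurement comes from at most one target. Clutter measurements form an independent PPP on $\mathcal{Z}$ with integrable intensity $\lambda^{\mathrm{FA}}(z_k)$. The measurement set $\mathbf{Z}_k$ is the (unlabelled) union of target-generated measurements and clutter. The given measurement sets are assumed to have positive likelihood, so that conditioning by Bayes' rule is defined. **Trajectories.** A trajectory is a tuple $X=(\beta,\varepsilon,x_{\beta:\varepsilon})$, where $\beta\le\varepsilon$ are the first and last time steps of the trajectory and $x_{\beta:\varepsilon}=(x_\beta,\ldots,x_\varepsilon)$ with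 $x_k\in\mathcal{X}$. The space of trajectories in the time interval $\alpha:\gamma$ is $$\mathcal{T}_{\alpha:\gamma}=\biguplus_{\alpha\le\beta\le\varepsilon\le\gamma}\{\beta\}\times\{\varepsilon\}\times\mathcal{X}^{\varepsilon-\beta+1},$$ and integration over it is $$\int_{\mathcal{T}_{\alpha:\gamma}} g(X)\,\mathrm{d}X=\sum_{\alpha\le\beta\le\varepsilon\le\gamma}\int_{\mathcal{X}^{\varepsilon-\beta+1}} g(\beta,\varepsilon,x_{\beta:\varepsilon})\,\mathrm{d}x_{\beta:\varepsilon}.$$ The set of trajectories in the time interval $\alpha:\gamma$, denoted $\mathbf{X}_{\alpha:\gamma}$, is the random finite subset of $\mathcal{T}_{\alpha:\gamma}$ obtained by taking the trajectories of all targets alive at some time in $\mathbb{N}_\alpha^\gamma$ and restricting each of them to the times in $\mathbb{N}_\alpha^\gamma$. **Multi-trajectory densities.** A multi-trajectory density is a nonnegative function $f$ on finite subsets of $\mathcal{T}_{\alpha:\gamma}$ with set integral equal to one, where the set integral is $$\int f(\mathbf{X})\,\delta\mathbf{X}=f(\emptyset)+\sum_{n\ge1}\frac1{n!}\int\cdots\int f(\{X^1,\ldots,X^n\})\,\mathrm{d}X^1\cdots\mathrm{d}X^n.$$ **Constraints.** A spatiotemporal trajectory constraint is a pair $(k,\mathcal{C})$ of a time step $k$ and a measurable region $\mathcal{C}\subseteq\mathcal{X}$. A set of constraints is a finite family $\mathbf{C}=\{(k_i,\mathcal{C}_i)\}_{i\in\mathbb{I}}$ with $k_i\in\mathbb{N}_\alpha^\gamma$;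 the times need not be consecutive, and the regions are arbitrary. For a trajectory $X=(\beta,\varepsilon,x_{\beta:\varepsilon})$ let $\mathbb{I}_\beta^\varepsilon=\{i\in\mathbb{I}:\beta\le k_i\le\varepsilon\}$. - Conjunct: $X$ satisfies $\mathbf{C}$ iff $\mathbb{I}_\beta^\varepsilon\ne\emptyset$ and $x_{k_i}\in\mathcal{C}_i$ for all $i\in\mathbb{I}_\beta^\varepsilon$. - Disjunct: $X$ satisfies $\mathbf{C}$ iff $\mathbb{I}_\beta^\varepsilon\ne\emptyset$ and there exists $i\in\mathbb{I}_\beta^\varepsilon$ with $x_{k_i}\in\mathcal{C}_i$. The set of trajectories in $\alpha:\gamma$ that satisfy $\mathbf{C}$ is $\mathbf{X}^{\mathbf{C}}_{\alpha:\gamma}=\{X\in\mathbf{X}_{\alpha:\gamma}: X \text{ satisfies } \mathbf{C}\}$, and $f^{\mathbf{C}}_{\alpha:\gamma|\xi:\chi}$ is its multi-trajectory density conditioned on $\mathbf{Z}_\xi,\ldots,\mathbf{Z}_\chi$. **PMBM densities.** A trajectory PPP density with intensity $\lambda\ge0$, $\int\lambda(X)\,\mathrm{d}X<\infty$, is $f^{\mathrm u}(\mathbf{X})=e^{-\int\lambda(X)\,\mathrm{d}X}\prod_{X\in\mathbf{X}}\lambda(X)$. A trajectory Bernoulli density with probability of existence $r\in[0,1]$ and trajectory density $p$ is $$f(\mathbf{X})=\begin{cases}1-r & \mathbf{X}=\emptyset,\\ r\,p(X) & \mathbf{X}=\{X\},\\ 0 & |\mathbf{X}|\ge2.\end{cases}$$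 A multi-trajectory density $f$ is a PMBM density if there are a trajectory PPP density $f^{\mathrm u}$, a finite index set $\mathbb{T}$, a finite set $\mathcal{A}$ of hypotheses $a=(a^i)_{i\in\mathbb{T}}$ with weights $w_a\ge0$, $\sum_{a\in\mathcal{A}}w_a=1$, and trajectory Bernoulli densities $f^{i,a^i}$ such that $$f(\mathbf{X})=\sum_{\mathbf{X}^{\mathrm u}\uplus(\uplus_{i\in\mathbb{T}}\mathbf{X}^i)=\mathbf{X}} f^{\mathrm u}(\mathbf{X}^{\mathrm u})\sum_{a\in\mathcal{A}}w_a\prod_{i\in\mathbb{T}}f^{i,a^i}(\mathbf{X}^i),$$ where the outer sum is over all ways of writing $\mathbf{X}$ as a disjoint union of (possibly empty) subsets $\mathbf{X}^{\mathrm u}$ and $\mathbf{X}^i$, $i\in\mathbb{T}$. *)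

theory Defs
  imports "HOL-Probability.Probability"
begin

text \<open>
  The measure on \<open>\<Omega>\<close> obtained from weighted measure spaces \<open>N i\<close> and maps \<open>g i\<close> into \<open>\<Omega>\<close>: it carries
  the largest sigma-algebra for which all \<open>g i\<close> are measurable, and integrating over it means
  summing the weighted integrals over the \<open>N i\<close>, see \<open>nn_integral_glue\<close>.
\<close>

definition glue_measure ::
    "'b set \<Rightarrow> 'i set \<Rightarrow> ('i \<Rightarrow> ennreal) \<Rightarrow> ('i \<Rightarrow> 'a measure) \<Rightarrow> ('i \<Rightarrow> 'a \<Rightarrow> 'b) \<Rightarrow> 'b measure" where
  "glue_measure \<Omega> I c N g = measure_of \<Omega>
     {A. A \<subseteq> \<Omega> \<and> (\<forall>i\<in>I. g i -` A \<inter> space (N i) \<in> sets (N i))}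
     (\<lambda>A. \<integral>\<^sup>+i. c i * emeasure (N i) (g i -` A \<inter> space (N i)) \<partial>count_space I)"

lemma sigma_algebra_glue:
  assumes g: "\<And>i. i \<in> I \<Longrightarrow> g i \<in> space (N i) \<rightarrow> \<Omega>"
  shows "sigma_algebra \<Omega> {A. A \<subseteq> \<Omega> \<and> (\<forall>i\<in>I. g i -` A \<inter> space (N i) \<in> sets (N i))}"
proof -
  let ?S = "{A. A \<subseteq> \<Omega> \<and> (\<forall>i\<in>I. g i -` A \<inter> space (N i) \<in> sets (N i))}"
  have "\<Omega> - A \<in> ?S" if "A \<in> ?S" for A
  proof -
    have "g i -` (\<Omega> - A) \<inter> space (N i) = space (N i) - (g i -` A \<inter> space (N i))" if "i \<in> I" for i
      using g[OF that] by auto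
    then show ?thesis using that by auto
  qed
  moreover have "(\<Union>n. A n) \<in> ?S" if "range A \<subseteq> ?S" for A :: "nat \<Rightarrow> _"
  proof -
    have "g i -` (\<Union>n. A n) \<inter> space (N i) = (\<Union>n. g i -` A n \<inter> space (N i))" for i by auto
    moreover have "(\<Union>n. g i -` A n \<inter> space (N i)) \<in> sets (N i)" if "i \<in> I" for i
      using \<open>range A \<subseteq> ?S\<close> that by (intro sets.countable_UN) auto
    ultimately show ?thesis using that by auto
  qed
  moreover have "?S \<subseteq> Pow \<Omega>" "{} \<in> ?S" by auto
  ultimately show ?thesis unfolding sigma_algebra_iff2 by blast
qed

lemma space_glue: "space (glue_measure \<Omega> I c N g) = \<Omega>"
  unfolding glue_measure_def by (rule space_measure_of) auto

lemma sets_glue: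
  assumes "\<And>i. i \<in> I \<Longrightarrow> g i \<in> space (N i) \<rightarrow> \<Omega>"
  shows "sets (glue_measure \<Omega> I c N g) =
    {A. A \<subseteq> \<Omega> \<and> (\<forall>i\<in>I. g i -` A \<inter> space (N i) \<in> sets (N i))}"
  unfolding glue_measure_def
  by (rule sigma_algebra.sets_measure_of_eq) (rule sigma_algebra_glue[OF assms])

lemma emeasure_glue:
  assumes g: "\<And>i. i \<in> I \<Longrightarrow> g i \<in> space (N i) \<rightarrow> \<Omega>"
    and A: "A \<in> sets (glue_measure \<Omega> I c N g)"
  shows "emeasure (glue_measure \<Omega> I c N g) A =
    (\<integral>\<^sup>+i. c i * emeasure (N i) (g i -` A \<inter> space (N i)) \<partial>count_space I)"
proof -
  let ?S = "{A. A \<subseteq> \<Omega> \<and> (\<forall>i\<in>I. g i -` A \<inter> space (N i) \<in> sets (N i))}"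
  let ?\<mu> = "\<lambda>A. \<integral>\<^sup>+i. c i * emeasure (N i) (g i -` A \<inter> space (N i)) \<partial>count_space I"
  have "countably_additive ?S ?\<mu>"
  proof (rule countably_additiveI)
    fix F :: "nat \<Rightarrow> _" assume F: "range F \<subseteq> ?S" "disjoint_family F"
    have "(\<Sum>n. ?\<mu> (F n)) =
      (\<integral>\<^sup>+i. (\<Sum>n. c i * emeasure (N i) (g i -` F n \<inter> space (N i))) \<partial>count_space I)"
      by (subst nn_integral_suminf) auto
    also have "\<dots> = ?\<mu> (\<Union>n. F n)"
    proof (intro nn_integral_cong)
      fix i assume "i \<in> space (count_space I)"
      then have "(\<Sum>n. emeasure (N i) (g i -` F n \<inter> space (N i))) =
          emeasure (N i) (\<Union>n. g i -` F n \<inter> space (N i))"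
        using F by (intro suminf_emeasure) (auto simp: disjoint_family_on_def disjoint_iff)
      moreover have "(\<Union>n. g i -` F n \<inter> space (N i)) = g i -` (\<Union>n. F n) \<inter> space (N i)" by auto
      ultimately show "(\<Sum>n. c i * emeasure (N i) (g i -` F n \<inter> space (N i))) =
          c i * emeasure (N i) (g i -` (\<Union>n. F n) \<inter> space (N i))"
        by simp
    qed
    finally show "(\<Sum>n. ?\<mu> (F n)) = ?\<mu> (\<Union>n. F n)" .
  qed
  moreover have "positive ?S ?\<mu>" by (simp add: positive_def)
  moreover have "A \<in> ?S" using A by (simp add: sets_glue[OF g])
  ultimately show ?thesis
    unfolding glue_measure_def
    by (intro emeasure_measure_of_sigma sigma_algebra_glue[OF g]) auto
qed

lemma measurable_glue_component:
  assumes "\<And>i. i \<in> I \<Longrightarrow> g i \<in> space (N i) \<rightarrow> \<Omega>" and "i \<in> I"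
  shows "g i \<in> measurable (N i) (glue_measure \<Omega> I c N g)"
  using assms by (auto simp: measurable_def space_glue sets_glue[OF assms(1)])

lemma nn_integral_glue:
  fixes \<Omega> :: "'b set" and f :: "'b \<Rightarrow> ennreal"
  assumes g: "\<And>i. i \<in> I \<Longrightarrow> g i \<in> space (N i) \<rightarrow> \<Omega>"
    and f: "f \<in> borel_measurable (glue_measure \<Omega> I c N g)"
  shows "(\<integral>\<^sup>+x. f x \<partial>glue_measure \<Omega> I c N g) =
    (\<integral>\<^sup>+i. c i * (\<integral>\<^sup>+x. f (g i x) \<partial>N i) \<partial>count_space I)"
proof -
  have comp: "(\<lambda>x. u (g i x)) \<in> borel_measurable (N i)"
    if "u \<in> borel_measurable (glue_measure \<Omega> I c N g)" "i \<in> I" for u :: "'b \<Rightarrow> ennreal" and i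
    by (rule measurable_compose[OF measurable_glue_component[OF g \<open>i \<in> I\<close>] that(1)])
  show ?thesis
    using f
  proof (induction rule: borel_measurable_induct)
    case (cong f h)
    have "(\<integral>\<^sup>+x. f x \<partial>glue_measure \<Omega> I c N g) = (\<integral>\<^sup>+x. h x \<partial>glue_measure \<Omega> I c N g)"
      by (intro nn_integral_cong cong)
    moreover have "(\<integral>\<^sup>+x. f (g i x) \<partial>N i) = (\<integral>\<^sup>+x. h (g i x) \<partial>N i)" if "i \<in> I" for i
      using g[OF that] by (intro nn_integral_cong cong) (auto simp: space_glue)
    then have "(\<integral>\<^sup>+i. c i * (\<integral>\<^sup>+x. f (g i x) \<partial>N i) \<partial>count_space I) =
        (\<integral>\<^sup>+i. c i * (\<integral>\<^sup>+x. h (g i x) \<partial>N i) \<partial>count_space I)"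
      by (intro nn_integral_cong) simp
    ultimately show ?case using cong by simp
  next
    case (set A)
    have "(\<integral>\<^sup>+x. indicator A (g i x) \<partial>N i) = emeasure (N i) (g i -` A \<inter> space (N i))" if "i \<in> I" for i
    proof -
      have "(\<integral>\<^sup>+x. indicator A (g i x) \<partial>N i) = (\<integral>\<^sup>+x. indicator (g i -` A \<inter> space (N i)) x \<partial>N i)"
        by (intro nn_integral_cong) (auto split: split_indicator)
      also have "\<dots> = emeasure (N i) (g i -` A \<inter> space (N i))"
        using set that by (intro nn_integral_indicator) (simp add: sets_glue[OF g])
      finally show ?thesis .
    qed
    then show ?case
      using set by (auto simp: emeasure_glue[OF g] intro!: nn_integral_cong)
  next
    case (mult u c')
    have "(\<integral>\<^sup>+i. c i * (\<integral>\<^sup>+x. c' * u (g i x) \<partial>N i) \<partial>count_space I) =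
        (\<integral>\<^sup>+i. c' * (c i * (\<integral>\<^sup>+x. u (g i x) \<partial>N i)) \<partial>count_space I)"
      using mult(2) by (intro nn_integral_cong, subst nn_integral_cmult) (auto intro: comp simp: mult_ac)
    then show ?case using mult by (simp add: nn_integral_cmult)
  next
    case (add u v)
    have "(\<integral>\<^sup>+i. c i * (\<integral>\<^sup>+x. v (g i x) + u (g i x) \<partial>N i) \<partial>count_space I) =
        (\<integral>\<^sup>+i. c i * (\<integral>\<^sup>+x. v (g i x) \<partial>N i) + c i * (\<integral>\<^sup>+x. u (g i x) \<partial>N i) \<partial>count_space I)"
      using add(1,3)
      by (intro nn_integral_cong, subst nn_integral_add) (auto intro: comp simp: distrib_left)
    then show ?case using add by (simp add: nn_integral_add)
  next
    case (seq U)
    have "(\<integral>\<^sup>+x. Sup (range U) x \<partial>glue_measure \<Omega> I c N g) =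
        (SUP n. \<integral>\<^sup>+x. U n x \<partial>glue_measure \<Omega> I c N g)"
      using seq by (subst SUP_apply, intro nn_integral_monotone_convergence_SUP) auto
    also have "\<dots> = (SUP n. \<integral>\<^sup>+i. c i * (\<integral>\<^sup>+x. U n (g i x) \<partial>N i) \<partial>count_space I)"
      using seq by simp
    also have "\<dots> = (\<integral>\<^sup>+i. (SUP n. c i * (\<integral>\<^sup>+x. U n (g i x) \<partial>N i)) \<partial>count_space I)"
      using seq(3)
      by (intro nn_integral_monotone_convergence_SUP[symmetric])
         (auto simp: incseq_def le_fun_def intro!: mult_left_mono nn_integral_mono)
    also have "\<dots> = (\<integral>\<^sup>+i. c i * (\<integral>\<^sup>+x. Sup (range U) (g i x) \<partial>N i) \<partial>count_space I)"
    proof (intro nn_integral_cong)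
      fix i assume "i \<in> space (count_space I)"
      then have "(\<integral>\<^sup>+x. (SUP n. U n (g i x)) \<partial>N i) = (SUP n. \<integral>\<^sup>+x. U n (g i x) \<partial>N i)"
        using seq(1,3)
        by (intro nn_integral_monotone_convergence_SUP)
           (auto simp: incseq_def le_fun_def intro: comp)
      then show "(SUP n. c i * (\<integral>\<^sup>+x. U n (g i x) \<partial>N i)) = c i * (\<integral>\<^sup>+x. Sup (range U) (g i x) \<partial>N i)"
        by (simp add: SUP_apply SUP_mult_left_ennreal image_comp)
    qed
    finally show ?case .
  qed
qed

definition finite_sets :: "'a measure \<Rightarrow> 'a set measure" where
  "finite_sets N = glue_measure {A. finite A \<and> A \<subseteq> space N} UNIV
     (\<lambda>n. 1 / fact n) (\<lambda>n. \<Pi>\<^sub>M i\<in>{..<n}. N) (\<lambda>n x. x ` {..<n})"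

text \<open>The set integral; the summand for \<open>n = 0\<close> is \<open>f {}\<close>.\<close>

lemma nn_integral_finite_sets:
  assumes "f \<in> borel_measurable (finite_sets N)"
  shows "(\<integral>\<^sup>+A. f A \<partial>finite_sets N) =
    (\<Sum>n. 1 / fact n * (\<integral>\<^sup>+x. f (x ` {..<n}) \<partial>(\<Pi>\<^sub>M i\<in>{..<n}. N)))"
  using assms unfolding finite_sets_def
  by (subst nn_integral_glue)
     (auto simp: nn_integral_count_space_nat space_PiM PiE_def Pi_def)

definition ppp_density :: "'a measure \<Rightarrow> ('a \<Rightarrow> real) \<Rightarrow> 'a set \<Rightarrow> real" where
  "ppp_density N lam A = exp (- (\<integral>x. lam x \<partial>N)) * (\<Prod>x\<in>A. lam x)"

definition ppp :: "'a measure \<Rightarrow> ('a \<Rightarrow> real) \<Rightarrow> 'a set measure" where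
  "ppp N lam = density (finite_sets N) (\<lambda>A. ennreal (ppp_density N lam A))"

definition bernoulli_density :: "real \<Rightarrow> ('a \<Rightarrow> real) \<Rightarrow> 'a set \<Rightarrow> real" where
  "bernoulli_density r p A =
     (if A = {} then 1 - r else if is_singleton A then r * p (the_elem A) else 0)"

definition is_intensity :: "'a measure \<Rightarrow> ('a \<Rightarrow> real) \<Rightarrow> bool" where
  "is_intensity N lam \<longleftrightarrow> integrable N lam \<and> (\<forall>x\<in>space N. 0 \<le> lam x)"

definition is_prob_density :: "'a measure \<Rightarrow> ('a \<Rightarrow> real) \<Rightarrow> bool" where
  "is_prob_density N p \<longleftrightarrow>
     p \<in> borel_measurable N \<and> (\<forall>x\<in>space N. 0 \<le> p x) \<and> (\<integral>\<^sup>+x. ennreal (p x) \<partial>N) = 1"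

text \<open>\<open>D None\<close> plays the role of the Poisson part, respectively of the clutter.\<close>

definition splits :: "'i set \<Rightarrow> 'a set \<Rightarrow> ('i option \<Rightarrow> 'a set) set" where
  "splits T A = {D \<in> insert None (Some ` T) \<rightarrow>\<^sub>E Pow A.
     disjoint_family_on D (insert None (Some ` T)) \<and> (\<Union>j\<in>insert None (Some ` T). D j) = A}"

definition pmbm_density :: "'a measure \<Rightarrow> ('a set \<Rightarrow> real) \<Rightarrow> bool" where
  "pmbm_density N f \<longleftrightarrow>
     (\<exists>(lam :: 'a \<Rightarrow> real) (T :: nat set) (H :: (nat \<Rightarrow> nat) set) (w :: (nat \<Rightarrow> nat) \<Rightarrow> real)
        (r :: nat \<Rightarrow> nat \<Rightarrow> real) (p :: nat \<Rightarrow> nat \<Rightarrow> 'a \<Rightarrow> real).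
        is_intensity N lam \<and> finite T \<and> finite H \<and> H \<subseteq> T \<rightarrow>\<^sub>E UNIV \<and>
        (\<forall>a\<in>H. 0 \<le> w a) \<and> (\<Sum>a\<in>H. w a) = 1 \<and>
        (\<forall>a\<in>H. \<forall>i\<in>T. r i (a i) \<in> {0..1} \<and> is_prob_density N (p i (a i))) \<and>
        (\<forall>A\<in>space (finite_sets N). f A =
           (\<Sum>D\<in>splits T A. ppp_density N lam (D None) *
              (\<Sum>a\<in>H. w a *
                 (\<Prod>i\<in>T. bernoulli_density (r i (a i)) (p i (a i)) (D (Some i)))))))"

text \<open>The states of \<open>(\<beta>, \<epsilon>, x)\<close> form a function \<open>x\<close> that is \<open>undefined\<close> outside \<open>{\<beta>..\<epsilon>}\<close>.\<close>

type_synonym 'x traj = "nat \<times> nat \<times> (nat \<Rightarrow> 'x)"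

definition traj_space :: "'x measure \<Rightarrow> nat \<Rightarrow> nat \<Rightarrow> 'x traj measure" where
  "traj_space M \<alpha> \<gamma> = glue_measure
     {(\<beta>, \<epsilon>, x). \<alpha> \<le> \<beta> \<and> \<beta> \<le> \<epsilon> \<and> \<epsilon> \<le> \<gamma> \<and> x \<in> {\<beta>..\<epsilon>} \<rightarrow>\<^sub>E space M}
     {(\<beta>, \<epsilon>). \<alpha> \<le> \<beta> \<and> \<beta> \<le> \<epsilon> \<and> \<epsilon> \<le> \<gamma>}
     (\<lambda>_. 1) (\<lambda>(\<beta>, \<epsilon>). \<Pi>\<^sub>M k\<in>{\<beta>..\<epsilon>}. M) (\<lambda>(\<beta>, \<epsilon>) x. (\<beta>, \<epsilon>, x))"

lemma nn_integral_traj_space: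
  assumes "g \<in> borel_measurable (traj_space M \<alpha> \<gamma>)"
  shows "(\<integral>\<^sup>+X. g X \<partial>traj_space M \<alpha> \<gamma>) =
    (\<Sum>(\<beta>, \<epsilon>)\<in>{(\<beta>, \<epsilon>). \<alpha> \<le> \<beta> \<and> \<beta> \<le> \<epsilon> \<and> \<epsilon> \<le> \<gamma>}. \<integral>\<^sup>+x. g (\<beta>, \<epsilon>, x) \<partial>(\<Pi>\<^sub>M k\<in>{\<beta>..\<epsilon>}. M))"
proof -
  have "finite {(\<beta>, \<epsilon>). \<alpha> \<le> \<beta> \<and> \<beta> \<le> \<epsilon> \<and> \<epsilon> \<le> \<gamma>}"
    by (rule finite_subset[of _ "{..\<gamma>} \<times> {..\<gamma>}"]) auto
  moreover have "(case i of (\<beta>, \<epsilon>) \<Rightarrow> \<lambda>x. (\<beta>, \<epsilon>, x)) \<in> space (case i of (\<beta>, \<epsilon>) \<Rightarrow> \<Pi>\<^sub>M k\<in>{\<beta>..\<epsilon>}. M) \<rightarrow>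
      {(\<beta>, \<epsilon>, x). \<alpha> \<le> \<beta> \<and> \<beta> \<le> \<epsilon> \<and> \<epsilon> \<le> \<gamma> \<and> x \<in> {\<beta>..\<epsilon>} \<rightarrow>\<^sub>E space M}"
    if "i \<in> {(\<beta>, \<epsilon>). \<alpha> \<le> \<beta> \<and> \<beta> \<le> \<epsilon> \<and> \<epsilon> \<le> \<gamma>}" for i
    using that by (cases i) (simp add: space_PiM)
  ultimately show ?thesis
    using assms unfolding traj_space_def
    by (subst nn_integral_glue) (simp_all add: nn_integral_count_space_finite split_def)
qed

definition alive :: "nat \<Rightarrow> 'x traj \<Rightarrow> bool" where
  "alive k = (\<lambda>(\<beta>, \<epsilon>, x). \<beta> \<le> k \<and> k \<le> \<epsilon>)"

definition state_at :: "nat \<Rightarrow> 'x traj \<Rightarrow> 'x" where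
  "state_at k = (\<lambda>(\<beta>, \<epsilon>, x). x k)"

definition traj_restrict :: "nat \<Rightarrow> nat \<Rightarrow> 'x traj \<Rightarrow> 'x traj" where
  "traj_restrict \<alpha> \<gamma> = (\<lambda>(\<beta>, \<epsilon>, x).
     (max \<alpha> \<beta>, min \<gamma> \<epsilon>, restrict x {max \<alpha> \<beta>..min \<gamma> \<epsilon>}))"

definition trajs_in :: "nat \<Rightarrow> nat \<Rightarrow> 'x traj set \<Rightarrow> 'x traj set" where
  "trajs_in \<alpha> \<gamma> S = traj_restrict \<alpha> \<gamma> ` {X \<in> S. \<exists>k\<in>{\<alpha>..\<gamma>}. alive k X}"

definition satisfies_conjunct :: "'i set \<Rightarrow> ('i \<Rightarrow> nat) \<Rightarrow> ('i \<Rightarrow> 'x set) \<Rightarrow> 'x traj \<Rightarrow> bool" where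
  "satisfies_conjunct I t C X \<longleftrightarrow>
     {i \<in> I. alive (t i) X} \<noteq> {} \<and> (\<forall>i \<in> {i \<in> I. alive (t i) X}. state_at (t i) X \<in> C i)"

definition satisfies_disjunct :: "'i set \<Rightarrow> ('i \<Rightarrow> nat) \<Rightarrow> ('i \<Rightarrow> 'x set) \<Rightarrow> 'x traj \<Rightarrow> bool" where
  "satisfies_disjunct I t C X \<longleftrightarrow>
     {i \<in> I. alive (t i) X} \<noteq> {} \<and> (\<exists>i \<in> {i \<in> I. alive (t i) X}. state_at (t i) X \<in> C i)"

text \<open>
  \<open>transition_density m x y\<close> is the density of moving from \<open>x\<close> to \<open>y\<close>, \<open>meas_density m x z\<close> that of
  measuring \<open>z\<close> at \<open>x\<close>.
\<close>

record ('x, 'z) target_model =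
  state_space :: "'x measure"
  meas_space :: "'z measure"
  birth_intensity :: "'x \<Rightarrow> real"
  survival_prob :: "'x \<Rightarrow> real"
  transition_density :: "'x \<Rightarrow> 'x \<Rightarrow> real"
  detection_prob :: "'x \<Rightarrow> real"
  meas_density :: "'x \<Rightarrow> 'z \<Rightarrow> real"
  clutter_intensity :: "'z \<Rightarrow> real"

text \<open>
  The measurable diagonal and the null singletons make two targets almost surely distinct. Otherwise
  a Poisson process is not a random set and \<open>ppp_density\<close> does not integrate to one.
\<close>

definition point_target_model :: "('x, 'z) target_model \<Rightarrow> bool" where
  "point_target_model m \<longleftrightarrow>
     (let M = state_space m; N = meas_space m in
       sigma_finite_measure M \<and>
       {q \<in> space (M \<Otimes>\<^sub>M M). fst q = snd q} \<in> sets (M \<Otimes>\<^sub>M M) \<and>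
       (\<forall>x\<in>space M. emeasure M {x} = 0) \<and>
       is_intensity M (birth_intensity m) \<and>
       survival_prob m \<in> borel_measurable M \<and> (\<forall>x\<in>space M. survival_prob m x \<in> {0..1}) \<and>
       (\<lambda>(x, y). transition_density m x y) \<in> borel_measurable (M \<Otimes>\<^sub>M M) \<and>
       (\<forall>x\<in>space M. is_prob_density M (transition_density m x)) \<and>
       detection_prob m \<in> borel_measurable M \<and> (\<forall>x\<in>space M. detection_prob m x \<in> {0..1}) \<and>
       (\<lambda>(x, z). meas_density m x z) \<in> borel_measurable (M \<Otimes>\<^sub>M N) \<and>
       (\<forall>x\<in>space M. is_prob_density N (meas_density m x)) \<and>
       is_intensity N (clutter_intensity m))"

definition newborn :: "nat \<Rightarrow> 'x \<Rightarrow> 'x traj" where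
  "newborn k x = (k, k, \<lambda>j\<in>{k}. x)"

text \<open>The random trajectory up to time \<open>Suc k\<close> of a target whose trajectory up to time \<open>k\<close> is given.\<close>

definition traj_step :: "('x, 'z) target_model \<Rightarrow> nat \<Rightarrow> 'x traj \<Rightarrow> 'x traj measure" where
  "traj_step m k = (\<lambda>(\<beta>, \<epsilon>, x).
     let T = traj_space (state_space m) 0 (Suc k) in
     if \<epsilon> = k then do {
       s \<leftarrow> measure_pmf (bernoulli_pmf (survival_prob m (x k)));
       if s then do {
         y \<leftarrow> density (state_space m) (\<lambda>y. ennreal (transition_density m (x k) y));
         return T (\<beta>, Suc k, x(Suc k := y))
       } else return T (\<beta>, \<epsilon>, x)
     } else return T (\<beta>, \<epsilon>, x))"

text \<open>
  The law of the set of the trajectories of all targets that have appeared up to time \<open>k\<close>. In the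
  recursive case \<open>h\<close> ranges over the product space indexed by the current trajectories, so that
  they are prolonged independently of each other, and \<open>B\<close> is the set of new target states.
\<close>

primrec all_trajs :: "('x, 'z) target_model \<Rightarrow> nat \<Rightarrow> 'x traj set measure" where
  "all_trajs m 0 = do {
     B \<leftarrow> ppp (state_space m) (birth_intensity m);
     return (finite_sets (traj_space (state_space m) 0 0)) (newborn 0 ` B)
   }"
| "all_trajs m (Suc k) = do {
     S \<leftarrow> all_trajs m k;
     h \<leftarrow> (\<Pi>\<^sub>M X\<in>S. traj_step m k X);
     B \<leftarrow> ppp (state_space m) (birth_intensity m);
     return (finite_sets (traj_space (state_space m) 0 (Suc k))) (h ` S \<union> newborn (Suc k) ` B)
   }"

text \<open>
  The density of the measurement set at time \<open>k\<close> given all trajectories \<open>S\<close>: it is the union of the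
  independent clutter and Bernoulli sets of the targets alive at time \<open>k\<close>.
\<close>

definition meas_set_density ::
    "('x, 'z) target_model \<Rightarrow> nat \<Rightarrow> 'x traj set \<Rightarrow> 'z set \<Rightarrow> real" where
  "meas_set_density m k S Z =
     (\<Sum>D\<in>splits {X \<in> S. alive k X} Z. ppp_density (meas_space m) (clutter_intensity m) (D None) *
        (\<Prod>X\<in>{X \<in> S. alive k X}.
           bernoulli_density (detection_prob m (state_at k X)) (meas_density m (state_at k X))
             (D (Some X))))"

definition likelihood ::
    "('x, 'z) target_model \<Rightarrow> nat \<Rightarrow> nat \<Rightarrow> (nat \<Rightarrow> 'z set) \<Rightarrow> 'x traj set \<Rightarrow> ennreal" where
  "likelihood m \<xi> \<eta> Z S = ennreal (\<Prod>k\<in>{\<xi>..\<eta>}. meas_set_density m k S (Z k))"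

definition evidence ::
    "('x, 'z) target_model \<Rightarrow> nat \<Rightarrow> nat \<Rightarrow> nat \<Rightarrow> (nat \<Rightarrow> 'z set) \<Rightarrow> ennreal" where
  "evidence m K \<xi> \<eta> Z = (\<integral>\<^sup>+S. likelihood m \<xi> \<eta> Z S \<partial>all_trajs m K)"

text \<open>
  Conditioning by Bayes' rule. Here \<open>K\<close> is any time that neither the measurements nor the
  trajectories of interest exceed.
\<close>

definition posterior ::
    "('x, 'z) target_model \<Rightarrow> nat \<Rightarrow> nat \<Rightarrow> nat \<Rightarrow> (nat \<Rightarrow> 'z set) \<Rightarrow> 'x traj set measure" where
  "posterior m K \<xi> \<eta> Z =
     density (all_trajs m K) (\<lambda>S. likelihood m \<xi> \<eta> Z S / evidence m K \<xi> \<eta> Z)"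

end

theory Submission
  imports Defs
begin

text \<open>
  For \<open>T\<^sub>g G A = \<integral> g(y) G(A \<union> {y}) dy\<close> the expectation of \<open>G\<close> under a Poisson process of intensity \<open>g\<close>
  is \<open>exp (- \<integral> g) (exp T\<^sub>g G) {}\<close>, and an independent point with density \<open>p\<close> acts as \<open>T\<^sub>p\<close>. These operators
  commute and are linear in \<open>g\<close>. Moving the points independently only replaces \<open>g\<close> by the intensity
  of the moved points, and adding newborns adds to \<open>g\<close>: the set of all trajectories is Poisson.

  A likelihood \<open>L W\<close> in which each target takes a part \<open>V\<close> of the measurement set \<open>W\<close> with weight
  \<open>l V\<close> satisfies \<open>T\<^sub>g (L W G) = (\<Sum>V \<subseteq> W. L (W - V) T\<^sub>g\<^sub>l\<^sub>V G)\<close>. Deciding for a measurement \<open>w\<close> whether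
  it is clutter or belongs to the part \<open>V\<close> of some target splits off one factor \<open>T\<^sub>g\<^sub>l\<^sub>V\<close>, hence the
  posterior is a finite mixture of \<open>exp T\<^sub>h T\<^sub>1 \<dots> T\<^sub>n\<close>, a Poisson process together with independent
  points. Restricting the trajectories and discarding those that violate the constraints turns
  each \<open>T\<close> into \<open>b + T'\<close> with a constant \<open>b\<close>, the mass that is discarded; so points become
  Bernoulli sets and the Poisson process remains one. Densities exist by the Radon-Nikodym theorem.
\<close>

subsection \<open>Functionals of finite sets\<close>

text \<open>The sigma-algebra on finite sets is the largest one that makes all tuple maps
  measurable, so joint measurability in a set and a further point does not come for free from a
  product space. It is therefore always tested along \<open>finset_maps\<close>, finite sets
  parametrised by finitely many measurable functions. Laws enter only through expectations of
  functionals with values in \<open>ennreal\<close>, so that sums and integrals may be exchanged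
  without integrability conditions. Real weights, existence probabilities and densities are
  extracted only at the end, where the total mass one of the posterior bounds every term of the
  mixture. A second obstacle is that sets forget multiplicities: \<open>insert y A\<close> adds
  nothing if \<open>y\<close> is already in \<open>A\<close>. The recursions for likelihoods and for
  motion hold for new points only, and a diffuse reference measure makes almost every point new. All
  terms of the mixture share one Poisson intensity because every branch of the recursion multiplies
  it by the same factor \<open>l {}\<close>, the weight of a target that takes no
  measurement.\<close>

lemma measurable_glueI:
  assumes g: "\<And>i. i \<in> I \<Longrightarrow> g i \<in> space (N i) \<rightarrow> \<Omega>"
    and f: "\<And>x. x \<in> \<Omega> \<Longrightarrow> f x \<in> space L" "\<And>i. i \<in> I \<Longrightarrow> (\<lambda>x. f (g i x)) \<in> measurable (N i) L"
  shows "f \<in> measurable (glue_measure \<Omega> I c N g) L"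
proof (rule measurableI)
  fix A assume A: "A \<in> sets L"
  have "g i -` (f -` A \<inter> \<Omega>) \<inter> space (N i) = (\<lambda>x. f (g i x)) -` A \<inter> space (N i)" if "i \<in> I" for i
    using g[OF that] by auto
  then show "f -` A \<inter> space (glue_measure \<Omega> I c N g) \<in> sets (glue_measure \<Omega> I c N g)"
    using A f(2) by (auto simp: space_glue sets_glue[OF g] intro: measurable_sets)
qed (use f in \<open>simp add: space_glue\<close>)

lemma space_finite_sets: "space (finite_sets N) = {A. finite A \<and> A \<subseteq> space N}"
  by (simp add: finite_sets_def space_glue)

lemma measurable_finite_setsI:
  assumes "\<And>A. finite A \<Longrightarrow> A \<subseteq> space N \<Longrightarrow> f A \<in> space L"
    and "\<And>n::nat. (\<lambda>x. f (x ` {..<n})) \<in> measurable (\<Pi>\<^sub>M i\<in>{..<n}. N) L"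
  shows "f \<in> measurable (finite_sets N) L"
  unfolding finite_sets_def
  by (intro measurable_glueI assms(2)) (auto simp: space_PiM assms(1))

lemma measurable_tuple_finite_sets:
  "(\<lambda>x. x ` {..<n}) \<in> measurable (\<Pi>\<^sub>M i\<in>{..<n::nat}. N) (finite_sets N)"
  unfolding finite_sets_def by (rule measurable_glue_component) (auto simp: space_PiM)

text \<open>The number of functions is fixed along such a map, while the cardinality of its values
  drops where functions coincide. The inductive form makes induction on the points of a random set
  possible.\<close>

inductive_set finset_maps :: "'w measure \<Rightarrow> 'a measure \<Rightarrow> ('w \<Rightarrow> 'a set) set" for \<Omega> N where
  empty: "(\<lambda>_. {}) \<in> finset_maps \<Omega> N"
| insert: "f \<in> measurable \<Omega> N \<Longrightarrow> S \<in> finset_maps \<Omega> N \<Longrightarrow> (\<lambda>\<omega>. insert (f \<omega>) (S \<omega>)) \<in> finset_maps \<Omega> N"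

lemma finset_maps_image:
  assumes "finite J" "\<And>j. j \<in> J \<Longrightarrow> f j \<in> measurable \<Omega> N"
  shows "(\<lambda>\<omega>. (\<lambda>j. f j \<omega>) ` J) \<in> finset_maps \<Omega> N"
  using assms by (induction J) (auto intro: finset_maps.intros)

lemma finset_maps_indexed:
  assumes "S \<in> finset_maps \<Omega> N"
  shows "\<exists>n f. (\<forall>i<n::nat. f i \<in> measurable \<Omega> N) \<and> S = (\<lambda>\<omega>. (\<lambda>i. f i \<omega>) ` {..<n})"
  using assms
proof induction
  case empty
  show ?case by (rule exI[of _ 0]) simp
next
  case (insert g S)
  then obtain n f where *: "\<forall>i<n::nat. f i \<in> measurable \<Omega> N" "S = (\<lambda>\<omega>. (\<lambda>i. f i \<omega>) ` {..<n})" by blast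
  have "insert (g \<omega>) (S \<omega>) = (\<lambda>i. (f(n := g)) i \<omega>) ` {..<Suc n}" for \<omega>
    by (auto simp: *(2) lessThan_Suc image_iff)
  then show ?case using * insert(1)
    by (intro exI[of _ "Suc n"] exI[of _ "f(n := g)"]) (auto simp: less_Suc_eq)
qed

lemma finset_maps_measurable:
  assumes "S \<in> finset_maps \<Omega> N"
  shows "S \<in> measurable \<Omega> (finite_sets N)"
proof -
  obtain n f where *: "\<forall>i<n::nat. f i \<in> measurable \<Omega> N" "S = (\<lambda>\<omega>. (\<lambda>i. f i \<omega>) ` {..<n})"
    using finset_maps_indexed[OF assms] by blast
  have "(\<lambda>\<omega>. \<lambda>i\<in>{..<n}. f i \<omega>) \<in> measurable \<Omega> (\<Pi>\<^sub>M i\<in>{..<n}. N)"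
    using * by (intro measurable_restrict) auto
  from measurable_compose[OF this measurable_tuple_finite_sets] show ?thesis
    by (simp add: *(2))
qed

lemma finset_maps_compose:
  assumes "S \<in> finset_maps \<Omega> N" and h: "h \<in> measurable \<Omega>' \<Omega>"
  shows "(\<lambda>\<omega>. S (h \<omega>)) \<in> finset_maps \<Omega>' N"
  using assms(1) by induction (auto intro: finset_maps.intros measurable_compose[OF h])

lemma finset_maps_Un:
  assumes "S \<in> finset_maps \<Omega> N" "S' \<in> finset_maps \<Omega> N"
  shows "(\<lambda>\<omega>. S \<omega> \<union> S' \<omega>) \<in> finset_maps \<Omega> N"
  using assms by induction (auto intro: finset_maps.intros)

lemma finset_maps_const:
  assumes "A \<in> space (finite_sets N)"
  shows "(\<lambda>_. A) \<in> finset_maps \<Omega> N"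
proof -
  have "(\<lambda>_. (\<lambda>a. a) ` A) \<in> finset_maps \<Omega> N"
    using assms by (intro finset_maps_image) (auto simp: space_finite_sets)
  then show ?thesis by simp
qed

lemma finset_maps_tuple: "(\<lambda>x. x ` {..<n}) \<in> finset_maps (\<Pi>\<^sub>M i\<in>{..<n::nat}. N) N"
  by (rule finset_maps_image) auto

text \<open>Tuple maps alone would characterise measurability. Allowing every parametrised set makes
  the criterion stable under insertions and unions, so it serves for introduction and for
  elimination.\<close>

lemma measurable_finite_sets_iff:
  "f \<in> measurable (finite_sets N) L \<longleftrightarrow> (\<forall>A. finite A \<and> A \<subseteq> space N \<longrightarrow> f A \<in> space L) \<and>
     (\<forall>n. \<forall>S\<in>finset_maps (\<Pi>\<^sub>M i\<in>{..<n::nat}. N) N. (\<lambda>x. f (S x)) \<in> measurable (\<Pi>\<^sub>M i\<in>{..<n}. N) L)"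
  (is "_ \<longleftrightarrow> ?R")
proof
  assume f: "f \<in> measurable (finite_sets N) L"
  show ?R
  proof (intro conjI allI ballI impI)
    show "f A \<in> space L" if "finite A \<and> A \<subseteq> space N" for A
      using measurable_space[OF f, of A] that by (simp add: space_finite_sets)
  qed (rule measurable_compose[OF finset_maps_measurable f])
next
  assume R: ?R
  show "f \<in> measurable (finite_sets N) L"
  proof (rule measurable_finite_setsI)
    show "(\<lambda>x. f (x ` {..<n})) \<in> measurable (\<Pi>\<^sub>M i\<in>{..<n}. N) L" for n :: nat
      using finset_maps_tuple[of n N] conjunct2[OF R] by metis
  qed (use R in simp)
qed

text \<open>
  The generators of the calculus: the expectation of \<open>G\<close> under a Poisson process of intensity \<open>g\<close> is
  the exponential of \<open>ins_int N g\<close> applied to \<open>G\<close>, at the empty set and up to normalisation.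
\<close>

definition ins_int :: "'a measure \<Rightarrow> ('a \<Rightarrow> ennreal) \<Rightarrow> ('a set \<Rightarrow> ennreal) \<Rightarrow> 'a set \<Rightarrow> ennreal" where
  "ins_int N g G A = (\<integral>\<^sup>+y. g y * G (insert y A) \<partial>N)"

abbreviation fin_meas :: "'a measure \<Rightarrow> ('a set \<Rightarrow> ennreal) set" where
  "fin_meas N \<equiv> borel_measurable (finite_sets N)"

abbreviation fin_subsets :: "'a measure \<Rightarrow> 'a set set" where
  "fin_subsets N \<equiv> space (finite_sets N)"

lemma insert_finite_sets:
  "y \<in> space N \<Longrightarrow> A \<in> fin_subsets N \<Longrightarrow> insert y A \<in> fin_subsets N"
  by (simp add: space_finite_sets)

lemma empty_finite_sets [simp]: "{} \<in> fin_subsets N"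
  by (simp add: space_finite_sets)

lemma insert_measurable:
  assumes "G \<in> fin_meas N" "A \<in> fin_subsets N"
  shows "(\<lambda>y. G (insert y A)) \<in> borel_measurable N"
  by (rule measurable_compose[OF finset_maps_measurable assms(1)])
     (intro finset_maps.insert finset_maps_const assms measurable_ident_sets refl)

text \<open>On the product space the inserted point is just one more parametrising function, which
  gives the joint measurability that integration over \<open>y\<close> requires.\<close>

lemma insert_measurable2:
  assumes "G \<in> fin_meas N" "S \<in> finset_maps \<Omega> N"
  shows "(\<lambda>(\<omega>, y). G (insert y (S \<omega>))) \<in> borel_measurable (\<Omega> \<Otimes>\<^sub>M N)"
  unfolding split_def
  by (rule measurable_compose[OF finset_maps_measurable assms(1)])
     (intro finset_maps.insert finset_maps_compose[OF assms(2)] measurable_fst measurable_snd)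

lemma ins_int_cong:
  assumes "\<And>B. B \<in> fin_subsets N \<Longrightarrow> G B = G' B" "A \<in> fin_subsets N"
  shows "ins_int N g G A = ins_int N g G' A"
  unfolding ins_int_def by (intro nn_integral_cong) (simp add: assms insert_finite_sets)

context sigma_finite_measure
begin

lemma ins_int_measurable:
  assumes [measurable]: "g \<in> borel_measurable M" and G: "G \<in> fin_meas M"
  shows "ins_int M g G \<in> fin_meas M"
  unfolding measurable_finite_sets_iff
proof (intro conjI allI ballI)
  fix n and S assume S: "S \<in> finset_maps (\<Pi>\<^sub>M i\<in>{..<n::nat}. M) M"
  note insert_measurable2[OF G S, measurable]
  show "(\<lambda>x. ins_int M g G (S x)) \<in> borel_measurable (\<Pi>\<^sub>M i\<in>{..<n}. M)"
    unfolding ins_int_def by measurable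
qed simp

text \<open>By Tonelli, since the order of two insertions into a set does not matter.\<close>

lemma ins_int_commute:
  assumes [measurable]: "g \<in> borel_measurable M" "h \<in> borel_measurable M" and G: "G \<in> fin_meas M"
    and A: "A \<in> fin_subsets M"
  shows "ins_int M g (ins_int M h G) A = ins_int M h (ins_int M g G) A"
proof -
  interpret pair_sigma_finite M M ..
  have "(\<lambda>(y, z). G (insert y (insert z A))) \<in> borel_measurable (M \<Otimes>\<^sub>M M)"
    unfolding split_def
    by (rule measurable_compose[OF finset_maps_measurable G])
      (intro finset_maps.insert finset_maps_const A measurable_fst measurable_snd)
  note this[measurable]
  have m1: "(\<lambda>z. G (insert y (insert z A))) \<in> borel_measurable M" if "y \<in> space M" for y
    using that by measurable
  have m2: "(\<lambda>z. G (insert z (insert y A))) \<in> borel_measurable M" if "y \<in> space M" for y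
    using that A by (intro insert_measurable[OF G] insert_finite_sets)
  have "ins_int M g (ins_int M h G) A = (\<integral>\<^sup>+y. \<integral>\<^sup>+z. g y * h z * G (insert y (insert z A)) \<partial>M \<partial>M)"
    unfolding ins_int_def
    by (intro nn_integral_cong) (simp add: nn_integral_cmult[symmetric] m1 m2 insert_commute mult_ac)
  also have "\<dots> = (\<integral>\<^sup>+z. \<integral>\<^sup>+y. g y * h z * G (insert y (insert z A)) \<partial>M \<partial>M)"
    by (rule Fubini'[symmetric]) measurable
  also have "\<dots> = ins_int M h (ins_int M g G) A"
    unfolding ins_int_def
    by (intro nn_integral_cong) (simp add: nn_integral_cmult[symmetric] m1 m2 insert_commute mult_ac)
  finally show ?thesis .
qed

end

subsection \<open>Exponentials of commuting operators\<close>

text \<open>Operators only see the values of a functional on finite subsets of the space.\<close>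

definition fin_op :: "'a measure \<Rightarrow> (('a set \<Rightarrow> ennreal) \<Rightarrow> 'a set \<Rightarrow> ennreal) \<Rightarrow> bool" where
  "fin_op N P \<longleftrightarrow> (\<forall>G\<in>fin_meas N. P G \<in> fin_meas N) \<and>
     (\<forall>G G'. \<forall>A\<in>fin_subsets N. (\<forall>B\<in>fin_subsets N. G B = G' B) \<longrightarrow> P G A = P G' A) \<and>
     (\<forall>G\<in>fin_meas N. \<forall>G'\<in>fin_meas N. \<forall>A\<in>fin_subsets N.
        P (\<lambda>B. G B + G' B) A = P G A + P G' A) \<and>
     (\<forall>c. \<forall>G\<in>fin_meas N. \<forall>A\<in>fin_subsets N. P (\<lambda>B. c * G B) A = c * P G A) \<and>
     (\<forall>G. \<forall>A\<in>fin_subsets N. (\<forall>n::nat. G n \<in> fin_meas N) \<longrightarrow>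
        P (\<lambda>B. \<Sum>n. G n B) A = (\<Sum>n. P (G n) A))"

definition ops_commute :: "'a measure \<Rightarrow> (('a set \<Rightarrow> ennreal) \<Rightarrow> 'a set \<Rightarrow> ennreal) \<Rightarrow>
    (('a set \<Rightarrow> ennreal) \<Rightarrow> 'a set \<Rightarrow> ennreal) \<Rightarrow> bool" where
  "ops_commute N P Q \<longleftrightarrow> (\<forall>G\<in>fin_meas N. \<forall>A\<in>fin_subsets N. P (Q G) A = Q (P G) A)"

lemma fin_opD:
  assumes "fin_op N P"
  shows "G \<in> fin_meas N \<Longrightarrow> P G \<in> fin_meas N"
    and "A \<in> fin_subsets N \<Longrightarrow> (\<And>B. B \<in> fin_subsets N \<Longrightarrow> G B = G' B) \<Longrightarrow> P G A = P G' A"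
    and "G \<in> fin_meas N \<Longrightarrow> G' \<in> fin_meas N \<Longrightarrow> A \<in> fin_subsets N \<Longrightarrow>
        P (\<lambda>B. G B + G' B) A = P G A + P G' A"
    and "G \<in> fin_meas N \<Longrightarrow> A \<in> fin_subsets N \<Longrightarrow> P (\<lambda>B. c * G B) A = c * P G A"
    and "(\<And>n::nat. F n \<in> fin_meas N) \<Longrightarrow> A \<in> fin_subsets N \<Longrightarrow>
        P (\<lambda>B. \<Sum>n. F n B) A = (\<Sum>n. P (F n) A)"
  using assms unfolding fin_op_def by blast+

lemma fin_op_sum:
  assumes "fin_op N P" "finite I" "\<And>i. i \<in> I \<Longrightarrow> F i \<in> fin_meas N" "A \<in> fin_subsets N"
  shows "P (\<lambda>B. \<Sum>i\<in>I. F i B) A = (\<Sum>i\<in>I. P (F i) A)"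
  using assms(2,3)
proof (induction I)
  case empty
  \<comment> \<open>Homogeneity with the scalar 0 shows that an operator maps 0 to 0.\<close>
  have "P (\<lambda>B. 0 * (0::ennreal)) A = 0 * P (\<lambda>_. 0) A"
    by (rule fin_opD(4)[OF assms(1) _ assms(4)]) simp
  then show ?case by simp
next
  case (insert i I)
  then show ?case by (simp add: fin_opD(3)[OF assms(1) _ _ assms(4)])
qed

lemma fin_op_compose:
  assumes P: "fin_op N P" and Q: "fin_op N Q"
  shows "fin_op N (\<lambda>G. P (Q G))"
  unfolding fin_op_def
proof (intro conjI ballI allI impI)
  fix G G' :: "'a set \<Rightarrow> ennreal" and A and c :: ennreal and F :: "nat \<Rightarrow> 'a set \<Rightarrow> ennreal"
  assume A: "A \<in> fin_subsets N"
  note PD = fin_opD[OF P] and QD = fin_opD[OF Q]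
  show "P (Q G) A = P (Q G') A" if "\<forall>B\<in>fin_subsets N. G B = G' B"
    using that by (intro PD(2) QD(2)) (auto simp: A)
  show "P (Q (\<lambda>B. \<Sum>n. F n B)) A = (\<Sum>n. P (Q (F n)) A)" if "\<forall>n. F n \<in> fin_meas N"
  proof -
    have "P (Q (\<lambda>B. \<Sum>n. F n B)) A = P (\<lambda>B. \<Sum>n. Q (F n) B) A"
      using that by (intro PD(2) A QD(5)) auto
    then show ?thesis using that by (simp add: PD(5) QD(1) A)
  qed
  assume G: "G \<in> fin_meas N"
  show "P (Q (\<lambda>B. c * G B)) A = c * P (Q G) A"
  proof -
    have "P (Q (\<lambda>B. c * G B)) A = P (\<lambda>B. c * Q G B) A"
      by (intro PD(2) A QD(4) G)
    then show ?thesis by (simp add: PD(4) QD(1) A G)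
  qed
  show "P (Q (\<lambda>B. G B + G' B)) A = P (Q G) A + P (Q G') A" if "G' \<in> fin_meas N"
  proof -
    have "P (Q (\<lambda>B. G B + G' B)) A = P (\<lambda>B. Q G B + Q G' B) A"
      by (intro PD(2) A QD(3) G that)
    then show ?thesis by (simp add: PD(3) QD(1) A G that)
  qed
qed (intro fin_opD(1)[OF P] fin_opD(1)[OF Q])

lemma fin_op_id: "fin_op N (\<lambda>G. G)"
  by (simp add: fin_op_def)

lemma fin_op_funpow: "fin_op N P \<Longrightarrow> fin_op N (P ^^ n)"
proof (induction n)
  case (Suc n)
  show ?case using fin_op_compose[OF Suc(2) Suc.IH[OF Suc(2)]] by (simp add: o_def)
qed (simp add: fin_op_id id_def)

lemma fin_op_foldr: "(\<And>P. P \<in> set Ps \<Longrightarrow> fin_op N P) \<Longrightarrow> fin_op N (foldr (\<lambda>P G. P G) Ps)"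
proof (induction Ps)
  case (Cons P Ps)
  have "fin_op N (\<lambda>G. P (foldr (\<lambda>P G. P G) Ps G))"
    by (rule fin_op_compose) (use Cons in auto)
  then show ?case by (simp add: o_def)
qed (simp add: fin_op_id id_def)

lemma fin_op_add:
  assumes P: "fin_op N P" and Q: "fin_op N Q"
  shows "fin_op N (\<lambda>G A. P G A + Q G A)"
  unfolding fin_op_def
proof (intro conjI ballI allI impI)
  fix G G' :: "'a set \<Rightarrow> ennreal" and A and c :: ennreal and F :: "nat \<Rightarrow> 'a set \<Rightarrow> ennreal"
  assume A: "A \<in> fin_subsets N"
  note PD = fin_opD[OF P] and QD = fin_opD[OF Q]
  show "P G A + Q G A = P G' A + Q G' A" if "\<forall>B\<in>fin_subsets N. G B = G' B"
    using that A by (intro arg_cong2[of _ _ _ _ "(+)"] PD(2) QD(2)) auto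
  show "P (\<lambda>B. \<Sum>n. F n B) A + Q (\<lambda>B. \<Sum>n. F n B) A = (\<Sum>n. P (F n) A + Q (F n) A)"
    if "\<forall>n. F n \<in> fin_meas N"
    using that by (simp add: PD(5) QD(5) A suminf_add[symmetric])
  assume G: "G \<in> fin_meas N"
  show "P (\<lambda>B. c * G B) A + Q (\<lambda>B. c * G B) A = c * (P G A + Q G A)"
    by (simp add: PD(4) QD(4) A G distrib_left)
  show "P (\<lambda>B. G B + G' B) A + Q (\<lambda>B. G B + G' B) A = P G A + Q G A + (P G' A + Q G' A)"
    if "G' \<in> fin_meas N"
    by (simp add: PD(3) QD(3) A G that ac_simps)
next
  fix G assume "G \<in> fin_meas N"
  then show "(\<lambda>A. P G A + Q G A) \<in> fin_meas N"
    by (intro borel_measurable_add fin_opD(1)[OF P] fin_opD(1)[OF Q])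
qed

lemma ops_commute_funpow:
  assumes "fin_op N P" "fin_op N Q" "ops_commute N P Q"
  shows "ops_commute N (P ^^ n) Q"
proof (induction n)
  case (Suc n)
  show ?case
    unfolding ops_commute_def
  proof (intro ballI)
    fix G A assume G: "G \<in> fin_meas N" and A: "A \<in> fin_subsets N"
    have "P ((P ^^ n) (Q G)) A = P (Q ((P ^^ n) G)) A"
      using Suc G by (intro fin_opD(2)[OF assms(1)] A) (auto simp: ops_commute_def)
    also have "\<dots> = Q (P ((P ^^ n) G)) A"
      using assms(3) fin_opD(1)[OF fin_op_funpow[OF assms(1)] G] A by (auto simp: ops_commute_def)
    finally show "(P ^^ Suc n) (Q G) A = Q ((P ^^ Suc n) G) A" by simp
  qed
qed (simp add: ops_commute_def)

definition op_exp :: "(('a set \<Rightarrow> ennreal) \<Rightarrow> 'a set \<Rightarrow> ennreal) \<Rightarrow> ('a set \<Rightarrow> ennreal) \<Rightarrow> 'a set \<Rightarrow> ennreal" where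
  "op_exp P G A = (\<Sum>n. ennreal (1 / fact n) * (P ^^ n) G A)"

lemma op_exp_measurable:
  assumes "fin_op N P" "G \<in> fin_meas N"
  shows "op_exp P G \<in> fin_meas N"
proof -
  have "(P ^^ n) G \<in> fin_meas N" for n
    by (rule fin_opD(1)[OF fin_op_funpow[OF assms(1)] assms(2)])
  then show ?thesis unfolding op_exp_def by measurable
qed

lemma op_exp_cong:
  assumes "fin_op N P" "A \<in> fin_subsets N" "\<And>B. B \<in> fin_subsets N \<Longrightarrow> G B = G' B"
  shows "op_exp P G A = op_exp P G' A"
  unfolding op_exp_def
  by (intro suminf_cong arg_cong2[of _ _ _ _ "(*)"] refl assms(3)
      fin_opD(2)[OF fin_op_funpow[OF assms(1)] assms(2)])

lemma op_exp_sum: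
  assumes "fin_op N P" "finite I" "\<And>i. i \<in> I \<Longrightarrow> F i \<in> fin_meas N" "A \<in> fin_subsets N"
  shows "op_exp P (\<lambda>B. \<Sum>i\<in>I. F i B) A = (\<Sum>i\<in>I. op_exp P (F i) A)"
  unfolding op_exp_def
  by (simp add: fin_op_sum[OF fin_op_funpow[OF assms(1)] assms(2-4)] sum_distrib_left suminf_sum)

lemma op_exp_cmult:
  assumes "fin_op N P" "G \<in> fin_meas N" "A \<in> fin_subsets N"
  shows "op_exp P (\<lambda>B. c * G B) A = c * op_exp P G A"
  unfolding op_exp_def
  by (simp add: fin_opD(4)[OF fin_op_funpow[OF assms(1)] assms(2,3)] mult.left_commute)

text \<open>The binomial theorem for commuting operators: \<open>Q\<close> is moved past the powers
  of \<open>P\<close>, and Pascal's rule collects the coefficients.\<close>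

lemma funpow_add_commuting_ops:
  assumes P: "fin_op N P" and Q: "fin_op N Q" and PQ: "ops_commute N P Q"
    and G: "G \<in> fin_meas N" and A: "A \<in> fin_subsets N"
  shows "((\<lambda>G A. P G A + Q G A) ^^ n) G A = (\<Sum>k\<le>n. of_nat (n choose k) * (P ^^ k) ((Q ^^ (n - k)) G) A)"
  using A
proof (induction n arbitrary: A)
  case (Suc n)
  let ?a = "\<lambda>k j. (P ^^ k) ((Q ^^ j) G) A"
  have m: "(P ^^ k) ((Q ^^ j) G) \<in> fin_meas N" for k j
    by (intro fin_opD(1)[OF fin_op_funpow] P Q G)
  have cm: "Q ((P ^^ k) ((Q ^^ j) G)) A = ?a k (Suc j)" for k j
    using ops_commute_funpow[OF P Q PQ, of k] fin_opD(1)[OF fin_op_funpow[OF Q] G, of j] Suc(2)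
    unfolding ops_commute_def by (simp add: o_def)
  have step: "R (((\<lambda>G A. P G A + Q G A) ^^ n) G) A =
      (\<Sum>k\<le>n. of_nat (n choose k) * R ((P ^^ k) ((Q ^^ (n - k)) G)) A)" if R: "fin_op N R" for R
  proof -
    have "R (((\<lambda>G A. P G A + Q G A) ^^ n) G) A =
        R (\<lambda>A. \<Sum>k\<le>n. of_nat (n choose k) * (P ^^ k) ((Q ^^ (n - k)) G) A) A"
      by (intro fin_opD(2)[OF R] Suc)
    also have "\<dots> = (\<Sum>k\<le>n. R (\<lambda>A. of_nat (n choose k) * (P ^^ k) ((Q ^^ (n - k)) G) A) A)"
      using m Suc(2) by (intro fin_op_sum[OF R]) auto
    finally show ?thesis using m Suc(2) by (simp add: fin_opD(4)[OF R])
  qed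
  have "((\<lambda>G A. P G A + Q G A) ^^ Suc n) G A =
      (\<Sum>k\<le>n. of_nat (n choose k) * ?a (Suc k) (n - k)) + (\<Sum>k\<le>n. of_nat (n choose k) * ?a k (Suc n - k))"
    using step[OF P] step[OF Q] by (simp add: cm Suc_diff_le)
  \<comment> \<open>The added term vanishes because \<open>n choose Suc n\<close> is 0.\<close>
  also have "(\<Sum>k\<le>n. of_nat (n choose k) * ?a k (Suc n - k)) =
      (\<Sum>k\<le>Suc n. of_nat (n choose k) * ?a k (Suc n - k))"
    by simp
  also have "\<dots> = ?a 0 (Suc n) + (\<Sum>k\<le>n. of_nat (n choose Suc k) * ?a (Suc k) (n - k))"
    by (subst sum.atMost_Suc_shift) simp
  also have "(\<Sum>k\<le>n. of_nat (n choose k) * ?a (Suc k) (n - k)) + \<dots> =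
      ?a 0 (Suc n) + (\<Sum>k\<le>n. of_nat (Suc n choose Suc k) * ?a (Suc k) (n - k))"
    by (simp add: sum.distrib distrib_right add_ac)
  also have "\<dots> = (\<Sum>k\<le>Suc n. of_nat (Suc n choose k) * ?a k (Suc n - k))"
    by (subst sum.atMost_Suc_shift[of _ n]) (simp del: binomial_Suc_Suc)
  finally show ?case .
qed simp

text \<open>Tonelli for counting measure: summing over the triangle \<open>k \<le> n\<close> first
  along \<open>n\<close> instead of along \<open>k\<close> and shifting by \<open>k\<close> gives
  the Cauchy product.\<close>

lemma suminf_triangle_ennreal:
  fixes a :: "nat \<Rightarrow> nat \<Rightarrow> ennreal"
  shows "(\<Sum>n. \<Sum>k\<le>n. a k (n - k)) = (\<Sum>k. \<Sum>j. a k j)"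
proof -
  have "(\<Sum>n. \<Sum>k\<le>n. a k (n - k)) = (\<Sum>n. \<Sum>k. if k \<le> n then a k (n - k) else 0)"
    by (intro suminf_cong, subst suminf_finite[of "{..n}" for n]) auto
  also have "\<dots> = (\<integral>\<^sup>+n. \<integral>\<^sup>+k. (if k \<le> n then a k (n - k) else 0) \<partial>count_space UNIV \<partial>count_space UNIV)"
    by (simp add: nn_integral_count_space_nat)
  also have "\<dots> = (\<integral>\<^sup>+k. \<integral>\<^sup>+n. (if k \<le> n then a k (n - k) else 0) \<partial>count_space UNIV \<partial>count_space UNIV)"
    by (rule nn_integral_count_space_nn_integral) auto
  also have "\<dots> = (\<Sum>k. \<Sum>n. if k \<le> n then a k (n - k) else 0)"
    by (simp add: nn_integral_count_space_nat)
  also have "\<dots> = (\<Sum>k. \<Sum>j. a k j)"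
  proof (rule suminf_cong)
    show "(\<Sum>n. if k \<le> n then a k (n - k) else 0) = (\<Sum>j. a k j)" for k
      using suminf_offset[of "\<lambda>n. if k \<le> n then a k (n - k) else 0" k] by simp
  qed
  finally show ?thesis .
qed

text \<open>As for numbers, the binomial expansion of the powers is the Cauchy product of two
  exponential series; commutation is what the expansion rests on.\<close>

lemma op_exp_add:
  assumes P: "fin_op N P" and Q: "fin_op N Q" and PQ: "ops_commute N P Q"
    and G: "G \<in> fin_meas N" and A: "A \<in> fin_subsets N"
  shows "op_exp (\<lambda>G A. P G A + Q G A) G A = op_exp P (op_exp Q G) A"
proof -
  let ?a = "\<lambda>k j. ennreal (1 / fact k) * (ennreal (1 / fact j) * (P ^^ k) ((Q ^^ j) G) A)"
  have m: "(Q ^^ j) G \<in> fin_meas N" for j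
    by (intro fin_opD(1)[OF fin_op_funpow] Q G)
  have c: "ennreal (1 / fact n) * of_nat (n choose k) = ennreal (1 / fact k) * ennreal (1 / fact (n - k))"
    if "k \<le> n" for n k
  proof -
    have "1 / fact n * real (n choose k) = 1 / fact k * (1 / fact (n - k))"
      using that by (simp add: binomial_fact field_simps)
    then show ?thesis
      by (simp only: ennreal_of_nat_eq_real_of_nat ennreal_mult'[symmetric] of_nat_0_le_iff
          divide_nonneg_nonneg zero_le_one fact_ge_zero)
  qed
  have "op_exp (\<lambda>G A. P G A + Q G A) G A = (\<Sum>n. \<Sum>k\<le>n. ?a k (n - k))"
    unfolding op_exp_def funpow_add_commuting_ops[OF P Q PQ G A] sum_distrib_left
    by (intro suminf_cong sum.cong refl) (simp add: c mult.assoc[symmetric])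
  also have "\<dots> = (\<Sum>k. \<Sum>j. ?a k j)" by (rule suminf_triangle_ennreal)
  also have "\<dots> = op_exp P (op_exp Q G) A"
    unfolding op_exp_def[of P]
  proof (intro suminf_cong)
    fix k
    have "(P ^^ k) (op_exp Q G) A = (\<Sum>j. (P ^^ k) (\<lambda>A. ennreal (1 / fact j) * (Q ^^ j) G A) A)"
      unfolding op_exp_def using m by (intro fin_opD(5)[OF fin_op_funpow[OF P]] A) measurable
    then show "(\<Sum>j. ?a k j) = ennreal (1 / fact k) * (P ^^ k) (op_exp Q G) A"
      by (simp add: fin_opD(4)[OF fin_op_funpow[OF P] m A])
  qed
  finally show ?thesis .
qed

lemma fin_op_cmult: "fin_op N (\<lambda>G A. c * G A)"
  by (auto simp: fin_op_def distrib_left mult.left_commute)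

text \<open>In this form the discarded mass of a thinned Poisson process becomes a scalar factor
  \<open>exp b\<close>.\<close>

lemma op_exp_cmult_op: "op_exp (\<lambda>G A. ennreal b * G A) G A = ennreal (exp b) * G A" if "0 \<le> b"
proof -
  have *: "((\<lambda>G A. ennreal b * G A) ^^ n) G A = ennreal (b ^ n) * G A" for n
    using that by (induction n) (auto simp: ennreal_mult mult_ac)
  have "(\<Sum>n. ennreal (1 / fact n) * ennreal (b ^ n)) = (\<Sum>n. ennreal (b ^ n /\<^sub>R fact n))"
    using that by (intro suminf_cong) (simp add: ennreal_mult'[symmetric] field_simps)
  also have "\<dots> = ennreal (exp b)"
    using that unfolding exp_def by (intro suminf_ennreal2 summable_exp_generic) auto
  finally show ?thesis
    by (simp add: op_exp_def * mult.assoc[symmetric])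
qed

context sigma_finite_measure
begin

lemma fin_op_ins_int:
  assumes [measurable]: "g \<in> borel_measurable M"
  shows "fin_op M (ins_int M g)"
  unfolding fin_op_def
proof (intro conjI ballI allI impI)
  fix A assume A: "A \<in> fin_subsets M"
  note m = insert_measurable[OF _ A, measurable]
  show "ins_int M g G A = ins_int M g G' A" if "\<forall>B\<in>fin_subsets M. G B = G' B" for G G'
    using that A by (intro ins_int_cong) auto
  show "ins_int M g (\<lambda>B. \<Sum>n. F n B) A = (\<Sum>n. ins_int M g (F n) A)"
    if "\<forall>n. F n \<in> fin_meas M" for F :: "nat \<Rightarrow> _"
  proof -
    have [measurable]: "(\<lambda>y. F n (insert y A)) \<in> borel_measurable M" for n
      using that by (intro m) auto
    show ?thesis unfolding ins_int_def by (subst nn_integral_suminf[symmetric]) auto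
  qed
  fix G assume G: "G \<in> fin_meas M"
  show "ins_int M g (\<lambda>B. c * G B) A = c * ins_int M g G A" for c
    unfolding ins_int_def using m[OF G] by (subst nn_integral_cmult[symmetric]) (auto simp: mult_ac)
  show "ins_int M g (\<lambda>B. G B + G' B) A = ins_int M g G A + ins_int M g G' A" if "G' \<in> fin_meas M" for G'
    unfolding ins_int_def using m[OF G] m[OF that]
    by (subst nn_integral_add[symmetric]) (auto simp: distrib_left)
qed (auto intro: ins_int_measurable)

lemma ops_commute_ins_int:
  "g \<in> borel_measurable M \<Longrightarrow> h \<in> borel_measurable M \<Longrightarrow> ops_commute M (ins_int M g) (ins_int M h)"
  by (simp add: ops_commute_def ins_int_commute)

lemma ins_int_add_weight:
  assumes [measurable]: "g \<in> borel_measurable M" "h \<in> borel_measurable M" and G: "G \<in> fin_meas M"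
    and A: "A \<in> fin_subsets M"
  shows "ins_int M (\<lambda>y. g y + h y) G A = ins_int M g G A + ins_int M h G A"
  unfolding ins_int_def using insert_measurable[OF G A]
  by (subst nn_integral_add[symmetric]) (auto simp: distrib_right)

text \<open>Peeling off one coordinate of an n-fold product integral is one application of the
  generator with weight 1, and the factor 1/n! of the set integral is that of the exponential
  series. Explicit densities thereby enter the calculus.\<close>

lemma nn_integral_finite_sets_eq_op_exp:
  assumes G: "G \<in> fin_meas M"
  shows "(\<integral>\<^sup>+A. G A \<partial>finite_sets M) = op_exp (ins_int M (\<lambda>_. 1)) G {}"
proof -
  interpret P: product_sigma_finite "\<lambda>_::nat. M" ..
  have "(\<integral>\<^sup>+x. G (x ` {..<n}) \<partial>(\<Pi>\<^sub>M i\<in>{..<n}. M)) = (ins_int M (\<lambda>_. 1) ^^ n) G {}" for n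
    using G
  proof (induction n arbitrary: G)
    case (Suc n)
    have "(\<integral>\<^sup>+x. G (x ` {..<Suc n}) \<partial>(\<Pi>\<^sub>M i\<in>{..<Suc n}. M)) =
        (\<integral>\<^sup>+x. \<integral>\<^sup>+y. G ((x(n := y)) ` {..<Suc n}) \<partial>M \<partial>(\<Pi>\<^sub>M i\<in>{..<n}. M))"
      unfolding lessThan_Suc using Suc(2) measurable_tuple_finite_sets[of "Suc n" M]
      by (subst P.product_nn_integral_insert) (auto intro: measurable_compose simp: lessThan_Suc)
    also have "\<dots> = (\<integral>\<^sup>+x. ins_int M (\<lambda>_. 1) G (x ` {..<n}) \<partial>(\<Pi>\<^sub>M i\<in>{..<n}. M))"
      unfolding ins_int_def
    proof (intro nn_integral_cong)
      fix x :: "nat \<Rightarrow> 'a" and y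
      have "(x(n := y)) ` {..<Suc n} = insert y (x ` {..<n})" by (auto simp: lessThan_Suc image_iff)
      then show "G ((x(n := y)) ` {..<Suc n}) = 1 * G (insert y (x ` {..<n}))" by simp
    qed
    also have "\<dots> = (ins_int M (\<lambda>_. 1) ^^ n) (ins_int M (\<lambda>_. 1) G) {}"
      by (intro Suc.IH ins_int_measurable Suc) simp
    finally show "(\<integral>\<^sup>+x. G (x ` {..<Suc n}) \<partial>(\<Pi>\<^sub>M i\<in>{..<Suc n}. M)) = (ins_int M (\<lambda>_. 1) ^^ Suc n) G {}"
      by (simp add: funpow_swap1)
  qed (simp add: P.nn_integral_empty del: nn_integral_const)
  moreover have "(1 / fact n :: ennreal) = ennreal (1 / fact n)" for n
    using divide_ennreal[of 1 "fact n"] ennreal_of_nat_eq_real_of_nat[of "fact n"] by simp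
  ultimately show ?thesis
    by (simp add: nn_integral_finite_sets[OF G] op_exp_def)
qed

end

subsection \<open>Likelihoods and Poisson multi-Bernoulli mixtures\<close>

locale diffuse_measure = sigma_finite_measure M for M :: "'a measure" +
  assumes diagonal: "{q \<in> space (M \<Otimes>\<^sub>M M). fst q = snd q} \<in> sets (M \<Otimes>\<^sub>M M)"
    and null_singleton: "x \<in> space M \<Longrightarrow> emeasure M {x} = 0"
begin

lemma sets_eq:
  assumes "f \<in> measurable \<Omega> M" "h \<in> measurable \<Omega> M"
  shows "{\<omega> \<in> space \<Omega>. f \<omega> = h \<omega>} \<in> sets \<Omega>"
proof -
  have "(\<lambda>\<omega>. (f \<omega>, h \<omega>)) -` {q \<in> space (M \<Otimes>\<^sub>M M). fst q = snd q} \<inter> space \<Omega> \<in> sets \<Omega>"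
    by (rule measurable_sets[OF _ diagonal]) (use assms in measurable)
  also have "(\<lambda>\<omega>. (f \<omega>, h \<omega>)) -` {q \<in> space (M \<Otimes>\<^sub>M M). fst q = snd q} \<inter> space \<Omega> =
      {\<omega> \<in> space \<Omega>. f \<omega> = h \<omega>}"
    using measurable_space[OF assms(1)] measurable_space[OF assms(2)] by (auto simp: space_pair_measure)
  finally show ?thesis .
qed

text \<open>Measurability of the diagonal makes the coincidence of two functions an event; the lemma
  serves to distinguish repeated points from new ones in a measurable way.\<close>

lemma sets_mem_finset_map:
  assumes S: "S \<in> finset_maps \<Omega> M" and f: "f \<in> measurable \<Omega> M"
  shows "{\<omega> \<in> space \<Omega>. f \<omega> \<in> S \<omega>} \<in> sets \<Omega>"
  using S
proof induction
  case (insert h S)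
  have "{\<omega> \<in> space \<Omega>. f \<omega> \<in> insert (h \<omega>) (S \<omega>)} = {\<omega> \<in> space \<Omega>. f \<omega> = h \<omega>} \<union> {\<omega> \<in> space \<Omega>. f \<omega> \<in> S \<omega>}"
    by auto
  then show ?case using insert sets_eq[OF f insert(1)] by simp
qed simp

text \<open>Finitely many null singletons form a null set, so an integral over an inserted point
  sees new points only.\<close>

lemma AE_not_in_finite:
  assumes "A \<in> fin_subsets M"
  shows "AE y in M. y \<notin> A"
proof -
  have "AE y in M. \<forall>x\<in>A. y \<noteq> x"
  proof (rule AE_finite_allI)
    fix x assume "x \<in> A"
    then have x: "x \<in> space M" using assms by (auto simp: space_finite_sets)
    have "{y \<in> space M. y = x} \<in> sets M"
      by (rule sets_eq) (use x in auto)
    moreover have "{y \<in> space M. y = x} = {x}" using x by auto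
    ultimately show "AE y in M. y \<noteq> x"
      using null_singleton[OF x] by (intro AE_I[of _ _ "{x}"]) auto
  qed (use assms in \<open>simp add: space_finite_sets\<close>)
  then show ?thesis by eventually_elim auto
qed

end

section \<open>Finite mixtures and their closure properties\<close>

definition ins_ints :: "'a measure \<Rightarrow> ('a \<Rightarrow> ennreal) list \<Rightarrow> ('a set \<Rightarrow> ennreal) \<Rightarrow> 'a set \<Rightarrow> ennreal" where
  "ins_ints N gs = foldr (ins_int N) gs"

lemma ins_ints_simps [simp]:
  "ins_ints N [] G = G" "ins_ints N (g # gs) G = ins_int N g (ins_ints N gs G)"
  "ins_ints N (gs @ [g]) G = ins_ints N gs (ins_int N g G)"
  by (simp_all add: ins_ints_def)

lemma (in sigma_finite_measure) fin_op_ins_ints: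
  assumes "set gs \<subseteq> borel_measurable M"
  shows "fin_op M (ins_ints M gs)"
proof -
  have "fin_op M (foldr (\<lambda>P. P) (map (ins_int M) gs))"
    using assms by (intro fin_op_foldr) (auto intro: fin_op_ins_int)
  moreover have "foldr (\<lambda>P. P) (map (ins_int M) gs) = foldr (ins_int M) gs"
    by (induction gs) auto
  ultimately show ?thesis by (simp add: ins_ints_def)
qed

text \<open>
  Up to normalisation, these are the expectations with respect to mixtures of the union of a Poisson
  process of intensity \<open>g\<close> and finitely many independent points.
\<close>

definition pmb_mixture :: "'a measure \<Rightarrow> ('a \<Rightarrow> ennreal) \<Rightarrow> (('a set \<Rightarrow> ennreal) \<Rightarrow> ennreal) \<Rightarrow> bool" where
  "pmb_mixture N g \<Psi> \<longleftrightarrow> (\<exists>hs. (\<forall>(c, gs)\<in>set hs. set gs \<subseteq> borel_measurable N) \<and>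
     (\<forall>G\<in>fin_meas N. \<Psi> G = (\<Sum>(c, gs)\<leftarrow>hs. c * op_exp (ins_int N g) (ins_ints N gs G) {})))"

lemma pmb_mixture_cong:
  assumes "pmb_mixture N g \<Psi>" "\<And>G. G \<in> fin_meas N \<Longrightarrow> \<Psi>' G = \<Psi> G"
  shows "pmb_mixture N g \<Psi>'"
  using assms unfolding pmb_mixture_def by simp

lemma pmb_mixture_single:
  assumes "set gs \<subseteq> borel_measurable N"
  shows "pmb_mixture N g (\<lambda>G. op_exp (ins_int N g) (ins_ints N gs G) {})"
  unfolding pmb_mixture_def using assms by (intro exI[of _ "[(1, gs)]"]) auto

lemma pmb_mixture_add:
  assumes "pmb_mixture N g \<Psi>" "pmb_mixture N g \<Psi>'"
  shows "pmb_mixture N g (\<lambda>G. \<Psi> G + \<Psi>' G)"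
proof -
  obtain hs where hs: "\<forall>(c, gs)\<in>set hs. set gs \<subseteq> borel_measurable N"
    "\<And>G. G \<in> fin_meas N \<Longrightarrow> \<Psi> G = (\<Sum>(c, gs)\<leftarrow>hs. c * op_exp (ins_int N g) (ins_ints N gs G) {})"
    using assms(1) unfolding pmb_mixture_def by blast
  obtain hs' where hs': "\<forall>(c, gs)\<in>set hs'. set gs \<subseteq> borel_measurable N"
    "\<And>G. G \<in> fin_meas N \<Longrightarrow> \<Psi>' G = (\<Sum>(c, gs)\<leftarrow>hs'. c * op_exp (ins_int N g) (ins_ints N gs G) {})"
    using assms(2) unfolding pmb_mixture_def by blast
  show ?thesis unfolding pmb_mixture_def
    using hs hs' by (intro exI[of _ "hs @ hs'"]) auto
qed

lemma pmb_mixture_cmult: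
  assumes "pmb_mixture N g \<Psi>"
  shows "pmb_mixture N g (\<lambda>G. c * \<Psi> G)"
proof -
  obtain hs where hs: "\<forall>(c, gs)\<in>set hs. set gs \<subseteq> borel_measurable N"
    "\<And>G. G \<in> fin_meas N \<Longrightarrow> \<Psi> G = (\<Sum>(c, gs)\<leftarrow>hs. c * op_exp (ins_int N g) (ins_ints N gs G) {})"
    using assms(1) unfolding pmb_mixture_def by blast
  show ?thesis unfolding pmb_mixture_def
    using hs by (intro exI[of _ "map (\<lambda>(c', gs). (c * c', gs)) hs"])
      (auto simp: sum_list_const_mult[symmetric] o_def split_def mult.assoc)
qed

lemma pmb_mixture_zero: "pmb_mixture N g (\<lambda>G. 0)"
  unfolding pmb_mixture_def by (intro exI[of _ "[]"]) auto

lemma pmb_mixture_sum: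
  assumes "finite I" "\<And>i. i \<in> I \<Longrightarrow> pmb_mixture N g (\<Psi> i)"
  shows "pmb_mixture N g (\<lambda>G. \<Sum>i\<in>I. \<Psi> i G)"
  using assms by (induction I) (auto intro: pmb_mixture_zero pmb_mixture_add)

lemma pmb_mixture_sum_list:
  assumes "\<And>i. i \<in> set xs \<Longrightarrow> pmb_mixture N g (\<Psi> i)"
  shows "pmb_mixture N g (\<lambda>G. \<Sum>i\<leftarrow>xs. \<Psi> i G)"
  using assms by (induction xs) (auto intro: pmb_mixture_zero pmb_mixture_add)

text \<open>The new operator acts on \<open>G\<close> before all others, so its weight is appended
  at the end of each list.\<close>

lemma (in sigma_finite_measure) pmb_mixture_ins_int:
  assumes "pmb_mixture M g \<Psi>" and h: "h \<in> borel_measurable M"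
  shows "pmb_mixture M g (\<lambda>G. \<Psi> (ins_int M h G))"
proof -
  obtain hs where hs: "\<forall>(c, gs)\<in>set hs. set gs \<subseteq> borel_measurable M"
    "\<And>G. G \<in> fin_meas M \<Longrightarrow> \<Psi> G = (\<Sum>(c, gs)\<leftarrow>hs. c * op_exp (ins_int M g) (ins_ints M gs G) {})"
    using assms(1) unfolding pmb_mixture_def by blast
  show ?thesis unfolding pmb_mixture_def
    using hs h ins_int_measurable[OF h]
    by (intro exI[of _ "map (\<lambda>(c, gs). (c, gs @ [h])) hs"]) (auto simp: o_def split_def)
qed

text \<open>
  The recursion has two instances: \<open>L W A\<close> is the likelihood of the measurement set \<open>W\<close> given the
  targets \<open>A\<close>, or the density at \<open>A\<close> of a Poisson multi-Bernoulli process with track set \<open>W\<close>, where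
  \<open>clut w\<close> is the probability that the track \<open>w\<close> does not exist.
\<close>

locale tilted_measure = diffuse_measure M for M :: "'a measure" +
  fixes L :: "'w set \<Rightarrow> 'a set \<Rightarrow> ennreal" and l :: "'w set \<Rightarrow> 'a \<Rightarrow> ennreal"
    and clut :: "'w \<Rightarrow> ennreal" and W0 :: "'w set"
  assumes finite_W0: "finite W0"
    and l_measurable: "V \<subseteq> W0 \<Longrightarrow> l V \<in> borel_measurable M"
    and L_insert: "W \<subseteq> W0 \<Longrightarrow> y \<in> space M \<Longrightarrow> A \<in> fin_subsets M \<Longrightarrow> y \<notin> A \<Longrightarrow>
      L W (insert y A) = (\<Sum>V\<in>Pow W. l V y * L (W - V) A)"
    and L_empty: "W \<subseteq> W0 \<Longrightarrow> w \<in> W \<Longrightarrow> L W {} = clut w * L (W - {w}) {}"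
begin

text \<open>Induction on the parametrised set: where the inserted function repeats an earlier point
  the set does not change, elsewhere \<open>L_insert\<close> expresses \<open>L\<close> through the
  smaller set. Membership is an event, so the two cases may be glued.\<close>

lemma L_finset_map_measurable:
  assumes "S \<in> finset_maps \<Omega> M" "W \<subseteq> W0"
  shows "(\<lambda>\<omega>. L W (S \<omega>)) \<in> borel_measurable \<Omega>"
  using assms
proof (induction arbitrary: W)
  case (insert f S)
  have S: "S \<omega> \<in> fin_subsets M" "f \<omega> \<in> space M" if "\<omega> \<in> space \<Omega>" for \<omega>
    using measurable_space[OF finset_maps_measurable[OF insert(2)] that] measurable_space[OF insert(1) that]
    by auto
  have "(\<lambda>\<omega>. if f \<omega> \<in> S \<omega> then L W (S \<omega>) else \<Sum>V\<in>Pow W. l V (f \<omega>) * L (W - V) (S \<omega>))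
      \<in> borel_measurable \<Omega>"
  proof (intro measurable_If sets_mem_finset_map insert borel_measurable_sum borel_measurable_times_ennreal)
    fix V assume "V \<in> Pow W"
    then show "(\<lambda>\<omega>. l V (f \<omega>)) \<in> borel_measurable \<Omega>" "W - V \<subseteq> W0"
      using insert.prems by (auto intro: measurable_compose[OF insert(1)] l_measurable)
  qed
  then show ?case
    by (rule measurable_cong[THEN iffD1, rotated])
       (use S L_insert[OF insert.prems] in \<open>auto simp: insert_absorb\<close>)
qed simp

lemma L_measurable: "W \<subseteq> W0 \<Longrightarrow> L W \<in> fin_meas M"
  unfolding measurable_finite_sets_iff by (auto intro: L_finset_map_measurable)

lemma LG_measurable: "W \<subseteq> W0 \<Longrightarrow> G \<in> fin_meas M \<Longrightarrow> (\<lambda>A. L W A * G A) \<in> fin_meas M"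
  using L_measurable by measurable

lemma finite_W: "W \<subseteq> W0 \<Longrightarrow> finite W"
  using finite_W0 finite_subset by blast

lemma gl_measurable [measurable]:
  "g \<in> borel_measurable M \<Longrightarrow> V \<subseteq> W0 \<Longrightarrow> (\<lambda>y. g y * l V y) \<in> borel_measurable M"
  using l_measurable[of V] by (intro borel_measurable_times_ennreal)

text \<open>Almost every inserted point is new, so \<open>L_insert\<close> may be applied under the
  integral; the inserted point takes \<open>V\<close> and leaves \<open>W - V\<close> to the
  others.\<close>

lemma ins_int_tilt:
  assumes W: "W \<subseteq> W0" and g[measurable]: "g \<in> borel_measurable M" and G: "G \<in> fin_meas M"
    and A: "A \<in> fin_subsets M"
  shows "ins_int M g (\<lambda>A. L W A * G A) A = (\<Sum>V\<in>Pow W. L (W - V) A * ins_int M (\<lambda>y. g y * l V y) G A)"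
proof -
  note insert_measurable[OF G A, measurable]
  have "ins_int M g (\<lambda>A. L W A * G A) A =
      (\<integral>\<^sup>+y. (\<Sum>V\<in>Pow W. L (W - V) A * (g y * l V y * G (insert y A))) \<partial>M)"
    unfolding ins_int_def using AE_not_in_finite[OF A] AE_space
  proof (intro nn_integral_cong_AE, eventually_elim)
    fix y assume y: "y \<notin> A" "y \<in> space M"
    show "g y * (L W (insert y A) * G (insert y A)) =
        (\<Sum>V\<in>Pow W. L (W - V) A * (g y * l V y * G (insert y A)))"
      unfolding L_insert[OF W y(2) A y(1)] sum_distrib_left sum_distrib_right by (simp add: ac_simps)
  qed
  also have "\<dots> = (\<Sum>V\<in>Pow W. \<integral>\<^sup>+y. L (W - V) A * (g y * l V y * G (insert y A)) \<partial>M)"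
    using W by (intro nn_integral_sum) (auto intro!: borel_measurable_times_ennreal l_measurable insert_measurable[OF G A])
  also have "\<dots> = (\<Sum>V\<in>Pow W. L (W - V) A * ins_int M (\<lambda>y. g y * l V y) G A)"
    unfolding ins_int_def using W
    by (intro sum.cong refl nn_integral_cmult)
       (auto intro!: borel_measurable_times_ennreal l_measurable insert_measurable[OF G A])
  finally show ?thesis .
qed

lemma op_ins_int_tilt:
  assumes P: "fin_op M P" and W: "W \<subseteq> W0" and g: "g \<in> borel_measurable M" and G: "G \<in> fin_meas M"
    and A: "A \<in> fin_subsets M"
  shows "P (ins_int M g (\<lambda>A. L W A * G A)) A =
    (\<Sum>V\<in>Pow W. P (\<lambda>A. L (W - V) A * ins_int M (\<lambda>y. g y * l V y) G A) A)"
proof -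
  have "P (ins_int M g (\<lambda>A. L W A * G A)) A =
      P (\<lambda>A. \<Sum>V\<in>Pow W. L (W - V) A * ins_int M (\<lambda>y. g y * l V y) G A) A"
    by (intro fin_opD(2)[OF P] A ins_int_tilt W g G)
  also have "\<dots> = (\<Sum>V\<in>Pow W. P (\<lambda>A. L (W - V) A * ins_int M (\<lambda>y. g y * l V y) G A) A)"
    using finite_W[OF W] W g G
    by (intro fin_op_sum[OF P] A LG_measurable ins_int_measurable gl_measurable) auto
  finally show ?thesis .
qed

text \<open>Either \<open>w\<close> is clutter, or one of the \<open>n\<close> points takes a set \<open>V\<close> containing \<open>w\<close>.\<close>

lemma funpow_ins_int_tilt:
  assumes g: "g \<in> borel_measurable M" and W: "W \<subseteq> W0" and w: "w \<in> W" and G: "G \<in> fin_meas M"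
  shows "(ins_int M g ^^ n) (\<lambda>A. L W A * G A) {} =
    clut w * (ins_int M g ^^ n) (\<lambda>A. L (W - {w}) A * G A) {} +
    of_nat n * (\<Sum>V\<in>{V \<in> Pow W. w \<in> V}.
      (ins_int M g ^^ (n - 1)) (\<lambda>A. L (W - V) A * ins_int M (\<lambda>y. g y * l V y) G A) {})"
  using W w G
proof (induction n arbitrary: W G)
  \<comment> \<open>With no point left, \<open>w\<close> can only be clutter.\<close>
  case 0
  then show ?case by (simp add: L_empty[of W w] mult.assoc)
next
  case (Suc n)
  note W = Suc.prems(1) and w = Suc.prems(2) and G = Suc.prems(3)
  define P where "P = ins_int M g"
  define Q where "Q V = ins_int M (\<lambda>y. g y * l V y)" for V
  define LG where "LG W G = (\<lambda>A. L W A * G A)" for W G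
  have P: "fin_op M P" unfolding P_def by (rule fin_op_ins_int[OF g])
  have tilt: "(P ^^ Suc n) (LG W G) {} = (\<Sum>V\<in>Pow W. (P ^^ n) (LG (W - V) (Q V G)) {})"
    if "W \<subseteq> W0" "G \<in> fin_meas M" for n W G
    unfolding funpow_Suc_right o_def P_def LG_def Q_def
    by (rule op_ins_int_tilt[OF fin_op_funpow[OF fin_op_ins_int[OF g]]]) (use that g in auto)
  have Qm: "Q V G \<in> fin_meas M" if "V \<subseteq> W0" "G \<in> fin_meas M" for V G
    unfolding Q_def by (intro ins_int_measurable gl_measurable g that)
  have fin: "finite W" by (rule finite_W[OF W])
  let ?N = "{V \<in> Pow W. w \<in> V}"
  \<comment> \<open>The first point takes a part \<open>V\<close>. If \<open>w\<close> is in
    \<open>V\<close>, the fate of \<open>w\<close> is settled; otherwise the induction hypothesis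
    for \<open>W - V\<close> decides it.\<close>
  have split: "Pow W = Pow (W - {w}) \<union> ?N" "Pow (W - {w}) \<inter> ?N = {}" by auto
  have "(P ^^ Suc n) (LG W G) {} = (\<Sum>V\<in>Pow W. (P ^^ n) (LG (W - V) (Q V G)) {})"
    by (rule tilt[OF W G])
  also have "\<dots> = (\<Sum>V\<in>Pow (W - {w}). (P ^^ n) (LG (W - V) (Q V G)) {}) +
      (\<Sum>V\<in>?N. (P ^^ n) (LG (W - V) (Q V G)) {})"
    using fin by (subst split(1), intro sum.union_disjoint) auto
  also have "(\<Sum>V\<in>Pow (W - {w}). (P ^^ n) (LG (W - V) (Q V G)) {}) =
      (\<Sum>V\<in>Pow (W - {w}). clut w * (P ^^ n) (LG (W - {w} - V) (Q V G)) {} +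
        of_nat n * (\<Sum>U\<in>{U \<in> Pow (W - V). w \<in> U}. (P ^^ (n - 1)) (LG (W - V - U) (Q U (Q V G))) {}))"
  proof (intro sum.cong refl)
    fix V assume V: "V \<in> Pow (W - {w})"
    have "W - V - {w} = W - {w} - V" by auto
    then show "(P ^^ n) (LG (W - V) (Q V G)) {} = clut w * (P ^^ n) (LG (W - {w} - V) (Q V G)) {} +
        of_nat n * (\<Sum>U\<in>{U \<in> Pow (W - V). w \<in> U}. (P ^^ (n - 1)) (LG (W - V - U) (Q U (Q V G))) {})"
      using Suc.IH[of "W - V" "Q V G"] V W w Qm[OF _ G, of V] unfolding P_def LG_def Q_def by auto
  qed
  also have "\<dots> = clut w * (P ^^ Suc n) (LG (W - {w}) G) {} +
      of_nat n * (\<Sum>V\<in>Pow (W - {w}). \<Sum>U\<in>{U \<in> Pow (W - V). w \<in> U}.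
        (P ^^ (n - 1)) (LG (W - V - U) (Q U (Q V G))) {})"
  proof -
    have "W - {w} \<subseteq> W0" using W by auto
    from tilt[OF this G, of n] show ?thesis
      by (simp only: sum.distrib sum_distrib_left[symmetric])
  qed
  \<comment> \<open>The order of choice is reversed: first the part \<open>U\<close> that contains
    \<open>w\<close>, then the part \<open>V\<close> of the first point, which avoids
    \<open>w\<close> because it lies in \<open>W - U\<close>. The two insertions commute.\<close>
  also have "(\<Sum>V\<in>Pow (W - {w}). \<Sum>U\<in>{U \<in> Pow (W - V). w \<in> U}.
        (P ^^ (n - 1)) (LG (W - V - U) (Q U (Q V G))) {}) =
      (\<Sum>U\<in>?N. \<Sum>V\<in>Pow (W - U). (P ^^ (n - 1)) (LG (W - U - V) (Q V (Q U G))) {})"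
  proof -
    have eq: "(P ^^ k) (LG (W - V - U) (Q U (Q V G))) {} = (P ^^ k) (LG (W - U - V) (Q V (Q U G))) {}"
      if "U \<subseteq> W" "V \<subseteq> W" for U V k
    proof (rule fin_opD(2)[OF fin_op_funpow[OF P]])
      fix B assume B: "B \<in> fin_subsets M"
      have "W - V - U = W - U - V" by auto
      moreover have "Q U (Q V G) B = Q V (Q U G) B"
        unfolding Q_def using that W by (intro ins_int_commute gl_measurable g G B) auto
      ultimately show "LG (W - V - U) (Q U (Q V G)) B = LG (W - U - V) (Q V (Q U G)) B"
        by (simp add: LG_def)
    qed simp
    have "(\<Sum>V\<in>Pow (W - {w}). \<Sum>U\<in>{U \<in> Pow (W - V). w \<in> U}. (P ^^ k) (LG (W - V - U) (Q U (Q V G))) {}) =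
        (\<Sum>U\<in>?N. \<Sum>V\<in>Pow (W - U). (P ^^ k) (LG (W - U - V) (Q V (Q U G))) {})" for k
      using fin
      by (subst (1 2) sum.Sigma, simp, simp, simp, simp)
         (rule sum.reindex_bij_witness[of _ "\<lambda>(U, V). (V, U)" "\<lambda>(V, U). (U, V)"], auto intro!: eq[symmetric])
    then show ?thesis .
  qed
  \<comment> \<open>The sum over \<open>V\<close> is one more application of the generator, read
    backwards through \<open>tilt\<close>. For \<open>n = 0\<close> the exponent
    \<open>n - 1\<close> is truncated, but the factor \<open>of_nat n\<close> vanishes.\<close>
  also have "of_nat n * \<dots> = of_nat n * (\<Sum>U\<in>?N. (P ^^ n) (LG (W - U) (Q U G)) {})"
  proof (cases n)
    case (Suc n')
    have "(\<Sum>V\<in>Pow (W - U). (P ^^ (n - 1)) (LG (W - U - V) (Q V (Q U G))) {}) = (P ^^ n) (LG (W - U) (Q U G)) {}"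
      if "U \<in> ?N" for U
    proof -
      have "W - U \<subseteq> W0" "U \<subseteq> W0" using W that by auto
      from tilt[OF this(1) Qm[OF this(2) G], of n'] show ?thesis
        by (simp only: Suc diff_Suc_1)
    qed
    then show ?thesis by simp
  qed simp
  finally show ?case
    unfolding P_def LG_def Q_def by (simp add: distrib_right add_ac)
qed

text \<open>Any of the \<open>n\<close> points may be the one that takes \<open>w\<close>, and this
  factor \<open>n\<close> turns 1/n! into 1/(n-1)!. The sum over all powers is therefore an
  exponential again.\<close>

lemma op_exp_ins_int_tilt:
  assumes g: "g \<in> borel_measurable M" and W: "W \<subseteq> W0" and w: "w \<in> W" and G: "G \<in> fin_meas M"
  shows "op_exp (ins_int M g) (\<lambda>A. L W A * G A) {} =
    clut w * op_exp (ins_int M g) (\<lambda>A. L (W - {w}) A * G A) {} +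
    (\<Sum>V\<in>{V \<in> Pow W. w \<in> V}.
      op_exp (ins_int M g) (\<lambda>A. L (W - V) A * ins_int M (\<lambda>y. g y * l V y) G A) {})"
proof -
  let ?P = "ins_int M g"
  define X where "X n = (\<Sum>V\<in>{V \<in> Pow W. w \<in> V}.
      (?P ^^ n) (\<lambda>A. L (W - V) A * ins_int M (\<lambda>y. g y * l V y) G A) {})" for n
  have f: "ennreal (1 / fact (Suc n)) * of_nat (Suc n) = ennreal (1 / fact n)" for n
  proof -
    have "1 / fact (Suc n) * real (Suc n) = 1 / fact n"
      unfolding fact_Suc of_nat_mult by (simp del: of_nat_Suc)
    then show ?thesis
      by (metis ennreal_mult'' of_nat_0_le_iff ennreal_of_nat_eq_real_of_nat)
  qed
  have "op_exp ?P (\<lambda>A. L W A * G A) {} =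
      (\<Sum>n. clut w * (ennreal (1 / fact n) * (?P ^^ n) (\<lambda>A. L (W - {w}) A * G A) {}) +
        ennreal (1 / fact n) * (of_nat n * X (n - 1)))"
    unfolding op_exp_def X_def funpow_ins_int_tilt[OF g W w G] by (simp add: distrib_left ac_simps)
  also have "\<dots> = clut w * op_exp ?P (\<lambda>A. L (W - {w}) A * G A) {} +
      (\<Sum>n. ennreal (1 / fact n) * (of_nat n * X (n - 1)))"
    unfolding op_exp_def by (subst suminf_add[symmetric]) auto
  \<comment> \<open>The term for \<open>n = 0\<close> vanishes, so the series may be shifted by
    one.\<close>
  also have "(\<Sum>n. ennreal (1 / fact n) * (of_nat n * X (n - 1))) = (\<Sum>n. ennreal (1 / fact n) * X n)"
    using suminf_offset[of "\<lambda>n. ennreal (1 / fact n) * (of_nat n * X (n - 1))" 1]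
    by (simp add: mult.assoc[symmetric] f del: fact_Suc of_nat_Suc)
  also have "\<dots> = (\<Sum>V\<in>{V \<in> Pow W. w \<in> V}.
      op_exp ?P (\<lambda>A. L (W - V) A * ins_int M (\<lambda>y. g y * l V y) G A) {})"
    unfolding X_def op_exp_def by (simp add: sum_distrib_left suminf_sum)
  finally show ?thesis .
qed

text \<open>With no measurement left, every point can take only the empty part, which merely
  reweights the intensity by \<open>l {}\<close>.\<close>

lemma op_exp_ins_int_tilt_empty:
  assumes g: "g \<in> borel_measurable M" and G: "G \<in> fin_meas M"
  shows "op_exp (ins_int M g) (\<lambda>A. L {} A * G A) {} = L {} {} * op_exp (ins_int M (\<lambda>y. g y * l {} y)) G {}"
proof -
  have "(ins_int M g ^^ n) (\<lambda>A. L {} A * G A) {} = L {} {} * (ins_int M (\<lambda>y. g y * l {} y) ^^ n) G {}" for n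
    using G
  proof (induction n arbitrary: G)
    case (Suc n)
    show ?case
      unfolding funpow_Suc_right o_def
      using op_ins_int_tilt[OF fin_op_funpow[OF fin_op_ins_int[OF g], of n] _ g Suc.prems empty_finite_sets, of "{}"]
        Suc.IH[OF ins_int_measurable[OF gl_measurable[OF g, of "{}"] Suc.prems]] by simp
  qed simp
  then show ?thesis by (simp add: op_exp_def mult.left_commute)
qed

text \<open>Induction along proper subsets of \<open>W\<close>: both branches of the recursion
  remove \<open>w\<close>, and the branch for \<open>V\<close> leaves behind one individual point
  with weight \<open>g y * l V y\<close>.\<close>

lemma pmb_mixture_tilt_ppp:
  assumes g: "g \<in> borel_measurable M" and W: "W \<subseteq> W0"
  shows "pmb_mixture M (\<lambda>y. g y * l {} y) (\<lambda>G. op_exp (ins_int M g) (\<lambda>A. L W A * G A) {})"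
  using finite_W[OF W] W
proof (induction W rule: finite_psubset_induct)
  case (psubset W)
  show ?case
  proof (cases "W = {}")
    case True
    have "pmb_mixture M (\<lambda>y. g y * l {} y)
        (\<lambda>G. L {} {} * op_exp (ins_int M (\<lambda>y. g y * l {} y)) (ins_ints M [] G) {})"
      by (intro pmb_mixture_cmult pmb_mixture_single) simp
    then show ?thesis
      by (rule pmb_mixture_cong) (simp add: True op_exp_ins_int_tilt_empty[OF g])
  next
    case False
    then obtain w where w: "w \<in> W" by blast
    have "pmb_mixture M (\<lambda>y. g y * l {} y) (\<lambda>G.
        clut w * op_exp (ins_int M g) (\<lambda>A. L (W - {w}) A * G A) {} +
        (\<Sum>V\<in>{V \<in> Pow W. w \<in> V}.
          op_exp (ins_int M g) (\<lambda>A. L (W - V) A * ins_int M (\<lambda>y. g y * l V y) G A) {}))"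
    proof -
      have IH: "pmb_mixture M (\<lambda>y. g y * l {} y) (\<lambda>G. op_exp (ins_int M g) (\<lambda>A. L (W - V) A * G A) {})"
        if "w \<in> V" for V
        using w psubset(3) that by (intro psubset(2)) auto
      show ?thesis
        using psubset(1,3) w
        by (intro pmb_mixture_add pmb_mixture_cmult pmb_mixture_sum
            pmb_mixture_ins_int[where \<Psi> = "\<lambda>G. op_exp (ins_int M g) (\<lambda>A. L (W - V) A * G A) {}" for V]
            gl_measurable g IH) auto
    qed
    then show ?thesis
      by (rule pmb_mixture_cong) (rule op_exp_ins_int_tilt[OF g psubset(3) w])
  qed
qed

text \<open>The points of the list are eliminated from its end, because the last operator acts first
  on the tilted functional. Its point takes some part \<open>V\<close>, and the remaining points
  face \<open>W - V\<close>.\<close>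

lemma pmb_mixture_tilt_single:
  assumes g: "g \<in> borel_measurable M" and W: "W \<subseteq> W0" and gs: "set gs \<subseteq> borel_measurable M"
  shows "pmb_mixture M (\<lambda>y. g y * l {} y) (\<lambda>G. op_exp (ins_int M g) (ins_ints M gs (\<lambda>A. L W A * G A)) {})"
  using gs W
proof (induction gs arbitrary: W rule: rev_induct)
  case Nil
  then show ?case by (simp add: pmb_mixture_tilt_ppp[OF g])
next
  case (snoc h gs)
  have "pmb_mixture M (\<lambda>y. g y * l {} y) (\<lambda>G. \<Sum>V\<in>Pow W.
      op_exp (ins_int M g) (ins_ints M gs (\<lambda>A. L (W - V) A * ins_int M (\<lambda>y. h y * l V y) G A)) {})"
  proof -
    have IH: "pmb_mixture M (\<lambda>y. g y * l {} y) (\<lambda>G. op_exp (ins_int M g) (ins_ints M gs (\<lambda>A. L (W - V) A * G A)) {})" for V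
      using snoc.prems by (intro snoc.IH) auto
    show ?thesis
      using snoc.prems finite_W[OF snoc(3)]
      by (intro pmb_mixture_sum pmb_mixture_ins_int[where
            \<Psi> = "\<lambda>G. op_exp (ins_int M g) (ins_ints M gs (\<lambda>A. L (W - V) A * G A)) {}" for V] gl_measurable IH) auto
  qed
  then show ?case
  proof (rule pmb_mixture_cong)
    fix G assume G: "G \<in> fin_meas M"
    have gs': "fin_op M (ins_ints M gs)" using snoc by (intro fin_op_ins_ints) auto
    have h: "h \<in> borel_measurable M" using snoc by simp
    have m: "ins_ints M gs (\<lambda>A. L (W - V) A * ins_int M (\<lambda>y. h y * l V y) G A) \<in> fin_meas M" if "V \<in> Pow W" for V
      using that snoc(3) by (intro fin_opD(1)[OF gs'] LG_measurable ins_int_measurable gl_measurable h G) auto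
    have "op_exp (ins_int M g) (ins_ints M (gs @ [h]) (\<lambda>A. L W A * G A)) {} =
        op_exp (ins_int M g) (\<lambda>B. \<Sum>V\<in>Pow W. ins_ints M gs (\<lambda>A. L (W - V) A * ins_int M (\<lambda>y. h y * l V y) G A) B) {}"
      unfolding ins_ints_simps
      by (intro op_exp_cong[OF fin_op_ins_int[OF g]] op_ins_int_tilt[OF gs' snoc(3) h G]) auto
    also have "\<dots> = (\<Sum>V\<in>Pow W. op_exp (ins_int M g) (ins_ints M gs (\<lambda>A. L (W - V) A * ins_int M (\<lambda>y. h y * l V y) G A)) {})"
      using finite_W[OF snoc(3)] m by (intro op_exp_sum[OF fin_op_ins_int[OF g]]) auto
    finally show "op_exp (ins_int M g) (ins_ints M (gs @ [h]) (\<lambda>A. L W A * G A)) {} = \<dots>" .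
  qed
qed

lemma pmb_mixture_tilt:
  assumes "pmb_mixture M g \<Psi>" and g: "g \<in> borel_measurable M" and W: "W \<subseteq> W0"
  shows "pmb_mixture M (\<lambda>y. g y * l {} y) (\<lambda>G. \<Psi> (\<lambda>A. L W A * G A))"
proof -
  obtain hs where hs: "\<forall>(c, gs)\<in>set hs. set gs \<subseteq> borel_measurable M"
    "\<And>G. G \<in> fin_meas M \<Longrightarrow> \<Psi> G = (\<Sum>(c, gs)\<leftarrow>hs. c * op_exp (ins_int M g) (ins_ints M gs G) {})"
    using assms(1) unfolding pmb_mixture_def by blast
  have "pmb_mixture M (\<lambda>y. g y * l {} y)
      (\<lambda>G. \<Sum>(c, gs)\<leftarrow>hs. c * op_exp (ins_int M g) (ins_ints M gs (\<lambda>A. L W A * G A)) {})"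
    unfolding split_def using hs(1)
    by (intro pmb_mixture_sum_list pmb_mixture_cmult pmb_mixture_tilt_single g W) fastforce
  then show ?thesis
    by (rule pmb_mixture_cong) (simp add: hs(2) LG_measurable[OF W])
qed

end

subsection \<open>Set convolutions and densities\<close>

text \<open>The convolution of set functions underlies both the multi-Bernoulli densities and the
  measurement densities. A general semiring allows it to be used with values in \<open>real\<close>
  and in \<open>ennreal\<close>.\<close>

definition set_conv :: "('a set \<Rightarrow> 'c::comm_semiring_1) \<Rightarrow> ('i \<Rightarrow> 'a set \<Rightarrow> 'c) \<Rightarrow> 'i set \<Rightarrow> 'a set \<Rightarrow> 'c" where
  "set_conv C b T A = (\<Sum>D\<in>splits T A. C (D None) * (\<Prod>i\<in>T. b i (D (Some i))))"

lemma splits_iff: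
  "D \<in> splits T A \<longleftrightarrow> (\<forall>j. j \<notin> insert None (Some ` T) \<longrightarrow> D j = undefined) \<and>
     disjoint_family_on D (insert None (Some ` T)) \<and> (\<Union>j\<in>insert None (Some ` T). D j) = A"
  by (auto simp: splits_def PiE_def extensional_def Pi_def)

lemma finite_splits: "finite T \<Longrightarrow> finite A \<Longrightarrow> finite (splits T A)"
  by (rule finite_subset[of _ "insert None (Some ` T) \<rightarrow>\<^sub>E Pow A"])
     (auto simp: splits_def intro!: finite_PiE)

lemma splits_subset: "D \<in> splits T A \<Longrightarrow> j \<in> insert None (Some ` T) \<Longrightarrow> D j \<subseteq> A"
  by (auto simp: splits_iff)

lemma set_conv_empty:
  fixes b :: "'i \<Rightarrow> 'a set \<Rightarrow> 'c::comm_semiring_1"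
  shows "set_conv C b {} A = C A"
proof -
  have "D = (\<lambda>_. undefined)(None := A)" if "D \<in> splits {} A" for D :: "'i option \<Rightarrow> 'a set"
  proof
    show "D j = ((\<lambda>_. undefined)(None := A)) j" for j
      using that by (cases j) (auto simp: splits_iff)
  qed
  then have "splits {} A = {(\<lambda>_::'i option. undefined)(None := A)}"
    by (auto simp: splits_iff disjoint_family_on_def)
  then show ?thesis by (simp add: set_conv_def)
qed

lemma set_conv_insert:
  assumes "finite T" "i \<notin> T" "finite A"
  shows "set_conv C b (insert i T) A = (\<Sum>B\<in>Pow A. b i B * set_conv C b T (A - B))"
proof -
  have fin: "\<forall>B\<in>Pow A. finite (splits T (A - B))"
    using assms by (auto intro: finite_splits)
  have "(\<Sum>B\<in>Pow A. b i B * set_conv C b T (A - B)) =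
      (\<Sum>(B, D)\<in>Sigma (Pow A) (\<lambda>B. splits T (A - B)). b i B * (C (D None) * (\<Prod>j\<in>T. b j (D (Some j)))))"
    unfolding set_conv_def sum_distrib_left using assms(3) fin by (subst sum.Sigma) auto
  also have "\<dots> = set_conv C b (insert i T) A"
    unfolding set_conv_def
  \<comment> \<open>A split is cut into its part at \<open>Some i\<close> and a split of the rest.
    The removed value is reset to \<open>undefined\<close> because splits are extensional.\<close>
  proof (rule sum.reindex_bij_witness[of _ "\<lambda>D. (D (Some i), D(Some i := undefined))" "\<lambda>(B, D). D(Some i := B)"])
    fix q assume "q \<in> Sigma (Pow A) (\<lambda>B. splits T (A - B))"
    then obtain B D where q: "q = (B, D)" "B \<subseteq> A" "D \<in> splits T (A - B)" by auto
    have Di: "D (Some i) = undefined" using q(3) assms(2) by (auto simp: splits_iff)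
    then show "(case case q of (B, D) \<Rightarrow> D(Some i := B) of D \<Rightarrow> (D (Some i), D(Some i := undefined))) = q"
      by (auto simp: q(1) fun_eq_iff)
    have "D j \<inter> B = {}" if "j \<in> insert None (Some ` T)" for j
      using splits_subset[OF q(3) that] by auto
    then have "disjoint_family_on (D(Some i := B)) (insert None (Some ` insert i T))"
      using q(3) assms(2) unfolding splits_iff disjoint_family_on_def by (auto simp: Int_commute)
    moreover have "(\<Union>j\<in>insert None (Some ` insert i T). (D(Some i := B)) j) = A"
    proof -
      have "(\<Union>j\<in>insert None (Some ` insert i T). (D(Some i := B)) j) = B \<union> (\<Union>j\<in>insert None (Some ` T). D j)"
        using assms(2) by auto
      then show ?thesis using q(2,3) by (auto simp: splits_iff)
    qed
    ultimately show "(case q of (B, D) \<Rightarrow> D(Some i := B)) \<in> splits (insert i T) A"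
      using q(3) unfolding q(1) splits_iff by auto
    have "(\<Prod>j\<in>insert i T. b j ((D(Some i := B)) (Some j))) = b i B * (\<Prod>j\<in>T. b j (D (Some j)))"
      using assms by (auto intro!: arg_cong2[of _ _ _ _ "(*)"] prod.cong)
    then show "C ((case q of (B, D) \<Rightarrow> D(Some i := B)) None) *
        (\<Prod>j\<in>insert i T. b j ((case q of (B, D) \<Rightarrow> D(Some i := B)) (Some j))) =
        (case q of (B, D) \<Rightarrow> b i B * (C (D None) * (\<Prod>j\<in>T. b j (D (Some j)))))"
      by (simp add: q(1) ac_simps)
  next
    fix D assume D: "D \<in> splits (insert i T) A"
    show "(case (D (Some i), D(Some i := undefined)) of (B, D) \<Rightarrow> D(Some i := B)) = D" by auto
    have dis: "D j \<inter> D (Some i) = {}" if "j \<in> insert None (Some ` T)" for j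
      using D that assms(2) unfolding splits_iff disjoint_family_on_def by auto
    have "(\<Union>j\<in>insert None (Some ` insert i T). D j) = D (Some i) \<union> (\<Union>j\<in>insert None (Some ` T). D j)"
      by auto
    then have "(\<Union>j\<in>insert None (Some ` T). D j) = A - D (Some i)"
      using D dis by (auto simp: splits_iff)
    moreover have "(\<Union>j\<in>insert None (Some ` T). (D(Some i := undefined)) j) = (\<Union>j\<in>insert None (Some ` T). D j)"
      using assms(2) by auto
    moreover have "disjoint_family_on (D(Some i := undefined)) (insert None (Some ` T))"
      using D assms(2) unfolding splits_iff disjoint_family_on_def by auto
    ultimately have "D(Some i := undefined) \<in> splits T (A - D (Some i))"
      using D unfolding splits_iff by auto
    then show "(D (Some i), D(Some i := undefined)) \<in> Sigma (Pow A) (\<lambda>B. splits T (A - B))"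
      using splits_subset[OF D] by auto
  qed
  finally show ?thesis by simp
qed

lemma ennreal_set_conv:
  assumes "\<And>B. B \<subseteq> A \<Longrightarrow> 0 \<le> C B" "\<And>i B. i \<in> T \<Longrightarrow> B \<subseteq> A \<Longrightarrow> 0 \<le> b i B"
  shows "ennreal (set_conv C b T A) = set_conv (\<lambda>B. ennreal (C B)) (\<lambda>i B. ennreal (b i B)) T A"
proof -
  have "0 \<le> C (D None)" "\<And>i. i \<in> T \<Longrightarrow> 0 \<le> b i (D (Some i))" if "D \<in> splits T A" for D
    using splits_subset[OF that] assms by auto
  then show ?thesis
    unfolding set_conv_def
    by (subst sum_ennreal[symmetric])
       (auto simp: ennreal_mult prod_ennreal prod_nonneg intro!: mult_nonneg_nonneg sum.cong)
qed

lemma set_conv_insert_single: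
  assumes "finite T" "i \<notin> T" "finite A"
    and b: "\<And>B. finite B \<Longrightarrow> card B \<ge> 2 \<Longrightarrow> b i B = 0"
  shows "set_conv C b (insert i T) A =
    b i {} * set_conv C b T A + (\<Sum>x\<in>A. b i {x} * set_conv C b T (A - {x}))"
proof -
  let ?g = "\<lambda>B. b i B * set_conv C b T (A - B)"
  have "set_conv C b (insert i T) A = sum ?g (Pow A)"
    by (rule set_conv_insert[OF assms(1-3)])
  also have "\<dots> = sum ?g (insert {} ((\<lambda>x. {x}) ` A))"
  proof (rule sum.mono_neutral_right)
    show "\<forall>B\<in>Pow A - insert {} ((\<lambda>x. {x}) ` A). ?g B = 0"
    proof
      fix B assume B: "B \<in> Pow A - insert {} ((\<lambda>x. {x}) ` A)"
      then have "finite B" using assms(3) finite_subset by auto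
      moreover have "card B \<noteq> 0" "card B \<noteq> 1"
        using B \<open>finite B\<close> by (auto simp: card_1_singleton_iff)
      ultimately have "b i B = 0" by (intro b) linarith+
      then show "?g B = 0" by simp
    qed
  qed (use assms in auto)
  also have "\<dots> = b i {} * set_conv C b T A + (\<Sum>x\<in>A. b i {x} * set_conv C b T (A - {x}))"
    using assms(3) by (subst sum.insert) (auto simp: sum.reindex inj_on_def)
  finally show ?thesis .
qed

text \<open>A product rule: the new point \<open>y\<close> lies either in the Poisson part, which
  contributes the factor \<open>lam\<close>, or it is the single point of one track
  \<open>i\<close>, which is then used up.\<close>

lemma set_conv_insert_point:
  assumes "finite T" "finite A" "y \<notin> A"
    and C: "\<And>B. finite B \<Longrightarrow> y \<notin> B \<Longrightarrow> C (insert y B) = lam * C B"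
    and b: "\<And>i B. i \<in> T \<Longrightarrow> finite B \<Longrightarrow> card B \<ge> 2 \<Longrightarrow> b i B = 0"
  shows "set_conv C b T (insert y A) = lam * set_conv C b T A + (\<Sum>i\<in>T. b i {y} * set_conv C b (T - {i}) A)"
  using assms(1-3) b
proof (induction T arbitrary: A)
  case empty
  then show ?case by (simp add: set_conv_empty C)
next
  case (insert i T)
  let ?c = "set_conv C b"
  have single: "?c (insert i T) B = b i {} * ?c T B + (\<Sum>x\<in>B. b i {x} * ?c T (B - {x}))" if "finite B" for B
    using insert.hyps insert.prems(3) that by (intro set_conv_insert_single) auto
  have IH: "?c T (insert y B) = lam * ?c T B + (\<Sum>j\<in>T. b j {y} * ?c (T - {j}) B)"
    if "finite B" "y \<notin> B" for B
    using that insert.prems(3) by (intro insert.IH) auto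
  have rm: "?c (insert i T - {j}) A = b i {} * ?c (T - {j}) A + (\<Sum>x\<in>A. b i {x} * ?c (T - {j}) (A - {x}))"
    if "j \<in> T" for j
  proof -
    have "insert i T - {j} = insert i (T - {j})" using that insert.hyps by auto
    then show ?thesis
      using insert.hyps insert.prems(1) insert.prems(3)[OF insertI1]
      by (simp add: set_conv_insert_single)
  qed
  \<comment> \<open>The track \<open>i\<close> takes nothing, or \<open>y\<close>, or an old point
    \<open>x\<close>; in the first and third case \<open>y\<close> is left to the other
    components.\<close>
  have "?c (insert i T) (insert y A) =
      b i {} * ?c T (insert y A) + (b i {y} * ?c T A + (\<Sum>x\<in>A. b i {x} * ?c T (insert y (A - {x}))))"
  proof -
    have "insert y A - {x} = insert y (A - {x})" if "x \<in> A" for x using that insert.prems(2) by auto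
    then show ?thesis
      using insert.prems(1,2) by (simp add: single cong: sum.cong)
  qed
  also have "\<dots> = b i {} * (lam * ?c T A + (\<Sum>j\<in>T. b j {y} * ?c (T - {j}) A)) + (b i {y} * ?c T A +
      (\<Sum>x\<in>A. b i {x} * (lam * ?c T (A - {x}) + (\<Sum>j\<in>T. b j {y} * ?c (T - {j}) (A - {x})))))"
    using insert.prems by (simp add: IH)
  also have "\<dots> = lam * (b i {} * ?c T A + (\<Sum>x\<in>A. b i {x} * ?c T (A - {x}))) + (b i {y} * ?c T A +
      (\<Sum>j\<in>T. b j {y} * (b i {} * ?c (T - {j}) A + (\<Sum>x\<in>A. b i {x} * ?c (T - {j}) (A - {x})))))"
  proof -
    have "(\<Sum>x\<in>A. b i {x} * (\<Sum>j\<in>T. b j {y} * ?c (T - {j}) (A - {x}))) =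
        (\<Sum>j\<in>T. b j {y} * (\<Sum>x\<in>A. b i {x} * ?c (T - {j}) (A - {x})))"
      unfolding sum_distrib_left by (subst sum.swap) (simp add: ac_simps)
    then show ?thesis
      by (simp add: distrib_left sum.distrib sum_distrib_left ac_simps)
  qed
  also have "\<dots> = lam * ?c (insert i T) A + (\<Sum>j\<in>insert i T. b j {y} * ?c (insert i T - {j}) A)"
    using insert.hyps insert.prems(1) by (simp add: single rm cong: sum.cong)
  finally show ?case .
qed

text \<open>With \<open>b = 1 - r\<close> and \<open>g = r p\<close> this adds a Bernoulli point.\<close>

definition affine_ins :: "'a measure \<Rightarrow> ennreal \<Rightarrow> ('a \<Rightarrow> ennreal) \<Rightarrow> ('a set \<Rightarrow> ennreal) \<Rightarrow> 'a set \<Rightarrow> ennreal" where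
  "affine_ins N b g G A = b * G A + ins_int N g G A"

lemma (in sigma_finite_measure) fin_op_affine_ins:
  "g \<in> borel_measurable M \<Longrightarrow> fin_op M (affine_ins M b g)"
  using fin_op_add[OF fin_op_cmult fin_op_ins_int, of g b] by (simp add: affine_ins_def[abs_def])

lemma (in sigma_finite_measure) affine_ins_measurable:
  "g \<in> borel_measurable M \<Longrightarrow> G \<in> fin_meas M \<Longrightarrow> affine_ins M b g G \<in> fin_meas M"
  by (rule fin_opD(1)[OF fin_op_affine_ins])

lemma bernoulli_density_simps:
  "bernoulli_density r p {} = 1 - r" "bernoulli_density r p {x} = r * p x"
  "card B \<ge> 2 \<Longrightarrow> bernoulli_density r p B = 0"
  by (auto simp: bernoulli_density_def is_singleton_altdef)

lemma bernoulli_density_nonneg: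
  assumes "r \<in> {0..1}" "\<And>x. x \<in> B \<Longrightarrow> 0 \<le> p x"
  shows "0 \<le> bernoulli_density r p B"
  using assms by (auto simp: bernoulli_density_def is_singleton_def)

lemma ppp_density_nonneg: "(\<And>x. x \<in> A \<Longrightarrow> 0 \<le> lam x) \<Longrightarrow> 0 \<le> ppp_density N lam A"
  by (simp add: ppp_density_def prod_nonneg)

section \<open>From explicit densities to exponentials\<close>

context diffuse_measure
begin

text \<open>The tilt recursion is run with tracks in place of measurements and reference weight 1.
  Removing the tracks one by one turns the explicit density into operators: a track that is left
  without a point contributes \<open>1 - r\<close>, a point that takes it the weight
  \<open>r * p\<close>. Together these are one \<open>affine_ins\<close>.\<close>

lemma
  fixes p :: "nat \<Rightarrow> 'a \<Rightarrow> real" and r :: "nat \<Rightarrow> real"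
  assumes lam: "is_intensity M lam" and r: "\<And>i. i < n \<Longrightarrow> r i \<in> {0..1}"
    and p: "\<And>i. i < n \<Longrightarrow> is_prob_density M (p i)"
  defines "f \<equiv> \<lambda>A. ennreal (set_conv (ppp_density M lam) (\<lambda>i. bernoulli_density (r i) (p i)) {..<n} A)"
  shows pmb_density_measurable: "f \<in> fin_meas M"
    and op_exp_pmb_density: "G \<in> fin_meas M \<Longrightarrow> op_exp (ins_int M (\<lambda>_. 1)) (\<lambda>A. f A * G A) {} =
      ennreal (exp (- (\<integral>x. lam x \<partial>M))) * op_exp (ins_int M (\<lambda>y. ennreal (lam y)))
        (foldr (\<lambda>i. affine_ins M (ennreal (1 - r i)) (\<lambda>y. ennreal (r i * p i y))) [0..<n] G) {}"
proof -
  define C where "C A = ennreal (ppp_density M lam A)" for A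
  define b where "b i A = ennreal (bernoulli_density (r i) (p i) A)" for i A
  \<comment> \<open>A point takes no track, and then belongs to the Poisson part, or exactly one
    track. Larger sets of tracks get weight 0.\<close>
  define l where "l V y = (if V = {} then ennreal (lam y)
    else if is_singleton V then b (the_elem V) {y} else 0)" for V y
  have lam0: "0 \<le> lam y" if "y \<in> space M" for y using lam that by (simp add: is_intensity_def)
  have lamm[measurable]: "lam \<in> borel_measurable M" using lam by (auto simp: is_intensity_def)
  have pm: "p i \<in> borel_measurable M" if "i < n" for i using p[OF that] by (simp add: is_prob_density_def)
  have p0: "0 \<le> p i y" if "y \<in> space M" "i < n" for i y
    using p[OF that(2)] that(1) by (simp add: is_prob_density_def)
  have bm: "(\<lambda>y. b i {y}) \<in> borel_measurable M" if "i < n" for i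
    using pm[OF that] by (simp add: b_def bernoulli_density_simps)
  interpret tilted_measure M "set_conv C b" l "\<lambda>i. b i {}" "{..<n}"
  proof
    fix V assume V: "V \<subseteq> {..<n}"
    show "l V \<in> borel_measurable M"
    proof (cases "is_singleton V")
      case True
      then have "l V = (\<lambda>y. b (the_elem V) {y})" by (auto simp: l_def is_singleton_def)
      moreover have "the_elem V < n" using True V by (auto simp: is_singleton_def)
      ultimately show ?thesis using bm by simp
    next
      case False
      then show ?thesis by (cases "V = {}") (simp_all add: l_def[abs_def])
    qed
  next
    fix W y A assume W: "W \<subseteq> {..<n}" and y: "y \<in> space M" and A: "A \<in> fin_subsets M" and yA: "y \<notin> A"
    have fin: "finite W" using W finite_subset by blast
    have "set_conv C b W (insert y A) =
        ennreal (lam y) * set_conv C b W A + (\<Sum>i\<in>W. b i {y} * set_conv C b (W - {i}) A)"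
    proof (rule set_conv_insert_point)
      show "C (insert y B) = ennreal (lam y) * C B" if "finite B" "y \<notin> B" for B
        using that lam0[OF y] by (simp add: C_def ppp_density_def ennreal_mult'[symmetric] ac_simps)
    qed (use A yA fin in \<open>auto simp: space_finite_sets b_def bernoulli_density_simps\<close>)
    also have "\<dots> = (\<Sum>V\<in>insert {} ((\<lambda>i. {i}) ` W). l V y * set_conv C b (W - V) A)"
      using fin by (subst sum.insert) (auto simp: sum.reindex inj_on_def l_def)
    also have "\<dots> = (\<Sum>V\<in>Pow W. l V y * set_conv C b (W - V) A)"
      using fin by (intro sum.mono_neutral_left) (auto simp: l_def is_singleton_def)
    finally show "set_conv C b W (insert y A) = (\<Sum>V\<in>Pow W. l V y * set_conv C b (W - V) A)" .
  next
    fix W w assume W: "W \<subseteq> {..<n}" "w \<in> W"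
    then have "finite (W - {w})" using finite_subset by blast
    from set_conv_insert[OF this, of w "{}" C b] W
    show "set_conv C b W {} = b w {} * set_conv C b (W - {w}) {}"
      by (simp add: insert_absorb)
  qed simp
  have f: "f A = set_conv C b {..<n} A" if "A \<in> fin_subsets M" for A
    unfolding f_def C_def b_def
    using that by (intro ennreal_set_conv)
      (auto simp: space_finite_sets subset_iff intro!: ppp_density_nonneg bernoulli_density_nonneg lam0 p0 r)
  show "f \<in> fin_meas M"
    using L_measurable[of "{..<n}"] by (subst measurable_cong[OF f]) auto
  assume G: "G \<in> fin_meas M"
  let ?a = "\<lambda>i. affine_ins M (ennreal (1 - r i)) (\<lambda>y. ennreal (r i * p i y))"
  have one: "(\<lambda>_. 1) \<in> borel_measurable M" by simp
  have "op_exp (ins_int M (\<lambda>_. 1)) (\<lambda>A. set_conv C b {..<k} A * G A) {} =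
      ennreal (exp (- (\<integral>x. lam x \<partial>M))) * op_exp (ins_int M (\<lambda>y. ennreal (lam y))) (foldr ?a [0..<k] G) {}"
    if "k \<le> n" for k
    using that G
  proof (induction k arbitrary: G)
    case 0
    have l0: "l {} = (\<lambda>y. ennreal (lam y))" by (simp add: l_def[abs_def])
    show ?case using op_exp_ins_int_tilt_empty[OF one 0(2)]
      by (simp add: set_conv_empty C_def ppp_density_def l0)
  next
    case (Suc k)
    let ?P = "ins_int M (\<lambda>_. 1)"
    note gm = gl_measurable[OF one] and P = fin_op_ins_int[OF one]
    have W: "{..<Suc k} \<subseteq> {..<n}" "k \<in> {..<Suc k}" using Suc.prems by auto
    have eq: "{..<Suc k} - {k} = {..<k}" by auto
    have pk: "(\<lambda>y. ennreal (r k * p k y)) \<in> borel_measurable M"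
      using pm[of k] Suc.prems by auto
    have lk: "(\<lambda>y. 1 * l {k} y) = (\<lambda>y. ennreal (r k * p k y))"
      by (simp add: l_def b_def bernoulli_density_simps is_singleton_def)
    \<comment> \<open>One point cannot be the point of two tracks, so among the sets containing
      \<open>k\<close> only \<open>{k}\<close> survives.\<close>
    have zero: "op_exp ?P (\<lambda>A. set_conv C b ({..<Suc k} - V) A * ins_int M (\<lambda>y. 1 * l V y) G A) {} = 0"
      if "V \<in> {V \<in> Pow {..<Suc k}. k \<in> V} - {{k}}" for V
    proof -
      have "l V = (\<lambda>y. 0)" using that by (auto simp: l_def is_singleton_def fun_eq_iff)
      then have "ins_int M (\<lambda>y. 1 * l V y) G = (\<lambda>_. 0)" by (simp add: ins_int_def fun_eq_iff)
      then show ?thesis using op_exp_cmult[OF P, of "\<lambda>_. 0" "{}" 0] by simp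
    qed
    have "op_exp ?P (\<lambda>A. set_conv C b {..<Suc k} A * G A) {} =
        b k {} * op_exp ?P (\<lambda>A. set_conv C b {..<k} A * G A) {} +
        op_exp ?P (\<lambda>A. set_conv C b {..<k} A * ins_int M (\<lambda>y. ennreal (r k * p k y)) G A) {}"
    proof -
      have "(\<Sum>V\<in>{V \<in> Pow {..<Suc k}. k \<in> V}.
          op_exp ?P (\<lambda>A. set_conv C b ({..<Suc k} - V) A * ins_int M (\<lambda>y. 1 * l V y) G A) {}) =
          (\<Sum>V\<in>{{k}}. op_exp ?P (\<lambda>A. set_conv C b ({..<Suc k} - V) A * ins_int M (\<lambda>y. 1 * l V y) G A) {})"
        by (rule sum.mono_neutral_right) (use zero in auto)
      then show ?thesis
        using op_exp_ins_int_tilt[OF one W Suc.prems(2)] by (simp add: eq lk[simplified])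
    qed
    also have "\<dots> = op_exp ?P (\<lambda>A. set_conv C b {..<k} A * ?a k G A) {}"
    proof -
      have m: "(\<lambda>A. set_conv C b {..<k} A * G A) \<in> fin_meas M"
        "(\<lambda>A. set_conv C b {..<k} A * ins_int M (\<lambda>y. ennreal (r k * p k y)) G A) \<in> fin_meas M"
        using Suc.prems by (auto intro!: LG_measurable ins_int_measurable pk)
      \<comment> \<open>The two summands are written as a sum over the booleans in order to apply
        additivity over finite sums.\<close>
      have "op_exp ?P (\<lambda>A. set_conv C b {..<k} A * ?a k G A) {} =
          op_exp ?P (\<lambda>A. \<Sum>s\<in>{True, False}. if s then b k {} * (set_conv C b {..<k} A * G A)
            else set_conv C b {..<k} A * ins_int M (\<lambda>y. ennreal (r k * p k y)) G A) {}"
        by (intro op_exp_cong[OF P])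
           (auto simp: affine_ins_def b_def bernoulli_density_simps distrib_left ac_simps)
      then show ?thesis
        using m by (subst (asm) op_exp_sum[OF P]) (auto simp: op_exp_cmult[OF P])
    qed
    also have "\<dots> = ennreal (exp (- (\<integral>x. lam x \<partial>M))) *
        op_exp (ins_int M (\<lambda>y. ennreal (lam y))) (foldr ?a [0..<k] (?a k G)) {}"
      using Suc.prems by (intro Suc.IH affine_ins_measurable pk) auto
    finally show ?case by simp
  qed
  from this[of n] show "op_exp (ins_int M (\<lambda>_. 1)) (\<lambda>A. f A * G A) {} =
      ennreal (exp (- (\<integral>x. lam x \<partial>M))) * op_exp (ins_int M (\<lambda>y. ennreal (lam y))) (foldr ?a [0..<n] G) {}"
    using op_exp_cong[OF fin_op_ins_int[OF one], of "{}" "\<lambda>A. f A * G A" "\<lambda>A. set_conv C b {..<n} A * G A"] f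
    by simp
qed

text \<open>A Poisson process is the special case of a multi-Bernoulli density with no
  tracks.\<close>

lemma nn_integral_ppp:
  assumes lam: "is_intensity M lam" and G: "G \<in> fin_meas M"
  shows "(\<integral>\<^sup>+A. G A \<partial>ppp M lam) =
    ennreal (exp (- (\<integral>x. lam x \<partial>M))) * op_exp (ins_int M (\<lambda>y. ennreal (lam y))) G {}"
proof -
  have m: "(\<lambda>A. ennreal (ppp_density M lam A)) \<in> fin_meas M"
  proof -
    have "(\<lambda>A. ennreal (set_conv (ppp_density M lam) (\<lambda>i. bernoulli_density 0 (\<lambda>_. 0)) {..<0::nat} A)) \<in> fin_meas M"
      by (rule pmb_density_measurable[OF lam]) auto
    then show ?thesis by (simp only: set_conv_empty lessThan_0)
  qed
  have "(\<integral>\<^sup>+A. G A \<partial>ppp M lam) = (\<integral>\<^sup>+A. ennreal (ppp_density M lam A) * G A \<partial>finite_sets M)"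
    unfolding ppp_def by (rule nn_integral_density[OF m G])
  also have "\<dots> = op_exp (ins_int M (\<lambda>_. 1)) (\<lambda>A. ennreal (ppp_density M lam A) * G A) {}"
    using m G by (intro nn_integral_finite_sets_eq_op_exp borel_measurable_times_ennreal)
  also have "\<dots> = ennreal (exp (- (\<integral>x. lam x \<partial>M))) * op_exp (ins_int M (\<lambda>y. ennreal (lam y))) G {}"
    using op_exp_pmb_density[OF lam _ _ G, of 0 undefined undefined] by (simp add: set_conv_empty)
  finally show ?thesis .
qed

end

subsection \<open>Thinned images\<close>

abbreviation affine_inss :: "'a measure \<Rightarrow> (ennreal \<times> ('a \<Rightarrow> ennreal)) list \<Rightarrow> ('a set \<Rightarrow> ennreal) \<Rightarrow> 'a set \<Rightarrow> ennreal" where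
  "affine_inss N bs \<equiv> foldr (\<lambda>(b, h). affine_ins N b h) bs"

lemma (in sigma_finite_measure) fin_op_affine_inss:
  assumes "\<And>b h. (b, h) \<in> set bs \<Longrightarrow> h \<in> borel_measurable M"
  shows "fin_op M (affine_inss M bs)"
proof -
  have "fin_op M (foldr (\<lambda>P. P) (map (\<lambda>(b, h). affine_ins M b h) bs))"
    using assms by (intro fin_op_foldr) (auto intro: fin_op_affine_ins)
  moreover have "foldr (\<lambda>P. P) (map (\<lambda>(b, h). affine_ins M b h) bs) = affine_inss M bs"
    by (induction bs) auto
  ultimately show ?thesis by simp
qed

text \<open>Points outside \<open>Y\<close> are discarded and the others are mapped by
  \<open>\<phi>\<close>, which need not be injective: inserting a point and taking images still
  amounts to inserting its image. The null set condition guarantees that image intensities have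
  densities with respect to \<open>N'\<close>.\<close>

locale thinned_image = N: sigma_finite_measure N + N': sigma_finite_measure N'
  for N :: "'a measure" and N' :: "'b measure" +
  fixes Y :: "'a set" and \<phi> :: "'a \<Rightarrow> 'b"
  assumes Y: "Y \<in> sets N" and \<phi>: "\<phi> \<in> measurable (restrict_space N Y) N'"
    and nonsingular: "A \<in> null_sets N' \<Longrightarrow> {y \<in> Y. \<phi> y \<in> A} \<in> null_sets N"
begin

definition im :: "'a set \<Rightarrow> 'b set" where
  "im S = \<phi> ` (S \<inter> Y)"

lemma Y_subset: "Y \<subseteq> space N"
  using sets.sets_into_space[OF Y] .

lemma \<phi>_space: "y \<in> Y \<Longrightarrow> \<phi> y \<in> space N'"
  using measurable_space[OF \<phi>, of y] Y_subset by (auto simp: space_restrict_space)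

lemma im_finite_sets: "S \<in> fin_subsets N \<Longrightarrow> im S \<in> fin_subsets N'"
  using \<phi>_space by (auto simp: im_def space_finite_sets)

text \<open>Finitely many events fix which of the parametrising functions fall into
  \<open>Y\<close>. On each of them the image is parametrised by the composed functions of one index
  set \<open>J\<close>.\<close>

lemma im_measurable: "im \<in> measurable (finite_sets N) (finite_sets N')"
  unfolding measurable_finite_sets_iff
proof (intro conjI allI ballI impI)
  fix A assume "finite A \<and> A \<subseteq> space N"
  then show "im A \<in> fin_subsets N'" by (intro im_finite_sets) (simp add: space_finite_sets)
next
  fix n :: nat and S assume S: "S \<in> finset_maps (\<Pi>\<^sub>M i\<in>{..<n}. N) N"
  let ?\<Omega> = "\<Pi>\<^sub>M i\<in>{..<n}. N"
  obtain k h where h: "\<forall>i<k::nat. h i \<in> measurable ?\<Omega> N" "S = (\<lambda>\<omega>. (\<lambda>i. h i \<omega>) ` {..<k})"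
    using finset_maps_indexed[OF S] by blast
  define E where "E J = {\<omega> \<in> space ?\<Omega>. \<forall>i\<in>{..<k}. (h i \<omega> \<in> Y) = (i \<in> J)}" for J
  have E: "E J \<in> sets ?\<Omega>" for J
  proof -
    have "Measurable.pred ?\<Omega> (\<lambda>\<omega>. \<forall>i\<in>{..<k}. (h i \<omega> \<in> Y) = (i \<in> J))"
    proof (rule pred_intros_finite)
      fix i assume "i \<in> {..<k}"
      then have "h i \<in> measurable ?\<Omega> N" using h by auto
      from pred_sets2[OF Y this] show "Measurable.pred ?\<Omega> (\<lambda>\<omega>. (h i \<omega> \<in> Y) = (i \<in> J))"
        by (cases "i \<in> J") simp_all
    qed simp
    then show ?thesis by (simp add: E_def pred_def)
  qed
  show "(\<lambda>\<omega>. im (S \<omega>)) \<in> measurable ?\<Omega> (finite_sets N')"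
  proof (rule measurable_piecewise_restrict[where C = "E ` Pow {..<k}"])
    show "space ?\<Omega> \<subseteq> \<Union> (E ` Pow {..<k})"
    proof
      fix \<omega> assume "\<omega> \<in> space ?\<Omega>"
      then have "\<omega> \<in> E {i \<in> {..<k}. h i \<omega> \<in> Y}" by (auto simp: E_def)
      then show "\<omega> \<in> \<Union> (E ` Pow {..<k})" by (rule UN_I[rotated]) auto
    qed
    fix e assume "e \<in> E ` Pow {..<k}"
    then obtain J where J: "J \<subseteq> {..<k}" "e = E J" by auto
    then have "finite J" by (auto intro: finite_subset)
    have "(\<lambda>\<omega>. (\<lambda>i. \<phi> (h i \<omega>)) ` J) \<in> measurable (restrict_space ?\<Omega> (E J)) (finite_sets N')"
    proof (intro finset_maps_measurable finset_maps_image \<open>finite J\<close>)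
      fix i assume i: "i \<in> J"
      have "h i \<in> measurable (restrict_space ?\<Omega> (E J)) (restrict_space N Y)"
        using h(1) i J by (intro measurable_restrict_space3) (auto simp: E_def)
      then show "(\<lambda>\<omega>. \<phi> (h i \<omega>)) \<in> measurable (restrict_space ?\<Omega> (E J)) N'"
        by (rule measurable_compose[OF _ \<phi>])
    qed
    moreover have "im (S \<omega>) = (\<lambda>i. \<phi> (h i \<omega>)) ` J" if "\<omega> \<in> space (restrict_space ?\<Omega> (E J))" for \<omega>
      using that J by (auto simp: im_def h(2) space_restrict_space E_def)
    ultimately show "(\<lambda>\<omega>. im (S \<omega>)) \<in> measurable (restrict_space ?\<Omega> e) (finite_sets N')"
      unfolding J(2) by (simp cong: measurable_cong)
  next
    show "countable (E ` Pow {..<k})" by (intro countable_finite) simp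
    show "e \<inter> space ?\<Omega> \<in> sets ?\<Omega>" if "e \<in> E ` Pow {..<k}" for e
      using that E by blast
  qed
qed

lemma comp_im_measurable: "G \<in> fin_meas N' \<Longrightarrow> (\<lambda>S. G (im S)) \<in> fin_meas N"
  by (rule measurable_compose[OF im_measurable])

text \<open>The image of the measure with density \<open>g\<close> vanishes on null sets of
  \<open>N'\<close>, so Radon-Nikodym applies. As \<open>g\<close> may have infinite mass, the
  density takes values in \<open>ennreal\<close>.\<close>

lemma image_intensity:
  assumes g: "g \<in> borel_measurable N"
  shows "\<exists>g'\<in>borel_measurable N'. \<forall>H\<in>borel_measurable N'.
      (\<integral>\<^sup>+y. g' y * H y \<partial>N') = (\<integral>\<^sup>+y. g y * H (\<phi> y) * indicator Y y \<partial>N)"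
proof -
  define R where "R = distr (density (restrict_space N Y) g) N' \<phi>"
  have gR: "g \<in> borel_measurable (restrict_space N Y)"
    using g by (rule measurable_restrict_space1)
  have \<phi>R: "\<phi> \<in> measurable (density (restrict_space N Y) g) N'" using \<phi> by simp
  have int: "(\<integral>\<^sup>+y. H y \<partial>R) = (\<integral>\<^sup>+y. g y * H (\<phi> y) * indicator Y y \<partial>N)" if H: "H \<in> borel_measurable N'" for H
  proof -
    have "(\<integral>\<^sup>+y. H y \<partial>R) = (\<integral>\<^sup>+y. g y * H (\<phi> y) \<partial>restrict_space N Y)"
      unfolding R_def using measurable_compose[OF \<phi> H] H
      by (simp add: nn_integral_distr[OF \<phi>R] nn_integral_density[OF gR])
    also have "\<dots> = (\<integral>\<^sup>+y. g y * H (\<phi> y) * indicator Y y \<partial>N)"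
      using Y by (intro nn_integral_restrict_space) auto
    finally show ?thesis .
  qed
  have ac: "absolutely_continuous N' R"
    unfolding absolutely_continuous_def
  proof
    fix A assume A: "A \<in> null_sets N'"
    have "emeasure R A = (\<integral>\<^sup>+y. indicator A y \<partial>R)"
      using A by (subst nn_integral_indicator) (auto simp: R_def)
    also have "\<dots> = (\<integral>\<^sup>+y. g y * indicator A (\<phi> y) * indicator Y y \<partial>N)"
      using A by (intro int) auto
    also have "\<dots> = (\<integral>\<^sup>+y. 0 \<partial>N)"
      using AE_not_in[OF nonsingular[OF A]]
      by (intro nn_integral_cong_AE, eventually_elim) (auto split: split_indicator)
    finally show "A \<in> null_sets R" using A by (auto simp: null_sets_def R_def)
  qed
  have "sets R = sets N'" by (simp add: R_def)
  from N'.Radon_Nikodym[OF ac this]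
  obtain g' where g': "g' \<in> borel_measurable N'" "density N' g' = R" by blast
  show ?thesis
  proof (intro bexI[OF _ g'(1)] ballI)
    fix H :: "'b \<Rightarrow> ennreal" assume H: "H \<in> borel_measurable N'"
    show "(\<integral>\<^sup>+y. g' y * H y \<partial>N') = (\<integral>\<^sup>+y. g y * H (\<phi> y) * indicator Y y \<partial>N)"
      using int[OF H] nn_integral_density[OF g'(1) H] g'(2) by simp
  qed
qed

text \<open>Inserting a discarded point leaves the image unchanged, whence the constant
  \<open>b\<close>; an accepted point is inserted as its image, distributed by the image
  intensity.\<close>

lemma ins_int_image:
  assumes g: "g \<in> borel_measurable N"
  shows "\<exists>b. \<exists>g'\<in>borel_measurable N'. b + (\<integral>\<^sup>+y. g' y \<partial>N') = (\<integral>\<^sup>+y. g y \<partial>N) \<and>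
    (\<forall>G\<in>fin_meas N'. \<forall>A\<in>fin_subsets N.
      ins_int N g (\<lambda>S. G (im S)) A = affine_ins N' b g' G (im A))"
proof -
  obtain g' where g': "g' \<in> borel_measurable N'" and
    int: "\<forall>H\<in>borel_measurable N'.
      (\<integral>\<^sup>+y. g' y * H y \<partial>N') = (\<integral>\<^sup>+y. g y * H (\<phi> y) * indicator Y y \<partial>N)"
    using image_intensity[OF g] by blast
  define b where "b = (\<integral>\<^sup>+y. g y * indicator (space N - Y) y \<partial>N)"
  have *: "ins_int N g (\<lambda>S. G (im S)) A = affine_ins N' b g' G (im A)"
    if G: "G \<in> fin_meas N'" and A: "A \<in> fin_subsets N" for G A
  proof -
    have m: "(\<lambda>y. G (insert y (im A))) \<in> borel_measurable N'"
      by (intro insert_measurable G im_finite_sets A)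
    have m2: "(\<lambda>y. G (im (insert y A))) \<in> borel_measurable N"
      by (rule insert_measurable[OF comp_im_measurable[OF G] A])
    have "ins_int N g (\<lambda>S. G (im S)) A =
        (\<integral>\<^sup>+y. g y * indicator (space N - Y) y * G (im A) + g y * G (im (insert y A)) * indicator Y y \<partial>N)"
      unfolding ins_int_def by (intro nn_integral_cong) (auto simp: im_def split: split_indicator)
    also have "\<dots> = (\<integral>\<^sup>+y. g y * indicator (space N - Y) y * G (im A) \<partial>N) +
        (\<integral>\<^sup>+y. g y * G (im (insert y A)) * indicator Y y \<partial>N)"
      using g m2 Y by (intro nn_integral_add) auto
    also have "(\<integral>\<^sup>+y. g y * indicator (space N - Y) y * G (im A) \<partial>N) = b * G (im A)"
      unfolding b_def using g Y by (intro nn_integral_multc) auto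
    also have "(\<integral>\<^sup>+y. g y * G (im (insert y A)) * indicator Y y \<partial>N) =
        (\<integral>\<^sup>+y. g y * G (insert (\<phi> y) (im A)) * indicator Y y \<partial>N)"
      by (intro nn_integral_cong) (auto simp: im_def split: split_indicator)
    also have "\<dots> = ins_int N' g' G (im A)"
      unfolding ins_int_def using bspec[OF int m] by simp
    finally show ?thesis by (simp add: affine_ins_def)
  qed
  \<comment> \<open>Evaluated at the constant functional 1, the identity becomes the balance of
    masses.\<close>
  have eq: "b + (\<integral>\<^sup>+y. g' y \<partial>N') = (\<integral>\<^sup>+y. g y \<partial>N)"
    using *[of "\<lambda>_. 1" "{}"] by (simp add: ins_int_def affine_ins_def)
  show ?thesis
  proof (intro exI[of _ b] bexI[OF _ g'] conjI ballI)
    show "ins_int N g (\<lambda>S. G (im S)) A = affine_ins N' b g' G (im A)"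
      if "G \<in> fin_meas N'" "A \<in> fin_subsets N" for G A
      using *[of G A] that by blast
  qed (rule eq)
qed


text \<open>Every generator passes through the image as an affine operator. In the exponential the
  constant commutes with the rest and splits off as a scalar factor. For the individual points it is
  kept, because it becomes the probability that the point is absent.\<close>

lemma pmb_mixture_image:
  assumes \<Psi>: "pmb_mixture N g \<Psi>" and g: "g \<in> borel_measurable N" and fin: "(\<integral>\<^sup>+y. g y \<partial>N) < \<infinity>"
  shows "\<exists>g'\<in>borel_measurable N'. \<exists>hs. (\<integral>\<^sup>+y. g' y \<partial>N') < \<infinity> \<and>
    (\<forall>(c, bs)\<in>set hs. \<forall>(b, h)\<in>set bs. h \<in> borel_measurable N') \<and>
    (\<forall>G\<in>fin_meas N'.
      \<Psi> (\<lambda>S. G (im S)) = (\<Sum>(c, bs)\<leftarrow>hs. c * op_exp (ins_int N' g') (affine_inss N' bs G) {}))"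
proof -
  obtain gs0 where gs0: "\<forall>(c, gs)\<in>set gs0. set gs \<subseteq> borel_measurable N"
    "\<And>G. G \<in> fin_meas N \<Longrightarrow> \<Psi> G = (\<Sum>(c, gs)\<leftarrow>gs0. c * op_exp (ins_int N g) (ins_ints N gs G) {})"
    using \<Psi> unfolding pmb_mixture_def by blast
  define imq where "imq g q \<longleftrightarrow> snd q \<in> borel_measurable N' \<and> (\<forall>G\<in>fin_meas N'. \<forall>A\<in>fin_subsets N.
      ins_int N g (\<lambda>S. G (im S)) A = affine_ins N' (fst q) (snd q) G (im A))" for g q
  have ex: "\<exists>q. imq g q" if g: "g \<in> borel_measurable N" for g
  proof -
    obtain b g' where "g' \<in> borel_measurable N'" "\<forall>G\<in>fin_meas N'. \<forall>A\<in>fin_subsets N.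
        ins_int N g (\<lambda>S. G (im S)) A = affine_ins N' b g' G (im A)"
      using ins_int_image[OF g] by blast
    then have "imq g (b, g')" by (simp add: imq_def)
    then show ?thesis ..
  qed
  \<comment> \<open>One image pair is chosen for every weight, so that whole lists of weights can be
    mapped.\<close>
  define T where "T g = (SOME q. imq g q)" for g
  have imqT: "imq g (T g)" if "g \<in> borel_measurable N" for g
    unfolding T_def by (rule someI_ex[OF ex[OF that]])
  then have T: "snd (T g) \<in> borel_measurable N'"
    "G \<in> fin_meas N' \<Longrightarrow> A \<in> fin_subsets N \<Longrightarrow>
      ins_int N g (\<lambda>S. G (im S)) A = affine_ins N' (fst (T g)) (snd (T g)) G (im A)"
    if "g \<in> borel_measurable N" for g G A
    using that unfolding imq_def by blast+
  have Ts_op: "fin_op N' (affine_inss N' (map T gs))" if "set gs \<subseteq> borel_measurable N" for gs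
  proof (rule N'.fin_op_affine_inss)
    fix b h assume "(b, h) \<in> set (map T gs)"
    then show "h \<in> borel_measurable N'" using T(1) that by (metis imageE list.set_map snd_conv subsetD)
  qed
  have Ts: "ins_ints N gs (\<lambda>S. G (im S)) A = affine_inss N' (map T gs) G (im A)"
    if "set gs \<subseteq> borel_measurable N" "G \<in> fin_meas N'" "A \<in> fin_subsets N" for gs G A
    using that
  proof (induction gs arbitrary: A)
    case (Cons h gs)
    have "ins_ints N (h # gs) (\<lambda>S. G (im S)) A = ins_int N h (\<lambda>S. affine_inss N' (map T gs) G (im S)) A"
      unfolding ins_ints_simps using Cons by (intro ins_int_cong Cons.IH) auto
    also have "\<dots> = affine_inss N' (map T (h # gs)) G (im A)"
      using Cons fin_opD(1)[OF Ts_op[of gs]] by (simp add: T(2) split_def)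
    finally show ?case .
  qed simp
  obtain b g' where g': "g' \<in> borel_measurable N'" and bg: "b + (\<integral>\<^sup>+y. g' y \<partial>N') = (\<integral>\<^sup>+y. g y \<partial>N)"
    and int': "\<forall>G\<in>fin_meas N'. \<forall>A\<in>fin_subsets N.
      ins_int N g (\<lambda>S. G (im S)) A = affine_ins N' b g' G (im A)"
    using ins_int_image[OF g] by blast
  note int = int'[THEN bspec, THEN bspec]
  have pow: "(ins_int N g ^^ n) (\<lambda>S. G (im S)) A = (affine_ins N' b g' ^^ n) G (im A)"
    if "G \<in> fin_meas N'" "A \<in> fin_subsets N" for n G A
    using that
  proof (induction n arbitrary: G)
    case (Suc n)
    have "(ins_int N g ^^ Suc n) (\<lambda>S. G (im S)) A = (ins_int N g ^^ n) (\<lambda>S. affine_ins N' b g' G (im S)) A"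
      unfolding funpow_Suc_right o_def
      by (rule fin_opD(2)[OF fin_op_funpow[OF N.fin_op_ins_int[OF g]] Suc.prems(2)]) (rule int[OF Suc.prems(1)])
    also have "\<dots> = (affine_ins N' b g' ^^ Suc n) G (im A)"
      unfolding funpow_Suc_right o_def
      by (intro Suc.IH N'.affine_ins_measurable g' Suc.prems)
    finally show ?case .
  qed simp
  \<comment> \<open>Finite total mass makes both the discarded and the surviving Poisson mass
    finite; the former is needed to write the scalar factor as a real exponential.\<close>
  have bfin: "b < \<infinity>" and g'fin: "(\<integral>\<^sup>+y. g' y \<partial>N') < \<infinity>"
    using fin unfolding bg[symmetric] by (simp_all add: ennreal_add_less_top)
  have main: "op_exp (ins_int N g) (\<lambda>S. G (im S)) {} = ennreal (exp (enn2real b)) * op_exp (ins_int N' g') G {}"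
    if G: "G \<in> fin_meas N'" for G
  proof -
    have "op_exp (ins_int N g) (\<lambda>S. G (im S)) {} = op_exp (affine_ins N' b g') G {}"
      unfolding op_exp_def using pow[OF G] by (simp add: im_def)
    also have "\<dots> = op_exp (\<lambda>G A. b * G A) (op_exp (ins_int N' g') G) {}"
    proof -
      have 1: "affine_ins N' b g' = (\<lambda>G A. b * G A + ins_int N' g' G A)"
        by (simp add: affine_ins_def fun_eq_iff)
      have "ops_commute N' (\<lambda>G A. b * G A) (ins_int N' g')"
        using fin_opD(4)[OF N'.fin_op_ins_int[OF g']] by (simp add: ops_commute_def)
      then show ?thesis
        unfolding 1 by (rule op_exp_add[OF fin_op_cmult N'.fin_op_ins_int[OF g'] _ G empty_finite_sets])
    qed
    also have "\<dots> = ennreal (exp (enn2real b)) * op_exp (ins_int N' g') G {}"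
      using op_exp_cmult_op[of "enn2real b"] bfin by simp
    finally show ?thesis .
  qed
  define hs where "hs = map (\<lambda>(c, gs). (c * ennreal (exp (enn2real b)), map T gs)) gs0"
  have hs_meas: "h \<in> borel_measurable N'" if cbs: "(c, bs) \<in> set hs" and dh: "(d, h) \<in> set bs" for c bs d h
  proof -
    obtain c' gs where gs: "(c', gs) \<in> set gs0" "bs = map T gs"
      using cbs unfolding hs_def by auto
    obtain h' where h': "h' \<in> set gs" "(d, h) = T h'"
      using dh unfolding gs(2) by auto
    have "h' \<in> borel_measurable N"
      using bspec[OF gs0(1) gs(1)] h'(1) by auto
    from T(1)[OF this] show ?thesis unfolding h'(2)[symmetric] by simp
  qed
  have "\<Psi> (\<lambda>S. G (im S)) = (\<Sum>(c, bs)\<leftarrow>hs. c * op_exp (ins_int N' g') (affine_inss N' bs G) {})"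
    if G: "G \<in> fin_meas N'" for G
  proof -
    have "c * op_exp (ins_int N g) (ins_ints N gs (\<lambda>S. G (im S))) {} =
        c * ennreal (exp (enn2real b)) * op_exp (ins_int N' g') (affine_inss N' (map T gs) G) {}"
      if "(c, gs) \<in> set gs0" for c gs
    proof -
      have gs: "set gs \<subseteq> borel_measurable N" using bspec[OF gs0(1) that] by simp
      have "op_exp (ins_int N g) (ins_ints N gs (\<lambda>S. G (im S))) {} =
          op_exp (ins_int N g) (\<lambda>S. affine_inss N' (map T gs) G (im S)) {}"
        by (rule op_exp_cong[OF N.fin_op_ins_int[OF g]]) (simp_all add: Ts[OF gs G])
      also have "\<dots> = ennreal (exp (enn2real b)) * op_exp (ins_int N' g') (affine_inss N' (map T gs) G) {}"
        by (rule main[OF fin_opD(1)[OF Ts_op[OF gs] G]])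
      finally show ?thesis by (simp add: mult.assoc)
    qed
    then show ?thesis
      unfolding gs0(2)[OF comp_im_measurable[OF G]] hs_def
      by (simp add: o_def split_def cong: map_cong)
  qed
  then show ?thesis
    using g'fin hs_meas by (intro bexI[OF _ g'] exI[of _ hs] conjI) auto
qed

end

subsection \<open>Normalisation\<close>

context diffuse_measure
begin

lemma ins_int_AE_cong:
  assumes "AE y in M. g y = h y"
  shows "ins_int M g G A = ins_int M h G A"
  unfolding ins_int_def using assms by (intro nn_integral_cong_AE) (auto elim: eventually_mono)

lemma ins_int_const: "h \<in> borel_measurable M \<Longrightarrow> ins_int M h (\<lambda>_. c) A = c * (\<integral>\<^sup>+y. h y \<partial>M)"
  unfolding ins_int_def by (subst nn_integral_multc) (auto simp: mult.commute)

text \<open>With \<open>s\<close> the mass of \<open>h\<close>, the existence probability is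
  \<open>s / \<rho>\<close> and the density is \<open>h / s\<close>. If \<open>s = 0\<close> the
  point almost surely does not exist; then the probability is 0 and \<open>p0\<close> is a mere
  placeholder.\<close>

lemma affine_ins_normalise:
  assumes h: "h \<in> borel_measurable M" and \<rho>: "b + (\<integral>\<^sup>+y. h y \<partial>M) = \<rho>" "\<rho> \<noteq> 0" "\<rho> < \<infinity>"
    and p0: "is_prob_density M p0"
  shows "\<exists>r p. r \<in> {0..1} \<and> is_prob_density M p \<and> (\<forall>G\<in>fin_meas M. \<forall>A\<in>fin_subsets M.
    affine_ins M b h G A = \<rho> * affine_ins M (ennreal (1 - r)) (\<lambda>y. ennreal (r * p y)) G A)"
proof -
  define s where "s = (\<integral>\<^sup>+y. h y \<partial>M)"
  have bs_fin: "b < \<infinity>" "s < \<infinity>" using \<rho> by (auto simp: s_def ennreal_add_less_top)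
  obtain br where br: "0 \<le> br" "b = ennreal br" using bs_fin by (cases b) auto
  obtain sr where sr: "0 \<le> sr" "s = ennreal sr" using bs_fin by (cases s) auto
  have \<rho>r: "\<rho> = ennreal (br + sr)" using \<rho>(1) br sr by (simp add: s_def ennreal_plus)
  have pos: "0 < br + sr" using \<rho>(2) br sr by (cases "br + sr = 0") (auto simp: \<rho>r)
  show ?thesis
  proof (cases "sr = 0")
    case True
    then have "AE y in M. h y = 0"
      using nn_integral_0_iff_AE[OF h] by (simp add: s_def[symmetric] sr)
    then have z: "ins_int M h G A = ins_int M (\<lambda>_. 0) G A" for G A by (rule ins_int_AE_cong)
    have "affine_ins M b h G A = \<rho> * affine_ins M (ennreal (1 - 0)) (\<lambda>y. ennreal (0 * p0 y)) G A" for G A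
      unfolding affine_ins_def z using True \<rho>r br by (simp add: ins_int_def)
    then show ?thesis using p0 by (intro exI[of _ 0] exI[of _ p0]) auto
  next
    case False
    then have sr0: "0 < sr" using sr by simp
    define r where "r = sr / (br + sr)"
    \<comment> \<open>\<open>h\<close> may be infinite on a null set, so the real density agrees
      with \<open>h / s\<close> only almost everywhere, which integrals do not notice.\<close>
    define p where "p y = enn2real (h y) / sr" for y
    have fin: "AE y in M. h y \<noteq> \<infinity>"
      using bs_fin(2) by (intro nn_integral_PInf_AE[OF h]) (simp add: s_def)
    have r: "r \<in> {0..1}" using pos br sr by (simp add: r_def)
    have "(\<integral>\<^sup>+y. ennreal (p y) \<partial>M) = (\<integral>\<^sup>+y. h y * ennreal (1 / sr) \<partial>M)"
      using fin
    proof (intro nn_integral_cong_AE, eventually_elim)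
      case (elim y)
      then have "h y = ennreal (enn2real (h y))" by (simp add: less_top)
      then show ?case using sr0
        by (metis ennreal_mult'' enn2real_nonneg p_def mult.right_neutral times_divide_eq_right
            less_imp_le divide_nonneg_nonneg zero_le_one)
    qed
    also have "\<dots> = ennreal sr * ennreal (1 / sr)"
      using h by (simp add: nn_integral_multc s_def[symmetric] sr(2))
    also have "\<dots> = 1" using sr0 by (simp add: ennreal_mult''[symmetric])
    finally have p: "is_prob_density M p"
      using h sr0 by (auto simp: is_prob_density_def p_def[abs_def])
    have b1: "b = \<rho> * ennreal (1 - r)"
    proof -
      have "br = (br + sr) * (1 - r)" using pos by (simp add: r_def field_simps)
      then show ?thesis using r pos unfolding br(2) \<rho>r
        by (metis ennreal_mult'' atLeastAtMost_iff diff_ge_0_iff_ge)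
    qed
    have h1: "AE y in M. h y = \<rho> * ennreal (r * p y)"
      using fin
    proof eventually_elim
      case (elim y)
      have rp: "0 \<le> r * p y" using r sr0 by (simp add: p_def)
      have "enn2real (h y) = (br + sr) * (r * p y)" using pos sr0 by (simp add: r_def p_def)
      then have "ennreal (enn2real (h y)) = \<rho> * ennreal (r * p y)"
        using rp pos unfolding \<rho>r by (metis ennreal_mult'')
      then show ?case using elim by (simp add: less_top)
    qed
    have "affine_ins M b h G A = \<rho> * affine_ins M (ennreal (1 - r)) (\<lambda>y. ennreal (r * p y)) G A"
      if G: "G \<in> fin_meas M" and A: "A \<in> fin_subsets M" for G A
    proof -
      have [measurable]: "p \<in> borel_measurable M" using p by (simp add: is_prob_density_def)
      note insert_measurable[OF G A, measurable]
      have "ins_int M h G A = ins_int M (\<lambda>y. \<rho> * ennreal (r * p y)) G A"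
        by (rule ins_int_AE_cong[OF h1])
      also have "\<dots> = \<rho> * ins_int M (\<lambda>y. ennreal (r * p y)) G A"
        unfolding ins_int_def mult.assoc by (intro nn_integral_cmult) measurable
      finally show ?thesis
        unfolding affine_ins_def distrib_left by (subst b1) (simp add: mult.assoc)
    qed
    then show ?thesis using r p by (intro exI[of _ r] exI[of _ p]) auto
  qed
qed

definition valid_bernoulli :: "real \<times> ('a \<Rightarrow> real) \<Rightarrow> bool" where
  "valid_bernoulli q \<longleftrightarrow> fst q \<in> {0..1} \<and> is_prob_density M (snd q)"

abbreviation bern_ins :: "real \<times> ('a \<Rightarrow> real) \<Rightarrow> ('a set \<Rightarrow> ennreal) \<Rightarrow> 'a set \<Rightarrow> ennreal" where
  "bern_ins q \<equiv> affine_ins M (ennreal (1 - fst q)) (\<lambda>y. ennreal (fst q * snd q y))"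

abbreviation bern_inss :: "(real \<times> ('a \<Rightarrow> real)) list \<Rightarrow> ('a set \<Rightarrow> ennreal) \<Rightarrow> 'a set \<Rightarrow> ennreal" where
  "bern_inss qs \<equiv> foldr bern_ins qs"

lemma fin_op_bern_ins: "valid_bernoulli q \<Longrightarrow> fin_op M (bern_ins q)"
  by (rule fin_op_affine_ins) (auto simp: valid_bernoulli_def is_prob_density_def)

lemma fin_op_bern_inss: "\<forall>q\<in>set qs. valid_bernoulli q \<Longrightarrow> fin_op M (bern_inss qs)"
proof (induction qs)
  case (Cons q qs)
  have "fin_op M (\<lambda>G. bern_ins q (bern_inss qs G))"
    by (rule fin_op_compose[OF fin_op_bern_ins Cons.IH]) (use Cons.prems in auto)
  then show ?case by (simp add: o_def)
qed (simp add: fin_op_id id_def)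

text \<open>Each track has total mass \<open>(1 - r) + r = 1\<close>, so tracks do not affect the
  normalisation.\<close>

lemma bern_inss_one:
  assumes "\<forall>q\<in>set qs. valid_bernoulli q" "A \<in> fin_subsets M"
  shows "bern_inss qs (\<lambda>_. 1) A = 1"
  using assms
proof (induction qs arbitrary: A)
  case (Cons q qs)
  have q: "fst q \<in> {0..1}" "is_prob_density M (snd q)" using Cons by (auto simp: valid_bernoulli_def)
  have qm: "(\<lambda>y. ennreal (fst q * snd q y)) \<in> borel_measurable M"
    using q(2) by (auto simp: is_prob_density_def)
  have "bern_inss (q # qs) (\<lambda>_. 1) A = bern_ins q (bern_inss qs (\<lambda>_. 1)) A" by simp
  also have "\<dots> = bern_ins q (\<lambda>_. 1) A"
    using Cons by (intro fin_opD(2)[OF fin_op_affine_ins[OF qm]]) auto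
  also have "\<dots> = ennreal (1 - fst q) + (\<integral>\<^sup>+y. ennreal (fst q * snd q y) \<partial>M)"
    by (simp add: affine_ins_def ins_int_const[OF qm])
  also have "(\<integral>\<^sup>+y. ennreal (fst q * snd q y) \<partial>M) = ennreal (fst q)"
    using q by (simp add: ennreal_mult' nn_integral_cmult is_prob_density_def)
  also have "ennreal (1 - fst q) + ennreal (fst q) = 1"
    using q(1) by (simp add: ennreal_plus[symmetric] del: ennreal_plus)
  finally show ?case .
qed simp

lemma affine_inss_normalise:
  assumes "\<And>b h. (b, h) \<in> set bs \<Longrightarrow> h \<in> borel_measurable M"
    and "\<And>b h. (b, h) \<in> set bs \<Longrightarrow> b + (\<integral>\<^sup>+y. h y \<partial>M) \<noteq> 0 \<and> b + (\<integral>\<^sup>+y. h y \<partial>M) < \<infinity>"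
    and p0: "is_prob_density M p0"
  shows "\<exists>qs. length qs = length bs \<and> (\<forall>q\<in>set qs. valid_bernoulli q) \<and>
    (\<forall>G\<in>fin_meas M. \<forall>A\<in>fin_subsets M.
      affine_inss M bs G A = (\<Prod>(b, h)\<leftarrow>bs. b + (\<integral>\<^sup>+y. h y \<partial>M)) * bern_inss qs G A)"
  using assms(1,2)
proof (induction bs)
  case (Cons bh bs)
  obtain b h where bh: "bh = (b, h)" by (cases bh)
  have h: "h \<in> borel_measurable M" using Cons.prems(1)[of b h] bh by simp
  define \<rho> where "\<rho> = b + (\<integral>\<^sup>+y. h y \<partial>M)"
  have "\<exists>qs. length qs = length bs \<and> (\<forall>q\<in>set qs. valid_bernoulli q) \<and>
    (\<forall>G\<in>fin_meas M. \<forall>A\<in>fin_subsets M.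
      affine_inss M bs G A = (\<Prod>(b, h)\<leftarrow>bs. b + (\<integral>\<^sup>+y. h y \<partial>M)) * bern_inss qs G A)"
    by (rule Cons.IH) (use Cons.prems in auto)
  then obtain qs where len: "length qs = length bs" and qs: "\<forall>q\<in>set qs. valid_bernoulli q"
    and eq: "\<forall>G\<in>fin_meas M. \<forall>A\<in>fin_subsets M.
      affine_inss M bs G A = (\<Prod>(b, h)\<leftarrow>bs. b + (\<integral>\<^sup>+y. h y \<partial>M)) * bern_inss qs G A"
    by (elim exE conjE)
  have "\<rho> \<noteq> 0" "\<rho> < \<infinity>" using Cons.prems(2)[of b h] bh by (auto simp: \<rho>_def)
  from affine_ins_normalise[OF h \<rho>_def[symmetric] this p0]
  obtain r p where rp: "r \<in> {0..1}" "is_prob_density M p"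
    and eq1: "\<forall>G\<in>fin_meas M. \<forall>A\<in>fin_subsets M.
      affine_ins M b h G A = \<rho> * affine_ins M (ennreal (1 - r)) (\<lambda>y. ennreal (r * p y)) G A"
    by (elim exE conjE)
  define q where "q = (r, p)"
  have q: "valid_bernoulli q" using rp by (simp add: q_def valid_bernoulli_def)
  let ?c = "\<Prod>(b, h)\<leftarrow>bs. b + (\<integral>\<^sup>+y. h y \<partial>M)"
  have "affine_inss M (bh # bs) G A = (\<rho> * ?c) * bern_inss (q # qs) G A"
    if G: "G \<in> fin_meas M" and A: "A \<in> fin_subsets M" for G A
  proof -
    have m: "bern_inss qs G \<in> fin_meas M" by (rule fin_opD(1)[OF fin_op_bern_inss[OF qs] G])
    have "affine_inss M (bh # bs) G A = affine_ins M b h (affine_inss M bs G) A" by (simp add: bh)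
    also have "\<dots> = affine_ins M b h (\<lambda>B. ?c * bern_inss qs G B) A"
      by (rule fin_opD(2)[OF fin_op_affine_ins[OF h] A]) (rule eq[THEN bspec, THEN bspec, OF G])
    also have "\<dots> = ?c * affine_ins M b h (bern_inss qs G) A"
      by (rule fin_opD(4)[OF fin_op_affine_ins[OF h] m A])
    also have "\<dots> = (\<rho> * ?c) * bern_inss (q # qs) G A"
      using eq1[THEN bspec, THEN bspec, OF m A] by (simp add: q_def ac_simps)
    finally show ?thesis .
  qed
  moreover have "(\<Prod>(b, h)\<leftarrow>bh # bs. b + (\<integral>\<^sup>+y. h y \<partial>M)) = \<rho> * ?c" by (simp add: bh \<rho>_def)
  ultimately have "\<forall>G\<in>fin_meas M. \<forall>A\<in>fin_subsets M. affine_inss M (bh # bs) G A =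
      (\<Prod>(b, h)\<leftarrow>bh # bs. b + (\<integral>\<^sup>+y. h y \<partial>M)) * bern_inss (q # qs) G A" by simp
  then show ?case using len qs q by (intro exI[of _ "q # qs"]) simp
qed simp

text \<open>A factor with mass zero has \<open>b = 0\<close> and \<open>h = 0\<close> almost
  everywhere, so it annihilates every functional. This treats the terms that cannot be
  normalised.\<close>

lemma affine_inss_eq_0:
  assumes "\<And>b h. (b, h) \<in> set bs \<Longrightarrow> h \<in> borel_measurable M"
    and "(b0, h0) \<in> set bs" "b0 + (\<integral>\<^sup>+y. h0 y \<partial>M) = 0" and A: "A \<in> fin_subsets M"
  shows "affine_inss M bs G A = 0"
  using assms
proof (induction bs arbitrary: A)
  case (Cons bh bs)
  obtain b h where bh: "bh = (b, h)" by (cases bh)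
  have h: "h \<in> borel_measurable M" using Cons.prems(1)[of b h] bh by simp
  show ?case
  proof (cases "(b0, h0) = (b, h)")
    case True
    then have b: "b = 0" and "(\<integral>\<^sup>+y. h y \<partial>M) = 0" using Cons.prems(3) by auto
    then have "AE y in M. h y = 0" using nn_integral_0_iff_AE[OF h] by simp
    then have "ins_int M h X A = ins_int M (\<lambda>_. 0) X A" for X by (rule ins_int_AE_cong)
    then show ?thesis by (simp add: bh b affine_ins_def ins_int_def)
  next
    case False
    have z: "affine_inss M bs G B = 0" if "B \<in> fin_subsets M" for B
      using Cons.prems False that by (intro Cons.IH) (auto simp: bh)
    have "affine_inss M (bh # bs) G A = affine_ins M b h (affine_inss M bs G) A" by (simp add: bh)
    also have "\<dots> = affine_ins M b h (\<lambda>_. 0) A"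
      using z by (intro fin_opD(2)[OF fin_op_affine_ins[OF h] Cons.prems(4)])
    also have "\<dots> = 0" by (simp add: affine_ins_def ins_int_def)
    finally show ?thesis .
  qed
qed simp

lemma op_exp_const:
  assumes g: "g \<in> borel_measurable M" and I: "(\<integral>\<^sup>+y. g y \<partial>M) = ennreal L" "0 \<le> L"
    and A: "A \<in> fin_subsets M"
  shows "op_exp (ins_int M g) (\<lambda>_. 1) A = ennreal (exp L)"
proof -
  have pow: "(ins_int M g ^^ n) (\<lambda>_. 1) A = ennreal (L ^ n)" if "A \<in> fin_subsets M" for n A
    using that
  proof (induction n arbitrary: A)
    case (Suc n)
    have "(ins_int M g ^^ Suc n) (\<lambda>_. 1) A = ins_int M g ((ins_int M g ^^ n) (\<lambda>_. 1)) A" by simp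
    also have "\<dots> = ins_int M g (\<lambda>_. ennreal (L ^ n)) A"
      using Suc by (intro ins_int_cong) auto
    finally show ?case using I(2) by (simp add: ins_int_const[OF g] I ennreal_mult' mult.commute)
  qed simp
  have "op_exp (ins_int M g) (\<lambda>_. 1) A = op_exp (\<lambda>G A. ennreal L * G A) (\<lambda>_. 1) A"
  proof -
    have "((\<lambda>G A. ennreal L * G A) ^^ n) (\<lambda>_. 1) A = ennreal (L ^ n)" for n
      using I(2) by (induction n arbitrary: A) (auto simp: ennreal_mult')
    then show ?thesis by (simp add: op_exp_def pow[OF A])
  qed
  then show ?thesis using op_exp_cmult_op[OF I(2), of "\<lambda>_. 1" A] by simp
qed

lemma intensity_real_version:
  assumes g: "g \<in> borel_measurable M" and fin: "(\<integral>\<^sup>+y. g y \<partial>M) < \<infinity>"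
  shows "\<exists>lam. is_intensity M lam \<and> (AE y in M. g y = ennreal (lam y)) \<and>
    (\<integral>\<^sup>+y. g y \<partial>M) = ennreal (\<integral>y. lam y \<partial>M)"
proof -
  define lam where "lam y = enn2real (g y)" for y
  have AE: "AE y in M. g y = ennreal (lam y)"
  proof -
    have "AE y in M. g y \<noteq> \<infinity>" using fin by (intro nn_integral_PInf_AE[OF g]) auto
    then show ?thesis by eventually_elim (simp add: lam_def less_top)
  qed
  then have I: "(\<integral>\<^sup>+y. g y \<partial>M) = (\<integral>\<^sup>+y. ennreal (lam y) \<partial>M)" by (rule nn_integral_cong_AE)
  have m: "lam \<in> borel_measurable M" using g by (simp add: lam_def[abs_def])
  have int: "integrable M lam"
    using I fin m by (intro integrableI_nonneg) (auto simp: lam_def)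
  have "(\<integral>\<^sup>+y. ennreal (lam y) \<partial>M) = ennreal (\<integral>y. lam y \<partial>M)"
    by (rule nn_integral_eq_integral[OF int]) (simp add: lam_def)
  then show ?thesis using int AE I by (intro exI[of _ lam]) (auto simp: is_intensity_def lam_def)
qed

end

section \<open>Assembling the PMBM density\<close>

lemma set_conv_nonneg:
  fixes C :: "'a set \<Rightarrow> real"
  assumes "\<And>B. B \<subseteq> A \<Longrightarrow> 0 \<le> C B" "\<And>i B. i \<in> T \<Longrightarrow> B \<subseteq> A \<Longrightarrow> 0 \<le> b i B"
  shows "0 \<le> set_conv C b T A"
proof -
  have "0 \<le> C (D None)" "\<And>i. i \<in> T \<Longrightarrow> 0 \<le> b i (D (Some i))" if "D \<in> splits T A" for D
    using splits_subset[OF that] assms by auto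
  then show ?thesis
    unfolding set_conv_def by (intro sum_nonneg mult_nonneg_nonneg prod_nonneg) auto
qed

text \<open>Since a zero factor absorbs infinity in \<open>ennreal\<close>, an infinite factor
  forces an infinite product only if no factor vanishes.\<close>

lemma prod_list_ennreal_eq_top:
  fixes xs :: "ennreal list"
  assumes "\<And>x. x \<in> set xs \<Longrightarrow> x \<noteq> 0" "\<infinity> \<in> set xs"
  shows "prod_list xs = \<infinity>"
  using assms
proof (induction xs)
  case (Cons x xs)
  have "prod_list xs \<noteq> 0" using Cons.prems by (auto simp: prod_list_zero_iff)
  then show ?case using Cons by (auto simp: ennreal_mult_eq_top_iff)
qed simp

context diffuse_measure
begin

lemma affine_inss_one:
  assumes "\<And>b h. (b, h) \<in> set bs \<Longrightarrow> h \<in> borel_measurable M" and A: "A \<in> fin_subsets M"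
  shows "affine_inss M bs (\<lambda>_. 1) A = (\<Prod>(b, h)\<leftarrow>bs. b + (\<integral>\<^sup>+y. h y \<partial>M))"
  using assms
proof (induction bs arbitrary: A)
  case (Cons bh bs)
  obtain b h where bh: "bh = (b, h)" by (cases bh)
  have h: "h \<in> borel_measurable M" using Cons.prems(1)[of b h] bh by simp
  let ?c = "\<Prod>(b, h)\<leftarrow>bs. b + (\<integral>\<^sup>+y. h y \<partial>M)"
  have "affine_inss M (bh # bs) (\<lambda>_. 1) A = affine_ins M b h (affine_inss M bs (\<lambda>_. 1)) A"
    by (simp add: bh)
  also have "\<dots> = affine_ins M b h (\<lambda>_. ?c) A"
    using Cons by (intro fin_opD(2)[OF fin_op_affine_ins[OF h] Cons.prems(2)]) auto
  also have "\<dots> = b * ?c + ?c * (\<integral>\<^sup>+y. h y \<partial>M)"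
    by (simp add: affine_ins_def ins_int_const[OF h])
  finally show ?case by (simp add: bh distrib_right mult.commute)
qed simp

text \<open>The weight \<open>w\<close> is the total mass of the term: \<open>c\<close> times the
  masses of its points times the Poisson mass \<open>exp L\<close>. If \<open>c\<close> or the mass
  of some point is zero, the term vanishes and gets weight 0 without tracks. Otherwise the finite
  total mass forces every point to have finite mass, so each can be normalised.\<close>

lemma pmb_term_normalise:
  assumes g: "g \<in> borel_measurable M" and I: "(\<integral>\<^sup>+y. g y \<partial>M) = ennreal L" "0 \<le> L"
    and bs: "\<And>b h. (b, h) \<in> set bs \<Longrightarrow> h \<in> borel_measurable M" and p0: "is_prob_density M p0"
    and fin: "c * op_exp (ins_int M g) (affine_inss M bs (\<lambda>_. 1)) {} < \<infinity>"
  shows "\<exists>w qs. 0 \<le> w \<and> (\<forall>q\<in>set qs. valid_bernoulli q) \<and> (\<forall>G\<in>fin_meas M.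
    c * op_exp (ins_int M g) (affine_inss M bs G) {} =
    ennreal w * (ennreal (exp (- L)) * op_exp (ins_int M g) (bern_inss qs G) {}))"
proof (cases "c = 0 \<or> (\<exists>(b, h)\<in>set bs. b + (\<integral>\<^sup>+y. h y \<partial>M) = 0)")
  case True
  have "c * op_exp (ins_int M g) (affine_inss M bs G) {} = 0" for G
  proof (cases "c = 0")
    case False
    then obtain b h where bh: "(b, h) \<in> set bs" "b + (\<integral>\<^sup>+y. h y \<partial>M) = 0" using True by auto
    have "op_exp (ins_int M g) (affine_inss M bs G) {} = op_exp (ins_int M g) (\<lambda>_. 0) {}"
      using affine_inss_eq_0[OF bs bh] by (intro op_exp_cong[OF fin_op_ins_int[OF g]]) auto
    also have "\<dots> = 0" using op_exp_cmult[OF fin_op_ins_int[OF g], of "\<lambda>_. 0" "{}" 0] by simp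
    finally show ?thesis by simp
  qed simp
  then show ?thesis by (intro exI[of _ 0] exI[of _ "[]"]) simp
next
  case False
  then have nz: "c \<noteq> 0" "\<And>b h. (b, h) \<in> set bs \<Longrightarrow> b + (\<integral>\<^sup>+y. h y \<partial>M) \<noteq> 0" by auto
  define P where "P = (\<Prod>(b, h)\<leftarrow>bs. b + (\<integral>\<^sup>+y. h y \<partial>M))"
  have "op_exp (ins_int M g) (affine_inss M bs (\<lambda>_. 1)) {} = op_exp (ins_int M g) (\<lambda>_. P * 1) {}"
    using affine_inss_one[OF bs] by (intro op_exp_cong[OF fin_op_ins_int[OF g]]) (auto simp: P_def)
  also have "\<dots> = P * ennreal (exp L)"
    by (subst op_exp_cmult[OF fin_op_ins_int[OF g]]) (simp_all add: op_exp_const[OF g I])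
  finally have cP: "c * (P * ennreal (exp L)) < \<infinity>" using fin by simp
  then have Pfin: "P < \<infinity>"
    using nz(1) by (auto simp: ennreal_mult_less_top less_top ennreal_mult_eq_top_iff)
  have \<rho>_fin: "b + (\<integral>\<^sup>+y. h y \<partial>M) < \<infinity>" if "(b, h) \<in> set bs" for b h
  proof (rule ccontr)
    assume "\<not> b + (\<integral>\<^sup>+y. h y \<partial>M) < \<infinity>"
    then have top: "\<infinity> = (case (b, h) of (b, h) \<Rightarrow> b + (\<integral>\<^sup>+y. h y \<partial>M))"
      by (metis infinity_ennreal_def top.not_eq_extremum prod.case)
    have "\<infinity> \<in> set (map (\<lambda>(b, h). b + (\<integral>\<^sup>+y. h y \<partial>M)) bs)"
      unfolding set_map using top that by (rule image_eqI)
    then have "P = \<infinity>" unfolding P_def using nz(2) by (intro prod_list_ennreal_eq_top) auto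
    then show False using Pfin by simp
  qed
  obtain qs where qs: "\<forall>q\<in>set qs. valid_bernoulli q"
    and eq: "\<forall>G\<in>fin_meas M. \<forall>A\<in>fin_subsets M. affine_inss M bs G A = P * bern_inss qs G A"
  proof -
    have "\<exists>qs. length qs = length bs \<and> (\<forall>q\<in>set qs. valid_bernoulli q) \<and>
      (\<forall>G\<in>fin_meas M. \<forall>A\<in>fin_subsets M. affine_inss M bs G A = P * bern_inss qs G A)"
      unfolding P_def by (rule affine_inss_normalise[OF _ _ p0]) (use bs nz(2) \<rho>_fin in blast)+
    then show thesis by (elim exE conjE) (rule that)
  qed
  define w where "w = enn2real (c * (P * ennreal (exp L)))"
  have w: "ennreal w = c * (P * ennreal (exp L))" using cP by (simp add: w_def less_top)
  have ee: "ennreal (exp L) * ennreal (exp (- L)) = 1"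
    by (simp add: ennreal_mult'[symmetric] exp_minus)
  have "c * op_exp (ins_int M g) (affine_inss M bs G) {} =
    ennreal w * (ennreal (exp (- L)) * op_exp (ins_int M g) (bern_inss qs G) {})" if G: "G \<in> fin_meas M" for G
  proof -
    have "op_exp (ins_int M g) (affine_inss M bs G) {} = op_exp (ins_int M g) (\<lambda>A. P * bern_inss qs G A) {}"
      using bspec[OF eq G] by (intro op_exp_cong[OF fin_op_ins_int[OF g]]) auto
    also have "\<dots> = P * op_exp (ins_int M g) (bern_inss qs G) {}"
      by (rule op_exp_cmult[OF fin_op_ins_int[OF g] fin_opD(1)[OF fin_op_bern_inss[OF qs] G]]) simp
    also have "c * \<dots> = c * P * (ennreal (exp L) * ennreal (exp (- L))) * op_exp (ins_int M g) (bern_inss qs G) {}"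
      unfolding ee by (simp add: ac_simps)
    also have "\<dots> = ennreal w * (ennreal (exp (- L)) * op_exp (ins_int M g) (bern_inss qs G) {})"
      unfolding w by (simp add: ac_simps)
    finally show ?thesis .
  qed
  then show ?thesis using qs by (intro exI[of _ w] exI[of _ qs]) (simp add: w_def)
qed

text \<open>A track with existence probability 0 acts as the identity. Components with different
  numbers of points can thus be padded to a common set of tracks.\<close>

lemma bern_inss_pad:
  assumes "length qs \<le> n"
  shows "foldr (\<lambda>i. bern_ins (if i < length qs then qs ! i else (0, p0))) [0..<n] G = bern_inss qs G"
proof -
  let ?q = "\<lambda>i. if i < length qs then qs ! i else (0, p0)"
  have id: "bern_ins (0, p0) G = G" for G
    by (simp add: affine_ins_def ins_int_def fun_eq_iff)
  have "foldr (\<lambda>i. bern_ins (?q i)) [length qs..<n] G = G"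
  proof -
    have "foldr (\<lambda>i. bern_ins (?q i)) xs G = G" if "\<forall>i\<in>set xs. length qs \<le> i" for xs
      using that
    proof (induction xs)
      case (Cons i xs)
      then have "?q i = (0, p0)" by simp
      then show ?case using Cons id[of G] by simp
    qed simp
    then show ?thesis by simp
  qed
  moreover have "foldr (\<lambda>i. bern_ins (?q i)) [0..<length qs] H = bern_inss qs H" for H
  proof -
    have "bern_inss qs H = foldr bern_ins (map ?q [0..<length qs]) H"
      by (rule arg_cong[where f = "\<lambda>l. foldr bern_ins l H"]) (auto intro: nth_equalityI)
    then show ?thesis by (simp add: foldr_map o_def)
  qed
  moreover have "[0..<n] = [0..<length qs] @ [length qs..<n]"
    using assms by (metis le_add_diff_inverse upt_add_eq_append zero_le)
  ultimately show ?thesis by simp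
qed

text \<open>The Poisson factor is the same for all components, so the sum over components may be
  moved inside the sum over splits, as the form of a PMBM density requires.\<close>

lemma pmbm_density_of_components:
  fixes q :: "nat \<Rightarrow> nat \<Rightarrow> real \<times> ('a \<Rightarrow> real)" and w :: "nat \<Rightarrow> real"
  assumes lam: "is_intensity M lam" and n: "0 < n" and w: "\<And>j. j < m \<Longrightarrow> 0 \<le> w j" "(\<Sum>j<m. w j) = 1"
    and q: "\<And>i j. i < n \<Longrightarrow> j < m \<Longrightarrow> valid_bernoulli (q i j)"
  defines "f \<equiv> \<lambda>A. \<Sum>j<m. w j *
    set_conv (ppp_density M lam) (\<lambda>i. bernoulli_density (fst (q i j)) (snd (q i j))) {..<n} A"
  shows "pmbm_density M f"
    and "(\<lambda>A. ennreal (f A)) \<in> fin_meas M"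
    and "G \<in> fin_meas M \<Longrightarrow> (\<integral>\<^sup>+A. ennreal (f A) * G A \<partial>finite_sets M) = (\<Sum>j<m. ennreal (w j) *
      (ennreal (exp (- (\<integral>x. lam x \<partial>M))) * op_exp (ins_int M (\<lambda>y. ennreal (lam y)))
        (foldr (\<lambda>i. bern_ins (q i j)) [0..<n] G) {}))"
proof -
  \<comment> \<open>Hypothesis \<open>j\<close> selects component \<open>j\<close> of every track; \<open>n > 0\<close> makes this encoding injective.\<close>
  define a where "a j = (\<lambda>i\<in>{..<n}. j)" for j :: nat
  have a0: "a j 0 = j" for j using n by (simp add: a_def)
  have inj: "inj a" by (rule injI) (metis a0)
  have fA: "f A = (\<Sum>D\<in>splits {..<n} A. ppp_density M lam (D None) * (\<Sum>h\<in>a ` {..<m}. w (h 0) *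
      (\<Prod>i<n. bernoulli_density (fst (q i (h i))) (snd (q i (h i))) (D (Some i)))))" for A
  proof -
    have "(\<Sum>h\<in>a ` {..<m}. w (h 0) * (\<Prod>i<n. bernoulli_density (fst (q i (h i))) (snd (q i (h i))) (D (Some i)))) =
        (\<Sum>j<m. w j * (\<Prod>i<n. bernoulli_density (fst (q i j)) (snd (q i j)) (D (Some i))))"
      for D :: "nat option \<Rightarrow> 'a set"
      using inj_on_subset[OF inj, of "{..<m}"] n by (subst sum.reindex) (auto simp: a_def)
    note * = this
    have "f A = (\<Sum>j<m. \<Sum>D\<in>splits {..<n} A. w j * (ppp_density M lam (D None) *
        (\<Prod>i<n. bernoulli_density (fst (q i j)) (snd (q i j)) (D (Some i)))))"
      by (simp add: f_def set_conv_def sum_distrib_left)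
    also have "\<dots> = (\<Sum>D\<in>splits {..<n} A. \<Sum>j<m. w j * (ppp_density M lam (D None) *
        (\<Prod>i<n. bernoulli_density (fst (q i j)) (snd (q i j)) (D (Some i)))))"
      by (rule sum.swap)
    also have "\<dots> = (\<Sum>D\<in>splits {..<n} A. ppp_density M lam (D None) * (\<Sum>j<m. w j *
        (\<Prod>i<n. bernoulli_density (fst (q i j)) (snd (q i j)) (D (Some i)))))"
      by (simp add: sum_distrib_left ac_simps)
    finally show ?thesis unfolding * .
  qed
  show "pmbm_density M f"
    unfolding pmbm_density_def
  proof (intro exI conjI)
    show "(\<Sum>h\<in>a ` {..<m}. w (h 0)) = 1"
      using w(2) inj_on_subset[OF inj, of "{..<m}"] by (subst sum.reindex) (auto simp: a0)
    show "\<forall>h\<in>a ` {..<m}. \<forall>i\<in>{..<n}. fst (q i (h i)) \<in> {0..1} \<and> is_prob_density M (snd (q i (h i)))"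
      using q by (auto simp: a_def valid_bernoulli_def)
    show "\<forall>A\<in>fin_subsets M. f A = (\<Sum>D\<in>splits {..<n} A. ppp_density M lam (D None) *
        (\<Sum>h\<in>a ` {..<m}. w (h 0) *
          (\<Prod>i\<in>{..<n}. bernoulli_density (fst (q i (h i))) (snd (q i (h i))) (D (Some i)))))"
      using fA by simp
    show "a ` {..<m} \<subseteq> {..<n} \<rightarrow>\<^sub>E UNIV" by (auto simp: a_def split: if_splits)
  qed (use w lam in \<open>auto simp: a0\<close>)
  let ?s = "\<lambda>j A. set_conv (ppp_density M lam) (\<lambda>i. bernoulli_density (fst (q i j)) (snd (q i j))) {..<n} A"
  have qq: "fst (q i j) \<in> {0..1}" "is_prob_density M (snd (q i j))" if "i < n" "j < m" for i j
    using q[OF that] by (auto simp: valid_bernoulli_def)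
  have sm: "(\<lambda>A. ennreal (?s j A)) \<in> fin_meas M" if "j < m" for j
    using qq that by (intro pmb_density_measurable[OF lam]) auto
  have fe: "ennreal (f A) = (\<Sum>j<m. ennreal (w j) * ennreal (?s j A))" if A: "A \<in> fin_subsets M" for A
  proof -
    have nn: "0 \<le> ?s j A" if "j < m" for j
    proof (rule set_conv_nonneg)
      show "0 \<le> ppp_density M lam B" if "B \<subseteq> A" for B
        using that A lam by (intro ppp_density_nonneg) (auto simp: is_intensity_def space_finite_sets)
      show "0 \<le> bernoulli_density (fst (q i j)) (snd (q i j)) B" if "i \<in> {..<n}" "B \<subseteq> A" for i B
        using that A qq[of i j] \<open>j < m\<close>
        by (intro bernoulli_density_nonneg) (auto simp: is_prob_density_def space_finite_sets)
    qed
    have "ennreal (f A) = (\<Sum>j<m. ennreal (w j * ?s j A))"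
      unfolding f_def using w(1) nn by (intro sum_ennreal[symmetric]) auto
    then show ?thesis using w(1) by (simp add: ennreal_mult')
  qed
  have Fm: "(\<lambda>A. \<Sum>j<m. ennreal (w j) * ennreal (?s j A)) \<in> fin_meas M"
    using sm by (intro borel_measurable_sum borel_measurable_times_ennreal) auto
  show "(\<lambda>A. ennreal (f A)) \<in> fin_meas M"
    by (subst measurable_cong[OF fe]) (simp_all add: Fm del: sum_ennreal)
  assume G: "G \<in> fin_meas M"
  have one: "(\<lambda>_. 1) \<in> borel_measurable M" by simp
  have sGm: "(\<lambda>A. ennreal (?s j A) * G A) \<in> fin_meas M" if "j < m" for j
    using sm[OF that] G by (rule borel_measurable_times_ennreal)
  have "(\<integral>\<^sup>+A. ennreal (f A) * G A \<partial>finite_sets M) =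
      (\<integral>\<^sup>+A. (\<Sum>j<m. ennreal (w j) * (ennreal (?s j A) * G A)) \<partial>finite_sets M)"
    by (intro nn_integral_cong) (simp add: fe sum_distrib_right mult.assoc del: sum_ennreal)
  also have "\<dots> = (\<Sum>j<m. ennreal (w j) * (\<integral>\<^sup>+A. ennreal (?s j A) * G A \<partial>finite_sets M))"
    using sGm by (subst nn_integral_sum) (auto simp: nn_integral_cmult intro!: borel_measurable_times_ennreal)
  also have "\<dots> = (\<Sum>j<m. ennreal (w j) * (ennreal (exp (- (\<integral>x. lam x \<partial>M))) *
      op_exp (ins_int M (\<lambda>y. ennreal (lam y))) (foldr (\<lambda>i. bern_ins (q i j)) [0..<n] G) {}))"
  proof (intro sum.cong refl arg_cong2[of _ _ _ _ "(*)"])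
    fix j assume "j \<in> {..<m}"
    then have j: "j < m" by simp
    show "(\<integral>\<^sup>+A. ennreal (?s j A) * G A \<partial>finite_sets M) = ennreal (exp (- (\<integral>x. lam x \<partial>M))) *
      op_exp (ins_int M (\<lambda>y. ennreal (lam y))) (foldr (\<lambda>i. bern_ins (q i j)) [0..<n] G) {}"
      unfolding nn_integral_finite_sets_eq_op_exp[OF sGm[OF j]]
      using qq j by (intro op_exp_pmb_density[OF lam _ _ G]) auto
  qed
  finally show "(\<integral>\<^sup>+A. ennreal (f A) * G A \<partial>finite_sets M) = \<dots>" .
qed

text \<open>The terms are normalised separately, and evaluating at the constant functional 1 then
  shows that the weights sum to one.\<close>

lemma pmbm_density_of_mixture:
  assumes g: "g \<in> borel_measurable M" and fin: "(\<integral>\<^sup>+y. g y \<partial>M) < \<infinity>"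
    and hs: "\<forall>(c, bs)\<in>set hs. \<forall>(b, h)\<in>set bs. h \<in> borel_measurable M"
    and p0: "is_prob_density M p0"
    and \<Psi>: "\<forall>G\<in>fin_meas M. \<Psi> G = (\<Sum>(c, bs)\<leftarrow>hs. c * op_exp (ins_int M g) (affine_inss M bs G) {})"
    and one: "\<Psi> (\<lambda>_. 1) = 1"
  shows "\<exists>f. pmbm_density M f \<and> (\<lambda>A. ennreal (f A)) \<in> fin_meas M \<and>
    (\<forall>G\<in>fin_meas M. \<Psi> G = (\<integral>\<^sup>+A. ennreal (f A) * G A \<partial>finite_sets M))"
proof -
  obtain lam where lam: "is_intensity M lam" and AE: "AE y in M. g y = ennreal (lam y)"
    and I: "(\<integral>\<^sup>+y. g y \<partial>M) = ennreal (\<integral>y. lam y \<partial>M)"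
    using intensity_real_version[OF g fin] by (elim exE conjE)
  define L where "L = (\<integral>y. lam y \<partial>M)"
  have L: "0 \<le> L" using lam unfolding L_def is_intensity_def by (intro Bochner_Integration.integral_nonneg) auto
  have ig: "ins_int M g = ins_int M (\<lambda>y. ennreal (lam y))"
    by (intro ext ins_int_AE_cong AE)
  define good where "good c bs = (\<lambda>(w, qs). 0 \<le> w \<and> (\<forall>q\<in>set qs. valid_bernoulli q) \<and> (\<forall>G\<in>fin_meas M.
    c * op_exp (ins_int M g) (affine_inss M bs G) {} =
    ennreal w * (ennreal (exp (- L)) * op_exp (ins_int M g) (bern_inss qs G) {})))" for c bs
  define W where "W = (\<lambda>(c, bs). SOME wq. good c bs wq)"
  have W: "good c bs (W (c, bs))" if cbs: "(c, bs) \<in> set hs" for c bs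
  proof -
    have bs: "h \<in> borel_measurable M" if "(b, h) \<in> set bs" for b h
      using bspec[OF hs cbs] that by auto
    \<comment> \<open>A single term is at most the sum of all terms, hence finite because the total
      mass is one.\<close>
    have "c * op_exp (ins_int M g) (affine_inss M bs (\<lambda>_. 1)) {} \<le> \<Psi> (\<lambda>_. 1)"
    proof -
      have "(case (c, bs) of (c, bs) \<Rightarrow> c * op_exp (ins_int M g) (affine_inss M bs (\<lambda>_. 1)) {}) \<le>
          (\<Sum>(c, bs)\<leftarrow>hs. c * op_exp (ins_int M g) (affine_inss M bs (\<lambda>_. 1)) {})"
        by (intro member_le_sum_list image_eqI[of _ _ "(c, bs)"]) (use cbs in \<open>auto intro!: image_eqI[of _ _ "(c, bs)"]\<close>)
      then show ?thesis using \<Psi> by simp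
    qed
    also have "\<dots> < \<infinity>" by (simp add: one)
    finally have "\<exists>w qs. good c bs (w, qs)"
      unfolding good_def prod.case using I L bs p0 unfolding L_def[symmetric] by (intro pmb_term_normalise[OF g]) auto
    then have "\<exists>wq. good c bs wq" by (elim exE) (rule exI)
    then show ?thesis unfolding W_def prod.case by (rule someI_ex)
  qed
  define ws where "ws = map W hs"
  define m where "m = length ws"
  \<comment> \<open>The total number of points bounds the number in each component.
    \<open>Suc\<close> makes \<open>n\<close> positive even if there are none, since the hypotheses
    are told apart by their value at track 0.\<close>
  define n where "n = Suc (sum_list (map (\<lambda>wq. length (snd wq)) ws))"
  define w where "w j = fst (ws ! j)" for j
  define q where "q i j = (if i < length (snd (ws ! j)) then snd (ws ! j) ! i else (0, p0))" for i j
  have wj: "0 \<le> w j" "\<forall>q\<in>set (snd (ws ! j)). valid_bernoulli q"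
    "\<And>G. G \<in> fin_meas M \<Longrightarrow> (case hs ! j of (c, bs) \<Rightarrow> c * op_exp (ins_int M g) (affine_inss M bs G) {}) =
      ennreal (w j) * (ennreal (exp (- L)) * op_exp (ins_int M g) (bern_inss (snd (ws ! j)) G) {})" if "j < m" for j
  proof -
    obtain c bs where cbs: "hs ! j = (c, bs)" by (cases "hs ! j")
    have "(c, bs) \<in> set hs" using that cbs by (metis length_map m_def nth_mem ws_def)
    moreover have "ws ! j = W (c, bs)" using that cbs by (simp add: ws_def m_def)
    ultimately have "good c bs (w j, snd (ws ! j))" using W[of c bs] by (simp add: w_def)
    then show "0 \<le> w j" "\<forall>q\<in>set (snd (ws ! j)). valid_bernoulli q"
      "\<And>G. G \<in> fin_meas M \<Longrightarrow> (case hs ! j of (c, bs) \<Rightarrow> c * op_exp (ins_int M g) (affine_inss M bs G) {}) =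
        ennreal (w j) * (ennreal (exp (- L)) * op_exp (ins_int M g) (bern_inss (snd (ws ! j)) G) {})"
      unfolding good_def by (simp_all add: cbs)
  qed
  have len: "length (snd (ws ! j)) \<le> n" if "j < m" for j
  proof -
    have "length (snd (ws ! j)) \<le> sum_list (map (\<lambda>wq. length (snd wq)) ws)"
      using that by (intro member_le_sum_list) (auto simp: m_def)
    then show ?thesis by (simp add: n_def)
  qed
  have q: "valid_bernoulli (q i j)" if "i < n" "j < m" for i j
    using wj(2)[OF that(2)] p0 by (auto simp: q_def valid_bernoulli_def[of "(0, p0)"])
  have \<Psi>': "\<Psi> G = (\<Sum>j<m. ennreal (w j) * (ennreal (exp (- L)) *
      op_exp (ins_int M g) (foldr (\<lambda>i. bern_ins (q i j)) [0..<n] G) {}))" if G: "G \<in> fin_meas M" for G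
  proof -
    have "\<Psi> G = (\<Sum>j<m. case hs ! j of (c, bs) \<Rightarrow> c * op_exp (ins_int M g) (affine_inss M bs G) {})"
      using bspec[OF \<Psi> G] by (simp add: sum_list_sum_nth m_def ws_def atLeast0LessThan)
    also have "\<dots> = (\<Sum>j<m. ennreal (w j) * (ennreal (exp (- L)) *
        op_exp (ins_int M g) (foldr (\<lambda>i. bern_ins (q i j)) [0..<n] G) {}))"
      by (intro sum.cong refl) (simp add: wj(3)[OF _ G] q_def bern_inss_pad[OF len])
    finally show ?thesis .
  qed
  have sum_w: "(\<Sum>j<m. w j) = 1"
  proof -
    have "op_exp (ins_int M g) (foldr (\<lambda>i. bern_ins (q i j)) [0..<n] (\<lambda>_. 1)) {} = ennreal (exp L)" if "j < m" for j
    proof -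
      have "op_exp (ins_int M g) (foldr (\<lambda>i. bern_ins (q i j)) [0..<n] (\<lambda>_. 1)) {} =
          op_exp (ins_int M g) (bern_inss (snd (ws ! j)) (\<lambda>_. 1)) {}"
        using bern_inss_pad[OF len[OF that], of p0] by (simp add: q_def)
      also have "\<dots> = op_exp (ins_int M g) (\<lambda>_. 1) {}"
        by (intro op_exp_cong[OF fin_op_ins_int[OF g]] bern_inss_one wj(2) that empty_finite_sets)
      finally show ?thesis using op_exp_const[OF g _ L, of "{}"] I by (simp add: L_def)
    qed
    then have "1 = (\<Sum>j<m. ennreal (w j) * (ennreal (exp (- L)) * ennreal (exp L)))"
      using one \<Psi>'[of "\<lambda>_. 1"] by simp
    also have "\<dots> = (\<Sum>j<m. ennreal (w j))"
      by (simp add: ennreal_mult'[symmetric] exp_minus)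
    also have "\<dots> = ennreal (\<Sum>j<m. w j)" using wj(1) by (intro sum_ennreal) auto
    finally show ?thesis by (metis ennreal_eq_1)
  qed
  define f where "f A = (\<Sum>j<m. w j *
    set_conv (ppp_density M lam) (\<lambda>i. bernoulli_density (fst (q i j)) (snd (q i j))) {..<n} A)" for A
  have n0: "0 < n" by (simp add: n_def)
  have "pmbm_density M f"
    unfolding f_def[abs_def] by (rule pmbm_density_of_components(1)[OF lam n0 _ sum_w]) (simp_all add: wj(1) q)
  moreover have "(\<lambda>A. ennreal (f A)) \<in> fin_meas M"
    unfolding f_def by (rule pmbm_density_of_components(2)[OF lam n0 _ sum_w]) (simp_all add: wj(1) q)
  moreover have "\<Psi> G = (\<integral>\<^sup>+A. ennreal (f A) * G A \<partial>finite_sets M)" if "G \<in> fin_meas M" for G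
    unfolding f_def \<Psi>'[OF that] ig L_def
    by (rule pmbm_density_of_components(3)[OF lam n0 _ sum_w _ that, symmetric]) (simp_all add: wj(1) q)
  ultimately show ?thesis by (intro exI[of _ f]) simp
qed

end

subsection \<open>The space of trajectories\<close>

abbreviation traj_ivls :: "nat \<Rightarrow> nat \<Rightarrow> (nat \<times> nat) set" where
  "traj_ivls \<alpha> \<gamma> \<equiv> {(\<beta>, \<epsilon>). \<alpha> \<le> \<beta> \<and> \<beta> \<le> \<epsilon> \<and> \<epsilon> \<le> \<gamma>}"

lemma finite_traj_ivls: "finite (traj_ivls \<alpha> \<gamma>)"
  by (rule finite_subset[of _ "{..\<gamma>} \<times> {..\<gamma>}"]) auto

lemma space_traj_space:
  "space (traj_space M \<alpha> \<gamma>) = {(\<beta>, \<epsilon>, x). \<alpha> \<le> \<beta> \<and> \<beta> \<le> \<epsilon> \<and> \<epsilon> \<le> \<gamma> \<and> x \<in> {\<beta>..\<epsilon>} \<rightarrow>\<^sub>E space M}"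
  by (simp add: traj_space_def space_glue)

lemma traj_space_component:
  assumes "i \<in> traj_ivls \<alpha> \<gamma>"
  shows "(case i of (\<beta>, \<epsilon>) \<Rightarrow> \<lambda>x. (\<beta>, \<epsilon>, x)) \<in> space (case i of (\<beta>, \<epsilon>) \<Rightarrow> \<Pi>\<^sub>M k\<in>{\<beta>..\<epsilon>}. M) \<rightarrow>
    {(\<beta>, \<epsilon>, x). \<alpha> \<le> \<beta> \<and> \<beta> \<le> \<epsilon> \<and> \<epsilon> \<le> \<gamma> \<and> x \<in> {\<beta>..\<epsilon>} \<rightarrow>\<^sub>E space M}"
  using assms by (cases i) (simp add: space_PiM)

lemma measurable_traj_spaceI:
  assumes "\<And>\<beta> \<epsilon>. \<alpha> \<le> \<beta> \<Longrightarrow> \<beta> \<le> \<epsilon> \<Longrightarrow> \<epsilon> \<le> \<gamma> \<Longrightarrow> (\<lambda>x. f (\<beta>, \<epsilon>, x)) \<in> measurable (\<Pi>\<^sub>M k\<in>{\<beta>..\<epsilon>}. M) L"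
  shows "f \<in> measurable (traj_space M \<alpha> \<gamma>) L"
  unfolding traj_space_def
proof (rule measurable_glueI[OF traj_space_component])
  fix X assume "X \<in> {(\<beta>, \<epsilon>, x). \<alpha> \<le> \<beta> \<and> \<beta> \<le> \<epsilon> \<and> \<epsilon> \<le> \<gamma> \<and> x \<in> {\<beta>..\<epsilon>} \<rightarrow>\<^sub>E space M}"
  then obtain \<beta> \<epsilon> x where X: "X = (\<beta>, \<epsilon>, x)" "\<alpha> \<le> \<beta>" "\<beta> \<le> \<epsilon>" "\<epsilon> \<le> \<gamma>" "x \<in> {\<beta>..\<epsilon>} \<rightarrow>\<^sub>E space M"
    by auto
  show "f X \<in> space L"
    using measurable_space[OF assms[OF X(2-4)], of x] X by (simp add: space_PiM)
next
  fix i assume "i \<in> traj_ivls \<alpha> \<gamma>"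
  then show "(\<lambda>x. f ((case i of (\<beta>, \<epsilon>) \<Rightarrow> \<lambda>x. (\<beta>, \<epsilon>, x)) x)) \<in> measurable (case i of (\<beta>, \<epsilon>) \<Rightarrow> \<Pi>\<^sub>M k\<in>{\<beta>..\<epsilon>}. M) L"
    by (cases i) (simp add: assms)
qed

lemma measurable_traj_Pair:
  assumes "\<alpha> \<le> \<beta>" "\<beta> \<le> \<epsilon>" "\<epsilon> \<le> \<gamma>"
  shows "(\<lambda>x. (\<beta>, \<epsilon>, x)) \<in> measurable (\<Pi>\<^sub>M k\<in>{\<beta>..\<epsilon>}. M) (traj_space M \<alpha> \<gamma>)"
proof -
  have "(case (\<beta>, \<epsilon>) of (\<beta>, \<epsilon>) \<Rightarrow> \<lambda>x. (\<beta>, \<epsilon>, x)) \<in>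
      measurable (case (\<beta>, \<epsilon>) of (\<beta>, \<epsilon>) \<Rightarrow> \<Pi>\<^sub>M k\<in>{\<beta>..\<epsilon>}. M) (traj_space M \<alpha> \<gamma>)"
    unfolding traj_space_def
    by (rule measurable_glue_component[OF traj_space_component]) (use assms in auto)
  then show ?thesis by simp
qed

lemma sets_traj_spaceI:
  assumes "A \<subseteq> space (traj_space M \<alpha> \<gamma>)"
    and "\<And>\<beta> \<epsilon>. \<alpha> \<le> \<beta> \<Longrightarrow> \<beta> \<le> \<epsilon> \<Longrightarrow> \<epsilon> \<le> \<gamma> \<Longrightarrow>
      (\<lambda>x. (\<beta>, \<epsilon>, x)) -` A \<inter> space (\<Pi>\<^sub>M k\<in>{\<beta>..\<epsilon>}. M) \<in> sets (\<Pi>\<^sub>M k\<in>{\<beta>..\<epsilon>}. M)"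
  shows "A \<in> sets (traj_space M \<alpha> \<gamma>)"
proof -
  have "(case i of (\<beta>, \<epsilon>) \<Rightarrow> \<lambda>x. (\<beta>, \<epsilon>, x)) -` A \<inter> space (case i of (\<beta>, \<epsilon>) \<Rightarrow> \<Pi>\<^sub>M k\<in>{\<beta>..\<epsilon>}. M)
      \<in> sets (case i of (\<beta>, \<epsilon>) \<Rightarrow> \<Pi>\<^sub>M k\<in>{\<beta>..\<epsilon>}. M)" if "i \<in> traj_ivls \<alpha> \<gamma>" for i
    using that assms(2) by (cases i) simp
  moreover have "sets (traj_space M \<alpha> \<gamma>) = {A. A \<subseteq> space (traj_space M \<alpha> \<gamma>) \<and> (\<forall>i\<in>traj_ivls \<alpha> \<gamma>.
      (case i of (\<beta>, \<epsilon>) \<Rightarrow> \<lambda>x. (\<beta>, \<epsilon>, x)) -` A \<inter> space (case i of (\<beta>, \<epsilon>) \<Rightarrow> \<Pi>\<^sub>M k\<in>{\<beta>..\<epsilon>}. M)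
      \<in> sets (case i of (\<beta>, \<epsilon>) \<Rightarrow> \<Pi>\<^sub>M k\<in>{\<beta>..\<epsilon>}. M))}"
    unfolding space_traj_space unfolding traj_space_def by (rule sets_glue) (rule traj_space_component)
  ultimately show ?thesis using assms(1) by blast
qed

lemma emeasure_traj_space:
  assumes "A \<in> sets (traj_space M \<alpha> \<gamma>)"
  shows "emeasure (traj_space M \<alpha> \<gamma>) A = (\<Sum>(\<beta>, \<epsilon>)\<in>traj_ivls \<alpha> \<gamma>.
    emeasure (\<Pi>\<^sub>M k\<in>{\<beta>..\<epsilon>}. M) ((\<lambda>x. (\<beta>, \<epsilon>, x)) -` A \<inter> space (\<Pi>\<^sub>M k\<in>{\<beta>..\<epsilon>}. M)))"
proof -
  have "emeasure (traj_space M \<alpha> \<gamma>) A = (\<integral>\<^sup>+X. indicator A X \<partial>traj_space M \<alpha> \<gamma>)"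
    using assms by simp
  also have "\<dots> = (\<Sum>(\<beta>, \<epsilon>)\<in>traj_ivls \<alpha> \<gamma>. \<integral>\<^sup>+x. indicator A (\<beta>, \<epsilon>, x) \<partial>(\<Pi>\<^sub>M k\<in>{\<beta>..\<epsilon>}. M))"
    using assms by (intro nn_integral_traj_space) auto
  also have "\<dots> = (\<Sum>(\<beta>, \<epsilon>)\<in>traj_ivls \<alpha> \<gamma>.
    emeasure (\<Pi>\<^sub>M k\<in>{\<beta>..\<epsilon>}. M) ((\<lambda>x. (\<beta>, \<epsilon>, x)) -` A \<inter> space (\<Pi>\<^sub>M k\<in>{\<beta>..\<epsilon>}. M)))"
  proof (intro sum.cong refl, clarify)
    fix \<beta> \<epsilon> assume i: "\<alpha> \<le> \<beta>" "\<beta> \<le> \<epsilon>" "\<epsilon> \<le> \<gamma>"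
    let ?P = "\<Pi>\<^sub>M k\<in>{\<beta>..\<epsilon>}. M"
    have "(\<integral>\<^sup>+x. indicator A (\<beta>, \<epsilon>, x) \<partial>?P) = (\<integral>\<^sup>+x. indicator ((\<lambda>x. (\<beta>, \<epsilon>, x)) -` A \<inter> space ?P) x \<partial>?P)"
      by (intro nn_integral_cong) (auto split: split_indicator)
    also have "\<dots> = emeasure ?P ((\<lambda>x. (\<beta>, \<epsilon>, x)) -` A \<inter> space ?P)"
      by (intro nn_integral_indicator measurable_sets[OF measurable_traj_Pair[OF i] assms])
    finally show "(\<integral>\<^sup>+x. indicator A (\<beta>, \<epsilon>, x) \<partial>?P) = \<dots>" .
  qed
  finally show ?thesis .
qed

lemma null_sets_traj_space_iff:
  assumes "A \<in> sets (traj_space M \<alpha> \<gamma>)"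
  shows "A \<in> null_sets (traj_space M \<alpha> \<gamma>) \<longleftrightarrow> (\<forall>\<beta> \<epsilon>. \<alpha> \<le> \<beta> \<longrightarrow> \<beta> \<le> \<epsilon> \<longrightarrow> \<epsilon> \<le> \<gamma> \<longrightarrow>
    (AE x in (\<Pi>\<^sub>M k\<in>{\<beta>..\<epsilon>}. M). (\<beta>, \<epsilon>, x) \<notin> A))"
proof -
  have "(AE x in (\<Pi>\<^sub>M k\<in>{\<beta>..\<epsilon>}. M). (\<beta>, \<epsilon>, x) \<notin> A) \<longleftrightarrow>
      emeasure (\<Pi>\<^sub>M k\<in>{\<beta>..\<epsilon>}. M) ((\<lambda>x. (\<beta>, \<epsilon>, x)) -` A \<inter> space (\<Pi>\<^sub>M k\<in>{\<beta>..\<epsilon>}. M)) = 0"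
    if "\<alpha> \<le> \<beta>" "\<beta> \<le> \<epsilon>" "\<epsilon> \<le> \<gamma>" for \<beta> \<epsilon>
    by (rule AE_iff_measurable[OF measurable_sets[OF measurable_traj_Pair[OF that] assms]]) auto
  then show ?thesis
    using assms finite_traj_ivls[of \<alpha> \<gamma>]
    by (auto simp: null_sets_def emeasure_traj_space sum_eq_0_iff)
qed

lemma traj_alive_states_measurable:
  assumes d: "d \<in> space M"
  shows "(\<lambda>X. if alive k X then state_at k X else d) \<in> measurable (traj_space M \<alpha> \<gamma>) M"
proof (rule measurable_traj_spaceI)
  fix \<beta> \<epsilon> :: nat
  show "(\<lambda>x. if alive k (\<beta>, \<epsilon>, x) then state_at k (\<beta>, \<epsilon>, x) else d) \<in> measurable (\<Pi>\<^sub>M k\<in>{\<beta>..\<epsilon>}. M) M"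
    using d by (cases "\<beta> \<le> k"; cases "k \<le> \<epsilon>") (simp_all add: alive_def state_at_def)
qed

lemma traj_ends_measurable:
  "(\<lambda>X. (fst X, fst (snd X))) \<in> measurable (traj_space M \<alpha> \<gamma>) (count_space UNIV)"
  by (rule measurable_traj_spaceI) simp

lemma sets_alive: "{X \<in> space (traj_space M \<alpha> \<gamma>). alive k X} \<in> sets (traj_space M \<alpha> \<gamma>)"
proof -
  have "{X \<in> space (traj_space M \<alpha> \<gamma>). alive k X} =
      (\<lambda>X. (fst X, fst (snd X))) -` {(\<beta>, \<epsilon>). \<beta> \<le> k \<and> k \<le> \<epsilon>} \<inter> space (traj_space M \<alpha> \<gamma>)"
    by (auto simp: alive_def)
  then show ?thesis using measurable_sets[OF traj_ends_measurable] by simp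
qed

lemma traj_function_measurable:
  assumes "f \<in> measurable M L" "c \<in> space L"
  shows "(\<lambda>X. if alive k X then f (state_at k X) else c) \<in> measurable (traj_space M \<alpha> \<gamma>) L"
proof (rule measurable_traj_spaceI)
  fix \<beta> \<epsilon> :: nat
  show "(\<lambda>x. if alive k (\<beta>, \<epsilon>, x) then f (state_at k (\<beta>, \<epsilon>, x)) else c) \<in> measurable (\<Pi>\<^sub>M k\<in>{\<beta>..\<epsilon>}. M) L"
    using assms by (cases "\<beta> \<le> k"; cases "k \<le> \<epsilon>")
      (simp_all add: alive_def state_at_def measurable_compose[OF measurable_component_singleton])
qed

lemma state_at_space: "X \<in> space (traj_space M \<alpha> \<gamma>) \<Longrightarrow> alive k X \<Longrightarrow> state_at k X \<in> space M"
  by (auto simp: space_traj_space alive_def state_at_def PiE_iff)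

context sigma_finite_measure
begin

text \<open>The space is a finite disjoint union of sigma-finite product spaces, whose countable
  covers are embedded and collected.\<close>

lemma sigma_finite_traj_space: "sigma_finite_measure (traj_space M \<alpha> \<gamma>)"
proof
  let ?T = "traj_space M \<alpha> \<gamma>" and ?P = "\<lambda>\<beta> \<epsilon>. \<Pi>\<^sub>M k\<in>{\<beta>..\<epsilon>::nat}. M"
  interpret P: product_sigma_finite "\<lambda>_::nat. M" ..
  have "\<exists>A. countable A \<and> A \<subseteq> sets (?P \<beta> \<epsilon>) \<and> \<Union> A = space (?P \<beta> \<epsilon>) \<and> (\<forall>a\<in>A. emeasure (?P \<beta> \<epsilon>) a \<noteq> \<infinity>)" for \<beta> \<epsilon>
  proof -
    interpret sigma_finite_measure "?P \<beta> \<epsilon>" by (rule P.sigma_finite) simp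
    show ?thesis by (rule sigma_finite_countable)
  qed
  note ex = this
  define A where "A \<beta> \<epsilon> = (SOME A. countable A \<and> A \<subseteq> sets (?P \<beta> \<epsilon>) \<and> \<Union> A = space (?P \<beta> \<epsilon>) \<and>
      (\<forall>a\<in>A. emeasure (?P \<beta> \<epsilon>) a \<noteq> \<infinity>))" for \<beta> \<epsilon>
  have A: "countable (A \<beta> \<epsilon>) \<and> A \<beta> \<epsilon> \<subseteq> sets (?P \<beta> \<epsilon>) \<and>
      \<Union> (A \<beta> \<epsilon>) = space (?P \<beta> \<epsilon>) \<and> (\<forall>a\<in>A \<beta> \<epsilon>. emeasure (?P \<beta> \<epsilon>) a \<noteq> \<infinity>)" for \<beta> \<epsilon>
    unfolding A_def by (rule someI_ex[OF ex])
  define B where "B = (\<Union>(\<beta>, \<epsilon>)\<in>traj_ivls \<alpha> \<gamma>. (\<lambda>a. (\<lambda>x. (\<beta>, \<epsilon>, x)) ` a) ` A \<beta> \<epsilon>)"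
  have vim: "(\<lambda>x. (\<beta>', \<epsilon>', x)) -` ((\<lambda>x. (\<beta>, \<epsilon>, x)) ` a) = (if (\<beta>', \<epsilon>') = (\<beta>, \<epsilon>) then a else {})"
    for \<beta> \<epsilon> \<beta>' \<epsilon>' and a :: "(nat \<Rightarrow> 'a) set" by auto
  have B: "b \<in> sets ?T \<and> emeasure ?T b \<noteq> \<infinity>" if bB: "b \<in> B" for b
  proof -
    obtain j where j: "j \<in> traj_ivls \<alpha> \<gamma>" "b \<in> (case j of (\<beta>, \<epsilon>) \<Rightarrow> (\<lambda>a. (\<lambda>x. (\<beta>, \<epsilon>, x)) ` a) ` A \<beta> \<epsilon>)"
      using bB unfolding B_def by (rule UN_E)
    obtain \<beta> \<epsilon> where be: "j = (\<beta>, \<epsilon>)" by (cases j)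
    have i: "\<alpha> \<le> \<beta>" "\<beta> \<le> \<epsilon>" "\<epsilon> \<le> \<gamma>" using j(1) by (simp_all add: be)
    obtain a where a: "a \<in> A \<beta> \<epsilon>" and b: "b = (\<lambda>x. (\<beta>, \<epsilon>, x)) ` a"
      using j(2) unfolding be prod.case by (rule imageE)
    have as: "a \<in> sets (?P \<beta> \<epsilon>)" "emeasure (?P \<beta> \<epsilon>) a \<noteq> \<infinity>" using A[of \<beta> \<epsilon>] a by auto
    have bs: "b \<in> sets ?T"
    proof (rule sets_traj_spaceI)
      show "b \<subseteq> space ?T"
        using sets.sets_into_space[OF as(1)] i by (auto simp: b space_traj_space space_PiM)
      show "(\<lambda>x. (\<beta>', \<epsilon>', x)) -` b \<inter> space (?P \<beta>' \<epsilon>') \<in> sets (?P \<beta>' \<epsilon>')" for \<beta>' \<epsilon>'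
        unfolding b vim using as(1) by auto
    qed
    have "emeasure ?T b = (\<Sum>(\<beta>, \<epsilon>)\<in>traj_ivls \<alpha> \<gamma>. emeasure (?P \<beta> \<epsilon>) ((\<lambda>x. (\<beta>, \<epsilon>, x)) -` b \<inter> space (?P \<beta> \<epsilon>)))"
      by (rule emeasure_traj_space[OF bs])
    also have "\<dots> = (\<Sum>i\<in>traj_ivls \<alpha> \<gamma>. if i = (\<beta>, \<epsilon>) then emeasure (?P \<beta> \<epsilon>) a else 0)"
      unfolding b vim
      using sets.sets_into_space[OF as(1)] by (intro sum.cong refl) (auto simp: Int_absorb2 split: if_splits)
    also have "\<dots> = emeasure (?P \<beta> \<epsilon>) a"
      using i finite_traj_ivls by (subst sum.delta) auto
    finally show ?thesis using bs as by simp
  qed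
  show "\<exists>A. countable A \<and> A \<subseteq> sets ?T \<and> \<Union> A = space ?T \<and> (\<forall>a\<in>A. emeasure ?T a \<noteq> \<infinity>)"
  proof (intro exI[of _ B] conjI)
    show "countable B" unfolding B_def
    proof (rule countable_UN)
      show "countable (traj_ivls \<alpha> \<gamma>)" by (rule countable_finite[OF finite_traj_ivls])
      show "countable (case i of (\<beta>, \<epsilon>) \<Rightarrow> (\<lambda>a. (\<lambda>x. (\<beta>, \<epsilon>, x)) ` a) ` A \<beta> \<epsilon>)" for i
        using A by (cases i) simp
    qed
    show "\<Union> B = space ?T"
    proof
      show "\<Union> B \<subseteq> space ?T" using B sets.sets_into_space by blast
      show "space ?T \<subseteq> \<Union> B"
      proof
        fix X assume "X \<in> space ?T"
        then obtain \<beta> \<epsilon> x where X: "X = (\<beta>, \<epsilon>, x)" "(\<beta>, \<epsilon>) \<in> traj_ivls \<alpha> \<gamma>" "x \<in> space (?P \<beta> \<epsilon>)"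
          by (auto simp: space_traj_space space_PiM)
        then have "x \<in> \<Union> (A \<beta> \<epsilon>)" using A by simp
        then obtain a where "a \<in> A \<beta> \<epsilon>" "x \<in> a" by blast
        then show "X \<in> \<Union> B" unfolding B_def X(1) using X(2) by auto
      qed
    qed
  qed (use B in auto)
qed

end

context diffuse_measure
begin

text \<open>Two trajectories agree iff their endpoints and their states at finitely many times
  agree, and each of these conditions is measurable. A single trajectory is a product of singletons
  over a nonempty interval, so it is null because its first factor is.\<close>

lemma diffuse_traj_space: "diffuse_measure (traj_space M \<alpha> \<gamma>)"
proof -
  let ?T = "traj_space M \<alpha> \<gamma>" and ?P = "\<lambda>\<beta> \<epsilon>. \<Pi>\<^sub>M k\<in>{\<beta>..\<epsilon>::nat}. M"
  interpret T: sigma_finite_measure ?T by (rule sigma_finite_traj_space)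
  interpret P: product_sigma_finite "\<lambda>_::nat. M" ..
  show ?thesis
  proof
    show "{q \<in> space (?T \<Otimes>\<^sub>M ?T). fst q = snd q} \<in> sets (?T \<Otimes>\<^sub>M ?T)"
    proof (cases "space M = {}")
      case True
      then have "space ?T = {}" by (auto simp: space_traj_space)
      then show ?thesis by (simp add: space_pair_measure)
    next
      case False
      then obtain d where d: "d \<in> space M" by blast
      \<comment> \<open>The default \<open>d\<close> stands in for the state at times at which the
        trajectory is not alive, so that states at fixed times are total functions.\<close>
      define c where "c k X = (if alive k X then state_at k X else d)" for k X
      have c: "c k \<in> measurable ?T M" for k
        unfolding c_def using traj_alive_states_measurable[OF d] by simp
      let ?e = "\<lambda>X :: 'a traj. (fst X, fst (snd X))"
      have eq: "X = Y" if XY: "X \<in> space ?T" "Y \<in> space ?T" "?e X = ?e Y" "\<forall>k\<in>{\<alpha>..\<gamma>}. c k X = c k Y" for X Y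
      proof -
        obtain \<beta> \<epsilon> x y where X: "X = (\<beta>, \<epsilon>, x)" "Y = (\<beta>, \<epsilon>, y)" using XY(3) by (cases X, cases Y) auto
        have "x k = y k" for k
        proof (cases "k \<in> {\<beta>..\<epsilon>}")
          case True
          then have "k \<in> {\<alpha>..\<gamma>}" using XY(1) by (auto simp: X space_traj_space)
          from bspec[OF XY(4) this] True show ?thesis by (simp add: X c_def alive_def state_at_def)
        next
          case False
          then show ?thesis using XY(1,2) by (auto simp: X space_traj_space PiE_def extensional_def)
        qed
        then show ?thesis by (auto simp: X)
      qed
      have "{q \<in> space (?T \<Otimes>\<^sub>M ?T). fst q = snd q} = {q \<in> space (?T \<Otimes>\<^sub>M ?T).
          ?e (fst q) = ?e (snd q)} \<inter> {q \<in> space (?T \<Otimes>\<^sub>M ?T). \<forall>k\<in>{\<alpha>..\<gamma>}. c k (fst q) = c k (snd q)}"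
        using eq by (auto simp: space_pair_measure)
      moreover have "{q \<in> space (?T \<Otimes>\<^sub>M ?T). ?e (fst q) = ?e (snd q)} \<in> sets (?T \<Otimes>\<^sub>M ?T)"
      proof -
        have m: "(\<lambda>q. ?e (fst q)) \<in> measurable (?T \<Otimes>\<^sub>M ?T) (count_space UNIV)"
          "(\<lambda>q. ?e (snd q)) \<in> measurable (?T \<Otimes>\<^sub>M ?T) (count_space UNIV)"
          by (rule measurable_compose[OF measurable_fst traj_ends_measurable],
              rule measurable_compose[OF measurable_snd traj_ends_measurable])
        have "(\<lambda>q. (?e (fst q), ?e (snd q))) \<in> measurable (?T \<Otimes>\<^sub>M ?T) (count_space UNIV \<Otimes>\<^sub>M count_space UNIV)"
          by (rule measurable_Pair[OF m])
        also have "count_space UNIV \<Otimes>\<^sub>M count_space UNIV = count_space (UNIV :: ((nat \<times> nat) \<times> (nat \<times> nat)) set)"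
          by (subst pair_measure_countable) auto
        finally have "(\<lambda>q. (?e (fst q), ?e (snd q))) -` {p. fst p = snd p} \<inter> space (?T \<Otimes>\<^sub>M ?T) \<in> sets (?T \<Otimes>\<^sub>M ?T)"
          by (rule measurable_sets) simp
        then show ?thesis by (simp add: vimage_def Int_def conj_commute)
      qed
      moreover have "{q \<in> space (?T \<Otimes>\<^sub>M ?T). \<forall>k\<in>{\<alpha>..\<gamma>}. c k (fst q) = c k (snd q)} \<in> sets (?T \<Otimes>\<^sub>M ?T)"
      proof (rule sets.sets_Collect_finite_All)
        fix k
        show "{q \<in> space (?T \<Otimes>\<^sub>M ?T). c k (fst q) = c k (snd q)} \<in> sets (?T \<Otimes>\<^sub>M ?T)"
          by (intro sets_eq measurable_compose[OF measurable_fst c] measurable_compose[OF measurable_snd c])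
      qed simp
      ultimately show ?thesis by simp
    qed
    fix X assume X: "X \<in> space ?T"
    then obtain \<beta> \<epsilon> x where X': "X = (\<beta>, \<epsilon>, x)" "\<alpha> \<le> \<beta>" "\<beta> \<le> \<epsilon>" "\<epsilon> \<le> \<gamma>" "x \<in> {\<beta>..\<epsilon>} \<rightarrow>\<^sub>E space M"
      by (auto simp: space_traj_space)
    have xs: "{x k} \<in> sets M" if "k \<in> {\<beta>..\<epsilon>}" for k
    proof -
      have xk: "x k \<in> space M" using X'(5) that by auto
      have "{y \<in> space M. y = x k} \<in> sets M" by (rule sets_eq) (use xk in auto)
      moreover have "{y \<in> space M. y = x k} = {x k}" using xk by auto
      ultimately show ?thesis by simp
    qed
    have sing: "{x} = (\<Pi>\<^sub>E k\<in>{\<beta>..\<epsilon>}. {x k})"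
      using PiE_singleton[of x "{\<beta>..\<epsilon>}"] X'(5) by (simp add: PiE_def)
    have sx: "{x} \<in> sets (?P \<beta> \<epsilon>)"
      unfolding sing using xs by (intro sets_PiM_I_finite) auto
    have ex: "emeasure (?P \<beta> \<epsilon>) {x} = 0"
    proof -
      have "emeasure (?P \<beta> \<epsilon>) {x} = (\<Prod>k\<in>{\<beta>..\<epsilon>}. emeasure M {x k})"
        unfolding sing using xs by (intro P.emeasure_PiM) auto
      also have "\<dots> = 0"
        using X'(3) null_singleton[OF PiE_mem[OF X'(5)], of \<beta>] by (intro prod_zero bexI[of _ \<beta>]) auto
      finally show ?thesis .
    qed
    have vim: "(\<lambda>x. (\<beta>', \<epsilon>', x)) -` {X} \<inter> space (?P \<beta>' \<epsilon>') = (if (\<beta>', \<epsilon>') = (\<beta>, \<epsilon>) then {x} else {})" for \<beta>' \<epsilon>'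
      using X'(5) by (auto simp: X'(1) space_PiM)
    have "{X} \<in> sets ?T"
      by (rule sets_traj_spaceI) (use X sx in \<open>auto simp: vim\<close>)
    then show "emeasure ?T {X} = 0"
      unfolding emeasure_traj_space[OF \<open>{X} \<in> sets ?T\<close>] vim
      by (intro sum.neutral) (auto simp: ex)
  qed
qed

end

subsection \<open>Independent motion\<close>

text \<open>
  Coinciding points would move together, since they are one point of the set. The diffuse measure \<open>N\<close>
  excludes this almost surely, so that \<open>move\<close> turns Poisson processes into Poisson processes.
\<close>

locale markov_move = N: diffuse_measure N + N': sigma_finite_measure N'
  for N :: "'a measure" and N' :: "'b measure" +
  fixes \<kappa> :: "'a \<Rightarrow> 'b measure"
  assumes kernel: "\<kappa> \<in> measurable N (subprob_algebra N')"
    and prob_kernel: "y \<in> space N \<Longrightarrow> prob_space (\<kappa> y)"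
    and nonsingular_kernel: "A \<in> null_sets N' \<Longrightarrow> AE y in N. emeasure (\<kappa> y) A = 0"
begin

definition move :: "('b set \<Rightarrow> ennreal) \<Rightarrow> 'a set \<Rightarrow> ennreal" where
  "move G S = (\<integral>\<^sup>+h. G (h ` S) \<partial>(\<Pi>\<^sub>M y\<in>S. \<kappa> y))"

lemma sets_kernel_at: "y \<in> space N \<Longrightarrow> sets (\<kappa> y) = sets N'"
  by (rule sets_kernel[OF kernel])

lemma move_image_measurable:
  assumes S: "S \<in> fin_subsets N"
  shows "(\<lambda>h. h ` S) \<in> finset_maps (\<Pi>\<^sub>M y\<in>S. \<kappa> y) N'"
proof (rule finset_maps_image)
  show "finite S" using S by (simp add: space_finite_sets)
  fix y assume y: "y \<in> S"
  then have "sets (\<kappa> y) = sets N'" using S by (intro sets_kernel_at) (auto simp: space_finite_sets)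
  then have "measurable (\<Pi>\<^sub>M y\<in>S. \<kappa> y) (\<kappa> y) = measurable (\<Pi>\<^sub>M y\<in>S. \<kappa> y) N'"
    by (intro measurable_cong_sets) auto
  then show "(\<lambda>h. h y) \<in> measurable (\<Pi>\<^sub>M y\<in>S. \<kappa> y) N'"
    using measurable_component_singleton[OF y, of \<kappa>] by simp
qed

lemma prob_space_PiM_kernel:
  "S \<in> fin_subsets N \<Longrightarrow> prob_space (\<Pi>\<^sub>M y\<in>S. \<kappa> y)"
  by (rule prob_space_PiM) (auto intro: prob_kernel simp: space_finite_sets)

lemma move_empty: "move G {} = G {}"
  by (simp add: move_def PiM_empty nn_integral_count_space_finite)

text \<open>Tonelli separates the coordinate of the new point from the coordinates of the
  others.\<close>

lemma move_insert:
  assumes y: "y \<in> space N" and S: "S \<in> fin_subsets N" and yS: "y \<notin> S" and G: "G \<in> fin_meas N'"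
  shows "move G (insert y S) = (\<integral>\<^sup>+y'. move (\<lambda>A. G (insert y' A)) S \<partial>\<kappa> y)"
proof -
  \<comment> \<open>The product calculus requires sigma-finite factors at all indices, while
    \<open>\<kappa>\<close> is controlled only on the space; elsewhere a one-point space is
    used.\<close>
  define \<kappa>' where "\<kappa>' i = (if i \<in> insert y S then \<kappa> i else count_space {undefined})" for i
  have yS': "insert y S \<in> fin_subsets N" by (rule insert_finite_sets[OF y S])
  interpret P: product_sigma_finite \<kappa>'
  proof
    fix i show "\<exists>A. countable A \<and> A \<subseteq> sets (\<kappa>' i) \<and> \<Union> A = space (\<kappa>' i) \<and> (\<forall>a\<in>A. emeasure (\<kappa>' i) a \<noteq> \<infinity>)"
    proof -
      have "prob_space (\<kappa>' i)"
        using y S prob_kernel by (auto simp: \<kappa>'_def space_finite_sets intro!: prob_spaceI[of "count_space {undefined}"])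
      then interpret prob_space "\<kappa>' i" .
      show ?thesis by (rule sigma_finite_countable)
    qed
  qed
  have eq: "(\<Pi>\<^sub>M y\<in>insert y S. \<kappa> y) = PiM (insert y S) \<kappa>'" "(\<Pi>\<^sub>M y\<in>S. \<kappa> y) = PiM S \<kappa>'"
    by (auto simp: \<kappa>'_def intro!: PiM_cong)
  have "(\<lambda>h. G (h ` insert y S)) \<in> borel_measurable (PiM (insert y S) \<kappa>')"
    unfolding eq(1)[symmetric]
    by (rule measurable_compose[OF finset_maps_measurable[OF move_image_measurable[OF yS']] G])
  then have "move G (insert y S) = (\<integral>\<^sup>+y'. \<integral>\<^sup>+h. G ((h(y := y')) ` insert y S) \<partial>PiM S \<kappa>' \<partial>\<kappa>' y)"
    unfolding move_def eq using S yS by (intro P.product_nn_integral_insert_rev) (auto simp: space_finite_sets)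
  also have "\<dots> = (\<integral>\<^sup>+y'. move (\<lambda>A. G (insert y' A)) S \<partial>\<kappa> y)"
  proof -
    have "(h(y := y')) ` insert y S = insert y' (h ` S)" for h :: "'a \<Rightarrow> 'b" and y' using yS by (auto simp: image_iff)
    then show ?thesis by (simp add: move_def eq \<kappa>'_def)
  qed
  finally show ?thesis .
qed

text \<open>The product of kernels is indexed by the very set that varies, so measurability is
  proved by induction on the number of points still to be moved. The points already moved are
  carried along in \<open>b\<close>: integrating over the kernel of the last point reduces
  \<open>Suc n\<close> and \<open>m\<close> to \<open>n\<close> and \<open>Suc m\<close>.\<close>

lemma move_tuple_measurable:
  assumes G: "G \<in> fin_meas N'"
  shows "(\<lambda>(x, b). move (\<lambda>A. G (A \<union> b ` {..<m})) (x ` {..<n})) \<in>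
    borel_measurable ((\<Pi>\<^sub>M i\<in>{..<n::nat}. N) \<Otimes>\<^sub>M (\<Pi>\<^sub>M i\<in>{..<m::nat}. N'))"
proof (induction n arbitrary: m)
  case 0
  have "(\<lambda>p. (\<lambda>b. b ` {..<m}) (snd p)) \<in> finset_maps ((\<Pi>\<^sub>M i\<in>{..<0::nat}. N) \<Otimes>\<^sub>M (\<Pi>\<^sub>M i\<in>{..<m}. N')) N'"
    by (rule finset_maps_compose[OF finset_maps_tuple]) simp
  from measurable_compose[OF finset_maps_measurable[OF this] G]
  show ?case by (simp add: move_empty split_def)
next
  case (Suc n)
  let ?A = "\<Pi>\<^sub>M i\<in>{..<Suc n}. N" and ?B = "\<lambda>m. \<Pi>\<^sub>M i\<in>{..<m::nat}. N'"
  let ?A' = "\<Pi>\<^sub>M i\<in>{..<n}. N"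
  let ?\<Theta> = "\<lambda>m x b. move (\<lambda>A. G (A \<union> b ` {..<m})) (x ` {..<n})"
  have r: "(\<lambda>x. restrict x {..<n}) \<in> measurable ?A ?A'"
    by (rule measurable_restrict_subset) auto
  have xn: "(\<lambda>x. x n) \<in> measurable ?A N" by simp
  have low: "(\<lambda>p. ?\<Theta> m (restrict (fst p) {..<n}) (snd p)) \<in> borel_measurable (?A \<Otimes>\<^sub>M ?B m)"
  proof -
    have "(\<lambda>p. (restrict (fst p) {..<n}, snd p)) \<in> measurable (?A \<Otimes>\<^sub>M ?B m) (?A' \<Otimes>\<^sub>M ?B m)"
      by (intro measurable_Pair measurable_compose[OF measurable_fst r] measurable_snd)
    from measurable_compose[OF this Suc.IH[of m]] show ?thesis by simp
  qed
  have high: "(\<lambda>p. \<integral>\<^sup>+y'. ?\<Theta> (Suc m) (restrict (fst p) {..<n}) ((snd p)(m := y')) \<partial>\<kappa> (fst p n))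
      \<in> borel_measurable (?A \<Otimes>\<^sub>M ?B m)"
  proof (rule nn_integral_measurable_subprob_algebra2)
    show "(\<lambda>p. \<kappa> (fst p n)) \<in> measurable (?A \<Otimes>\<^sub>M ?B m) (subprob_algebra N')"
      by (rule measurable_compose[OF measurable_compose[OF measurable_fst xn] kernel])
    have up: "(\<lambda>q. (snd (fst q))(m := snd q)) \<in> measurable ((?A \<Otimes>\<^sub>M ?B m) \<Otimes>\<^sub>M N') (?B (Suc m))"
    proof -
      have "(\<lambda>q. (snd (fst q), snd q)) \<in> measurable ((?A \<Otimes>\<^sub>M ?B m) \<Otimes>\<^sub>M N') (?B m \<Otimes>\<^sub>M N')"
        by (intro measurable_Pair measurable_snd measurable_compose[OF measurable_fst measurable_snd])
      from measurable_compose[OF this measurable_add_dim[of m "{..<m}" "\<lambda>_. N'"]]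
      show ?thesis by (simp add: lessThan_Suc)
    qed
    have "(\<lambda>q. (restrict (fst (fst q)) {..<n}, (snd (fst q))(m := snd q))) \<in>
        measurable ((?A \<Otimes>\<^sub>M ?B m) \<Otimes>\<^sub>M N') (?A' \<Otimes>\<^sub>M ?B (Suc m))"
      by (intro measurable_Pair up measurable_compose[OF measurable_compose[OF measurable_fst measurable_fst] r])
    from measurable_compose[OF this Suc.IH[of "Suc m"]]
    show "(\<lambda>(p, y'). ?\<Theta> (Suc m) (restrict (fst p) {..<n}) ((snd p)(m := y'))) \<in>
        borel_measurable ((?A \<Otimes>\<^sub>M ?B m) \<Otimes>\<^sub>M N')"
      by (simp add: split_def)
  qed
  have mem: "{p \<in> space (?A \<Otimes>\<^sub>M ?B m). fst p n \<in> fst p ` {..<n}} \<in> sets (?A \<Otimes>\<^sub>M ?B m)"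
  proof (rule N.sets_mem_finset_map)
    show "(\<lambda>p. fst p ` {..<n}) \<in> finset_maps (?A \<Otimes>\<^sub>M ?B m) N"
    proof (rule finset_maps_image)
      fix i assume "i \<in> {..<n}"
      then have "(\<lambda>x. x i) \<in> measurable ?A N" by simp
      then show "(\<lambda>p. fst p i) \<in> measurable (?A \<Otimes>\<^sub>M ?B m) N" by (rule measurable_compose[OF measurable_fst])
    qed simp
    show "(\<lambda>p. fst p n) \<in> measurable (?A \<Otimes>\<^sub>M ?B m) N" by (rule measurable_compose[OF measurable_fst xn])
  qed
  \<comment> \<open>If the last point repeats an earlier one, the set and its motion are those of
    the first \<open>n\<close> points; otherwise \<open>move_insert\<close> applies.\<close>
  have eq: "move (\<lambda>A. G (A \<union> snd p ` {..<m})) (fst p ` {..<Suc n}) =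
      (if fst p n \<in> fst p ` {..<n} then ?\<Theta> m (restrict (fst p) {..<n}) (snd p)
       else \<integral>\<^sup>+y'. ?\<Theta> (Suc m) (restrict (fst p) {..<n}) ((snd p)(m := y')) \<partial>\<kappa> (fst p n))"
    if "p \<in> space (?A \<Otimes>\<^sub>M ?B m)" for p
  proof -
    have fp: "fst p ` {..<n} \<in> fin_subsets N" "fst p n \<in> space N" and sp: "snd p ` {..<m} \<in> fin_subsets N'"
      using that by (auto simp: space_pair_measure space_PiM space_finite_sets PiE_iff)
    have ins: "fst p ` {..<Suc n} = insert (fst p n) (fst p ` {..<n})" by (simp add: lessThan_Suc)
    have res: "restrict (fst p) {..<n} ` {..<n} = fst p ` {..<n}" by auto
    show ?thesis
    proof (cases "fst p n \<in> fst p ` {..<n}")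
      case True
      then show ?thesis by (simp add: ins insert_absorb res)
    next
      case False
      have Gm: "(\<lambda>A. G (A \<union> snd p ` {..<m})) \<in> fin_meas N'"
        unfolding measurable_finite_sets_iff
      proof (intro conjI allI ballI)
        fix k and S assume "S \<in> finset_maps (\<Pi>\<^sub>M i\<in>{..<k::nat}. N') N'"
        then show "(\<lambda>x. G (S x \<union> snd p ` {..<m})) \<in> borel_measurable (\<Pi>\<^sub>M i\<in>{..<k}. N')"
          by (intro measurable_compose[OF finset_maps_measurable G] finset_maps_Un finset_maps_const sp)
      qed simp
      have up: "((snd p)(m := y')) ` {..<Suc m} = insert y' (snd p ` {..<m})" for y'
        by (auto simp: lessThan_Suc image_iff)
      have "move (\<lambda>A. G (A \<union> snd p ` {..<m})) (fst p ` {..<Suc n}) =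
          (\<integral>\<^sup>+y'. move (\<lambda>A. G (insert y' A \<union> snd p ` {..<m})) (fst p ` {..<n}) \<partial>\<kappa> (fst p n))"
        unfolding ins by (rule move_insert[OF fp(2,1) False Gm])
      then show ?thesis using False by (simp only: res up if_False Un_insert_left Un_insert_right)
    qed
  qed
  have "(\<lambda>p. move (\<lambda>A. G (A \<union> snd p ` {..<m})) (fst p ` {..<Suc n})) \<in> borel_measurable (?A \<Otimes>\<^sub>M ?B m)"
    by (rule measurable_cong[THEN iffD2, OF eq measurable_If[OF low high mem]])
  then show ?case by (simp add: split_def)
qed

lemma move_measurable:
  assumes G: "G \<in> fin_meas N'"
  shows "move G \<in> fin_meas N"
proof (rule measurable_finite_setsI)
  fix n :: nat
  \<comment> \<open>No point has been moved at the start, so \<open>m = 0\<close> and the only tuple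
    is the everywhere undefined function.\<close>
  have "(\<lambda>_. undefined) \<in> space (\<Pi>\<^sub>M i\<in>{..<0::nat}. N')" by (simp add: space_PiM)
  then have "(\<lambda>x. (x, \<lambda>_. undefined)) \<in> measurable (\<Pi>\<^sub>M i\<in>{..<n}. N) ((\<Pi>\<^sub>M i\<in>{..<n}. N) \<Otimes>\<^sub>M (\<Pi>\<^sub>M i\<in>{..<0::nat}. N'))"
    by (intro measurable_Pair) simp_all
  from measurable_compose[OF this move_tuple_measurable[OF G]]
  show "(\<lambda>x. move G (x ` {..<n})) \<in> borel_measurable (\<Pi>\<^sub>M i\<in>{..<n}. N)" by simp
qed simp

text \<open>The intensity of the moved points is the composition of the density \<open>g\<close>
  with the kernel. It charges no null set, since almost every starting point avoids it, and
  Radon-Nikodym provides the density.\<close>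

lemma move_intensity:
  assumes g: "g \<in> borel_measurable N"
  shows "\<exists>g'\<in>borel_measurable N'. \<forall>H\<in>borel_measurable N'.
    (\<integral>\<^sup>+y. g' y * H y \<partial>N') = (\<integral>\<^sup>+y. g y * (\<integral>\<^sup>+y'. H y' \<partial>\<kappa> y) \<partial>N)"
\<comment> \<open>On an empty space \<open>bind\<close> degenerates, so this case is
  separated.\<close>
proof (cases "space N = {}")
  case True
  then show ?thesis by (intro bexI[of _ "\<lambda>_. 0"]) (simp_all add: nn_integral_empty)
next
  case False
  define R where "R = density N g \<bind> \<kappa>"
  have kd: "\<kappa> \<in> measurable (density N g) (subprob_algebra N')" using kernel by simp
  have sR: "sets R = sets N'"
    unfolding R_def using False by (intro sets_bind_measurable[OF kd]) simp
  have int: "(\<integral>\<^sup>+y'. H y' \<partial>R) = (\<integral>\<^sup>+y. g y * (\<integral>\<^sup>+y'. H y' \<partial>\<kappa> y) \<partial>N)" if H: "H \<in> borel_measurable N'" for H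
  proof -
    have "(\<lambda>y. \<integral>\<^sup>+y'. H y' \<partial>\<kappa> y) \<in> borel_measurable N"
      by (rule measurable_compose[OF kernel nn_integral_measurable_subprob_algebra[OF H]])
    then show ?thesis unfolding R_def nn_integral_bind[OF H kd] by (rule nn_integral_density[OF g])
  qed
  have ac: "absolutely_continuous N' R"
    unfolding absolutely_continuous_def
  proof
    fix A assume A: "A \<in> null_sets N'"
    have "emeasure R A = (\<integral>\<^sup>+y'. indicator A y' \<partial>R)" using A sR by (subst nn_integral_indicator) auto
    also have "\<dots> = (\<integral>\<^sup>+y. g y * (\<integral>\<^sup>+y'. indicator A y' \<partial>\<kappa> y) \<partial>N)" using A by (intro int) auto
    also have "\<dots> = (\<integral>\<^sup>+y. 0 \<partial>N)"
      using nonsingular_kernel[OF A] AE_space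
    proof (intro nn_integral_cong_AE, eventually_elim)
      fix y assume "emeasure (\<kappa> y) A = 0" "y \<in> space N"
      then show "g y * (\<integral>\<^sup>+y'. indicator A y' \<partial>\<kappa> y) = 0"
        using A sets_kernel_at[of y] by (subst nn_integral_indicator) auto
    qed
    finally show "A \<in> null_sets R" using A sR by auto
  qed
  from N'.Radon_Nikodym[OF ac sR]
  obtain g' where g': "g' \<in> borel_measurable N'" "density N' g' = R" by blast
  show ?thesis
  proof (intro bexI[OF _ g'(1)] ballI)
    fix H :: "'b \<Rightarrow> ennreal" assume H: "H \<in> borel_measurable N'"
    show "(\<integral>\<^sup>+y. g' y * H y \<partial>N') = (\<integral>\<^sup>+y. g y * (\<integral>\<^sup>+y'. H y' \<partial>\<kappa> y) \<partial>N)"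
      using nn_integral_density[OF g'(1) H] int[OF H] g'(2) by simp
  qed
qed

text \<open>A new point moves independently of the old ones, so inserting it before the motion with
  intensity \<open>g\<close> is the same as inserting it after the motion with the moved intensity.
  Almost every point being new, \<open>move_insert\<close> applies under the integral.\<close>

lemma ins_int_move:
  assumes g: "g \<in> borel_measurable N" and g': "g' \<in> borel_measurable N'"
    and int: "\<forall>H\<in>borel_measurable N'.
      (\<integral>\<^sup>+y. g' y * H y \<partial>N') = (\<integral>\<^sup>+y. g y * (\<integral>\<^sup>+y'. H y' \<partial>\<kappa> y) \<partial>N)"
    and G: "G \<in> fin_meas N'" and S: "S \<in> fin_subsets N"
  shows "ins_int N g (move G) S = move (ins_int N' g' G) S"
proof -
  let ?P = "\<Pi>\<^sub>M y\<in>S. \<kappa> y"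
  interpret P: prob_space ?P by (rule prob_space_PiM_kernel[OF S])
  interpret NP: pair_sigma_finite N' ?P ..
  have joint: "(\<lambda>(y', h). G (insert y' (h ` S))) \<in> borel_measurable (N' \<Otimes>\<^sub>M ?P)"
    unfolding split_def
    by (intro measurable_compose[OF finset_maps_measurable G] finset_maps.insert measurable_fst
        finset_maps_compose[OF move_image_measurable[OF S] measurable_snd])
  have H: "(\<lambda>y'. move (\<lambda>A. G (insert y' A)) S) \<in> borel_measurable N'"
    unfolding move_def using P.borel_measurable_nn_integral[OF joint] by simp
  have "ins_int N g (move G) S = (\<integral>\<^sup>+y. g y * (\<integral>\<^sup>+y'. move (\<lambda>A. G (insert y' A)) S \<partial>\<kappa> y) \<partial>N)"
    unfolding ins_int_def using N.AE_not_in_finite[OF S] AE_space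
  proof (intro nn_integral_cong_AE, eventually_elim)
    fix y assume "y \<notin> S" "y \<in> space N"
    then show "g y * move G (insert y S) = g y * (\<integral>\<^sup>+y'. move (\<lambda>A. G (insert y' A)) S \<partial>\<kappa> y)"
      using move_insert[OF _ S _ G] by simp
  qed
  also have "\<dots> = (\<integral>\<^sup>+y'. g' y' * move (\<lambda>A. G (insert y' A)) S \<partial>N')"
    using bspec[OF int H] by simp
  also have "\<dots> = (\<integral>\<^sup>+y'. \<integral>\<^sup>+h. g' y' * G (insert y' (h ` S)) \<partial>?P \<partial>N')"
  proof (intro nn_integral_cong)
    fix y' assume y': "y' \<in> space N'"
    have "(\<lambda>h. G (insert y' (h ` S))) \<in> borel_measurable ?P"
      using measurable_Pair2[OF joint y'] by simp
    then show "g' y' * move (\<lambda>A. G (insert y' A)) S = (\<integral>\<^sup>+h. g' y' * G (insert y' (h ` S)) \<partial>?P)"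
      by (simp add: move_def nn_integral_cmult)
  qed
  also have "\<dots> = (\<integral>\<^sup>+h. \<integral>\<^sup>+y'. g' y' * G (insert y' (h ` S)) \<partial>N' \<partial>?P)"
  proof (rule NP.Fubini'[symmetric])
    have "(\<lambda>p. g' (fst p) * (\<lambda>(y', h). G (insert y' (h ` S))) p) \<in> borel_measurable (N' \<Otimes>\<^sub>M ?P)"
      by (intro borel_measurable_times_ennreal joint measurable_compose[OF measurable_fst g'])
    then show "(\<lambda>(y', h). g' y' * G (insert y' (h ` S))) \<in> borel_measurable (N' \<Otimes>\<^sub>M ?P)"
      by (simp add: split_def)
  qed
  also have "\<dots> = move (ins_int N' g' G) S"
    by (simp add: move_def ins_int_def)
  finally show ?thesis .
qed

text \<open>The displacement theorem for Poisson processes: \<open>move\<close> intertwines the two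
  generators and hence all their powers, and at the empty set it changes nothing.\<close>

lemma op_exp_move:
  assumes g: "g \<in> borel_measurable N"
  shows "\<exists>g'\<in>borel_measurable N'. (\<integral>\<^sup>+y. g' y \<partial>N') = (\<integral>\<^sup>+y. g y \<partial>N) \<and>
    (\<forall>G\<in>fin_meas N'. op_exp (ins_int N g) (move G) {} = op_exp (ins_int N' g') G {})"
proof -
  obtain g' where g': "g' \<in> borel_measurable N'" and int: "\<forall>H\<in>borel_measurable N'.
      (\<integral>\<^sup>+y. g' y * H y \<partial>N') = (\<integral>\<^sup>+y. g y * (\<integral>\<^sup>+y'. H y' \<partial>\<kappa> y) \<partial>N)"
    using move_intensity[OF g] by blast
  have pow: "(ins_int N g ^^ n) (move G) {} = (ins_int N' g' ^^ n) G {}" if "G \<in> fin_meas N'" for n G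
    using that
  proof (induction n arbitrary: G)
    case 0
    then show ?case by (simp add: move_empty)
  next
    case (Suc n)
    have "(ins_int N g ^^ Suc n) (move G) {} = (ins_int N g ^^ n) (move (ins_int N' g' G)) {}"
      unfolding funpow_Suc_right o_def
      by (rule fin_opD(2)[OF fin_op_funpow[OF N.fin_op_ins_int[OF g]] empty_finite_sets])
         (rule ins_int_move[OF g g' int Suc.prems])
    also have "\<dots> = (ins_int N' g' ^^ Suc n) G {}"
      unfolding funpow_Suc_right o_def by (intro Suc.IH N'.ins_int_measurable g' Suc.prems)
    finally show ?case .
  qed
  \<comment> \<open>The test function 1 and the total mass one of the kernels show that motion
    preserves the mass.\<close>
  have mass: "(\<integral>\<^sup>+y. g' y \<partial>N') = (\<integral>\<^sup>+y. g y \<partial>N)"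
  proof -
    have "(\<integral>\<^sup>+y. g' y * 1 \<partial>N') = (\<integral>\<^sup>+y. g y * (\<integral>\<^sup>+y'. 1 \<partial>\<kappa> y) \<partial>N)"
      using int by (rule bspec) simp
    also have "\<dots> = (\<integral>\<^sup>+y. g y \<partial>N)"
      by (intro nn_integral_cong) (simp add: prob_space.emeasure_space_1[OF prob_kernel])
    finally show ?thesis by simp
  qed
  show ?thesis
    by (intro bexI[OF _ g'] conjI ballI mass) (simp add: op_exp_def pow)
qed

end

subsection \<open>The set of all trajectories\<close>

locale point_targets =
  fixes m :: "('x, 'z) target_model"
  assumes model: "point_target_model m"
begin

abbreviation "M \<equiv> state_space m"
abbreviation "Tr k \<equiv> traj_space M 0 k"
abbreviation "ps \<equiv> survival_prob m"
abbreviation "tr \<equiv> transition_density m"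

lemma diffuse_states: "diffuse_measure M"
proof -
  interpret sigma_finite_measure M using model by (simp add: point_target_model_def Let_def)
  show ?thesis
    by standard (use model in \<open>simp_all add: point_target_model_def Let_def\<close>)
qed

sublocale M: diffuse_measure M by (rule diffuse_states)

lemma model_simps:
  "is_intensity M (birth_intensity m)"
  "ps \<in> borel_measurable M" "\<And>x. x \<in> space M \<Longrightarrow> ps x \<in> {0..1}"
  "(\<lambda>(x, y). tr x y) \<in> borel_measurable (M \<Otimes>\<^sub>M M)" "\<And>x. x \<in> space M \<Longrightarrow> is_prob_density M (tr x)"
  using model by (simp_all add: point_target_model_def Let_def)

lemma diffuse_Tr: "diffuse_measure (Tr k)"
  by (rule M.diffuse_traj_space)

lemma Tr_Suc: "X \<in> space (Tr k) \<Longrightarrow> X \<in> space (Tr (Suc k))"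
  by (auto simp: space_traj_space)

lemma extend_measurable:
  assumes "\<beta> \<le> k"
  shows "(\<lambda>(x, y). (\<beta>, Suc k, x(Suc k := y))) \<in> measurable ((\<Pi>\<^sub>M j\<in>{\<beta>..k}. M) \<Otimes>\<^sub>M M) (Tr (Suc k))"
proof -
  have ins: "insert (Suc k) {\<beta>..k} = {\<beta>..Suc k}" using assms by auto
  have "(\<lambda>(x, y). x(Suc k := y)) \<in> measurable ((\<Pi>\<^sub>M j\<in>{\<beta>..k}. M) \<Otimes>\<^sub>M M) (\<Pi>\<^sub>M j\<in>{\<beta>..Suc k}. M)"
    using measurable_add_dim[of "Suc k" "{\<beta>..k}" "\<lambda>_. M"] unfolding ins .
  from measurable_compose[OF this measurable_traj_Pair[of 0 \<beta> "Suc k" "Suc k"]] assms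
  show ?thesis by (simp add: case_prod_unfold)
qed

lemma extend_measurable2:
  assumes "\<beta> \<le> k" "x \<in> space (\<Pi>\<^sub>M j\<in>{\<beta>..k}. M)"
  shows "(\<lambda>y. (\<beta>, Suc k, x(Suc k := y))) \<in> measurable M (Tr (Suc k))"
  using measurable_Pair2[OF extend_measurable[OF assms(1)] assms(2)] by simp

lemma traj_step_dead: "\<epsilon> \<noteq> k \<Longrightarrow> traj_step m k (\<beta>, \<epsilon>, x) = return (Tr (Suc k)) (\<beta>, \<epsilon>, x)"
  by (simp add: traj_step_def)

lemma prob_space_transition: "x \<in> space M \<Longrightarrow> prob_space (density M (\<lambda>y. ennreal (tr x y)))"
  using model_simps(5)[of x] by (intro prob_spaceI) (auto simp: emeasure_density is_prob_density_def cong: nn_integral_cong)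

lemma
  assumes X: "\<beta> \<le> k" "x \<in> space (\<Pi>\<^sub>M j\<in>{\<beta>..k}. M)"
  shows sets_traj_step_alive: "sets (traj_step m k (\<beta>, k, x)) = sets (Tr (Suc k))"
    and nn_integral_traj_step_alive: "H \<in> borel_measurable (Tr (Suc k)) \<Longrightarrow>
      (\<integral>\<^sup>+Y. H Y \<partial>traj_step m k (\<beta>, k, x)) =
      (\<integral>\<^sup>+y. ennreal (tr (x k) y) * H (\<beta>, Suc k, x(Suc k := y)) \<partial>M) * ennreal (ps (x k)) +
      H (\<beta>, k, x) * ennreal (1 - ps (x k))"
proof -
  let ?T = "Tr (Suc k)"
  have xk: "x k \<in> space M" using X by (auto simp: space_PiM)
  have X': "(\<beta>, k, x) \<in> space ?T" using X by (auto simp: space_traj_space space_PiM)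
  define D where "D = density M (\<lambda>y. ennreal (tr (x k) y))"
  interpret D: prob_space D unfolding D_def by (rule prob_space_transition[OF xk])
  define f where "f y = (\<beta>, Suc k, x(Suc k := y))" for y
  have f: "f \<in> measurable D ?T" unfolding D_def f_def using extend_measurable2[OF X] by simp
  define K where "K s = (if s then distr D ?T f else return ?T (\<beta>, k, x))" for s
  have step: "traj_step m k (\<beta>, k, x) = measure_pmf (bernoulli_pmf (ps (x k))) \<bind> K"
  proof -
    have "D \<bind> (\<lambda>y. return ?T (f y)) = distr D ?T f"
      by (rule bind_return_distr'[OF D.not_empty f])
    then show ?thesis
      unfolding traj_step_def Let_def K_def[abs_def] D_def f_def by (simp cong: if_cong)
  qed
  have K: "K \<in> measurable (measure_pmf (bernoulli_pmf (ps (x k)))) (subprob_algebra ?T)"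
  proof -
    have "K s \<in> space (subprob_algebra ?T)" for s
      using D.prob_space_distr[OF f] prob_space_return[OF X']
      by (auto simp: K_def space_subprob_algebra intro: prob_space_imp_subprob_space)
    then show ?thesis by simp
  qed
  show "sets (traj_step m k (\<beta>, k, x)) = sets ?T"
    unfolding step by (rule sets_bind_measurable[OF K]) simp
  assume H: "H \<in> borel_measurable ?T"
  have p: "0 \<le> ps (x k)" "ps (x k) \<le> 1" using model_simps(3)[OF xk] by auto
  have tm: "(\<lambda>y. ennreal (tr (x k) y)) \<in> borel_measurable M"
    using model_simps(5)[OF xk] by (auto simp: is_prob_density_def)
  have "(\<integral>\<^sup>+Y. H Y \<partial>distr D ?T f) = (\<integral>\<^sup>+y. H (f y) \<partial>D)"
    by (rule nn_integral_distr[OF f]) (use H in simp)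
  also have "\<dots> = (\<integral>\<^sup>+y. ennreal (tr (x k) y) * H (f y) \<partial>M)"
    unfolding D_def f_def
    by (rule nn_integral_density[OF tm measurable_compose[OF extend_measurable2[OF X] H]])
  finally have "(\<integral>\<^sup>+Y. H Y \<partial>K True) = (\<integral>\<^sup>+y. ennreal (tr (x k) y) * H (f y) \<partial>M)"
    by (simp add: K_def)
  moreover have "(\<integral>\<^sup>+Y. H Y \<partial>K False) = H (\<beta>, k, x)"
    by (simp add: K_def nn_integral_return[OF X' H])
  ultimately show "(\<integral>\<^sup>+Y. H Y \<partial>traj_step m k (\<beta>, k, x)) =
      (\<integral>\<^sup>+y. ennreal (tr (x k) y) * H (\<beta>, Suc k, x(Suc k := y)) \<partial>M) * ennreal (ps (x k)) +
      H (\<beta>, k, x) * ennreal (1 - ps (x k))"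
    unfolding step nn_integral_bind[OF H K] using p by (simp add: f_def)
qed

lemma Tr_cases:
  assumes "X \<in> space (Tr k)"
  obtains (dead) \<beta> \<epsilon> x where "X = (\<beta>, \<epsilon>, x)" "\<epsilon> \<noteq> k"
    | (alive) \<beta> x where "X = (\<beta>, k, x)" "\<beta> \<le> k" "x \<in> space (\<Pi>\<^sub>M j\<in>{\<beta>..k}. M)"
  using assms by (cases X) (auto simp: space_traj_space space_PiM)

lemma sets_traj_step:
  assumes X: "X \<in> space (Tr k)"
  shows "sets (traj_step m k X) = sets (Tr (Suc k))"
  using X
proof (cases rule: Tr_cases)
  case (dead \<beta> \<epsilon> x)
  then show ?thesis by (simp add: traj_step_dead)
next
  case (alive \<beta> x)
  then show ?thesis using sets_traj_step_alive[OF alive(2,3)] by simp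
qed

lemma prob_space_traj_step:
  assumes X: "X \<in> space (Tr k)"
  shows "prob_space (traj_step m k X)"
  using X
proof (cases rule: Tr_cases)
  case (dead \<beta> \<epsilon> x)
  then show ?thesis using Tr_Suc[OF X] by (simp add: traj_step_dead prob_space_return)
next
  case (alive \<beta> x)
  have xk: "x k \<in> space M" using alive by (auto simp: space_PiM)
  have "(\<integral>\<^sup>+Y. 1 \<partial>traj_step m k (\<beta>, k, x)) = ennreal (ps (x k)) + ennreal (1 - ps (x k))"
    using model_simps(5)[OF xk]
    by (subst nn_integral_traj_step_alive[OF alive(2,3)]) (simp_all add: is_prob_density_def)
  also have "\<dots> = 1" using model_simps(3)[OF xk] by (simp add: ennreal_plus[symmetric] del: ennreal_plus)
  finally show ?thesis by (intro prob_spaceI) (simp add: alive(1))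
qed

lemma emeasure_traj_step_measurable:
  assumes A: "A \<in> sets (Tr (Suc k))"
  shows "(\<lambda>X. emeasure (traj_step m k X) A) \<in> borel_measurable (Tr k)"
proof (rule measurable_traj_spaceI)
  fix \<beta> \<epsilon> assume b: "(0::nat) \<le> \<beta>" "\<beta> \<le> \<epsilon>" "\<epsilon> \<le> k"
  let ?P = "\<Pi>\<^sub>M j\<in>{\<beta>..\<epsilon>}. M"
  have iA: "(\<lambda>X. indicator A X :: ennreal) \<in> borel_measurable (Tr (Suc k))" using A by simp
  have Pm: "(\<lambda>x. indicator A (\<beta>, \<epsilon>, x) :: ennreal) \<in> borel_measurable ?P"
    by (rule measurable_compose[OF measurable_traj_Pair iA]) (use b in auto)
  show "(\<lambda>x. emeasure (traj_step m k (\<beta>, \<epsilon>, x)) A) \<in> borel_measurable ?P"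
  proof (cases "\<epsilon> = k")
    case False
    have "emeasure (traj_step m k (\<beta>, \<epsilon>, x)) A = indicator A (\<beta>, \<epsilon>, x)" for x
      using A by (simp add: traj_step_dead[OF False])
    then show ?thesis using Pm by simp
  next
    case True
    have xk: "(\<lambda>x. x k) \<in> measurable ?P M" using b True by simp
    have "(\<lambda>q. (fst q k, snd q)) \<in> measurable (?P \<Otimes>\<^sub>M M) (M \<Otimes>\<^sub>M M)"
      by (intro measurable_Pair measurable_snd measurable_compose[OF measurable_fst xk])
    from measurable_compose[OF this model_simps(4)]
    have t: "(\<lambda>q. tr (fst q k) (snd q)) \<in> borel_measurable (?P \<Otimes>\<^sub>M M)" by simp
    have e: "(\<lambda>q. indicator A (\<beta>, Suc k, (fst q)(Suc k := snd q)) :: ennreal) \<in> borel_measurable (?P \<Otimes>\<^sub>M M)"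
      using measurable_compose[OF extend_measurable[of \<beta> k] iA] b True by (simp add: split_def)
    have "(\<lambda>q. ennreal (tr (fst q k) (snd q)) * indicator A (\<beta>, Suc k, (fst q)(Suc k := snd q)))
        \<in> borel_measurable (?P \<Otimes>\<^sub>M M)"
      using t e by (intro borel_measurable_times_ennreal) auto
    then have j: "(\<lambda>x. \<integral>\<^sup>+y. ennreal (tr (x k) y) * indicator A (\<beta>, Suc k, x(Suc k := y)) \<partial>M) \<in> borel_measurable ?P"
      by (intro M.borel_measurable_nn_integral) (simp add: split_def)
    have pm: "(\<lambda>x. ps (x k)) \<in> borel_measurable ?P" by (rule measurable_compose[OF xk model_simps(2)])
    have "(\<lambda>x. (\<integral>\<^sup>+y. ennreal (tr (x k) y) * indicator A (\<beta>, Suc k, x(Suc k := y)) \<partial>M) * ennreal (ps (x k)) +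
        indicator A (\<beta>, k, x) * ennreal (1 - ps (x k))) \<in> borel_measurable ?P"
      using j pm Pm True by (intro borel_measurable_add borel_measurable_times_ennreal) auto
    moreover have "emeasure (traj_step m k (\<beta>, \<epsilon>, x)) A =
        (\<integral>\<^sup>+y. ennreal (tr (x k) y) * indicator A (\<beta>, Suc k, x(Suc k := y)) \<partial>M) * ennreal (ps (x k)) +
        indicator A (\<beta>, k, x) * ennreal (1 - ps (x k))" if "x \<in> space ?P" for x
    proof -
      have x: "\<beta> \<le> k" "x \<in> space (\<Pi>\<^sub>M j\<in>{\<beta>..k}. M)" using that b True by auto
      have "emeasure (traj_step m k (\<beta>, k, x)) A = (\<integral>\<^sup>+Y. indicator A Y \<partial>traj_step m k (\<beta>, k, x))"
        using A sets_traj_step_alive[OF x] by simp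
      then show ?thesis using nn_integral_traj_step_alive[OF x iA] by (simp add: True)
    qed
    ultimately show ?thesis by (simp cong: measurable_cong)
  qed
qed

lemma traj_step_kernel: "traj_step m k \<in> measurable (Tr k) (subprob_algebra (Tr (Suc k)))"
  by (rule measurable_subprob_algebra)
     (rule prob_space_imp_subprob_space[OF prob_space_traj_step] sets_traj_step emeasure_traj_step_measurable,
      assumption)+

text \<open>A trajectory that is not prolonged enters \<open>A\<close> only if it lies in
  \<open>A\<close> already. A prolonged one receives a new state that has a density; by Tonelli on
  the longer product space, almost every trajectory has almost no prolongation in
  \<open>A\<close>.\<close>

lemma traj_step_nonsingular:
  assumes A: "A \<in> null_sets (Tr (Suc k))"
  shows "AE X in Tr k. emeasure (traj_step m k X) A = 0"
proof -
  interpret P: product_sigma_finite "\<lambda>_::nat. M" ..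
  have As: "A \<in> sets (Tr (Suc k))" using A by auto
  note null = A[unfolded null_sets_traj_space_iff[OF As]]
  have iA: "(\<lambda>X. indicator A X :: ennreal) \<in> borel_measurable (Tr (Suc k))" using As by simp
  define B where "B = {X \<in> space (Tr k). emeasure (traj_step m k X) A \<noteq> 0}"
  have Bs: "B \<in> sets (Tr k)"
  proof -
    have "(\<lambda>X. emeasure (traj_step m k X) A) -` (- {0}) \<inter> space (Tr k) \<in> sets (Tr k)"
      by (rule measurable_sets[OF emeasure_traj_step_measurable[OF As]]) simp
    also have "(\<lambda>X. emeasure (traj_step m k X) A) -` (- {0}) \<inter> space (Tr k) = B" by (auto simp: B_def)
    finally show ?thesis .
  qed
  have "AE x in (\<Pi>\<^sub>M j\<in>{\<beta>..\<epsilon>}. M). (\<beta>, \<epsilon>, x) \<notin> B" if b: "0 \<le> \<beta>" "\<beta> \<le> \<epsilon>" "\<epsilon> \<le> k" for \<beta> \<epsilon>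
  proof (cases "\<epsilon> = k")
    case False
    have "emeasure (traj_step m k (\<beta>, \<epsilon>, x)) A = indicator A (\<beta>, \<epsilon>, x)" for x
      using As by (simp add: traj_step_dead[OF False])
    moreover have "AE x in (\<Pi>\<^sub>M j\<in>{\<beta>..\<epsilon>}. M). (\<beta>, \<epsilon>, x) \<notin> A" using null b by simp
    ultimately show ?thesis by (auto simp: B_def)
  next
    case True
    let ?P = "\<Pi>\<^sub>M j\<in>{\<beta>..k}. M"
    let ?i = "\<lambda>x y. indicator A (\<beta>, Suc k, x(Suc k := y)) :: ennreal"
    have ins: "insert (Suc k) {\<beta>..k} = {\<beta>..Suc k}" using b True by auto
    have im: "(\<lambda>x. indicator A (\<beta>, Suc k, x) :: ennreal) \<in> borel_measurable (\<Pi>\<^sub>M j\<in>{\<beta>..Suc k}. M)"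
      by (rule measurable_compose[OF measurable_traj_Pair iA]) (use b in auto)
    have ij: "(\<lambda>q. ?i (fst q) (snd q)) \<in> borel_measurable (?P \<Otimes>\<^sub>M M)"
      using measurable_compose[OF extend_measurable[of \<beta> k] iA] b True by (simp add: split_def)
    have "(\<integral>\<^sup>+x. \<integral>\<^sup>+y. ?i x y \<partial>M \<partial>?P) = (\<integral>\<^sup>+x. indicator A (\<beta>, Suc k, x) \<partial>(\<Pi>\<^sub>M j\<in>{\<beta>..Suc k}. M))"
      using P.product_nn_integral_insert[of "{\<beta>..k}" "Suc k" "\<lambda>x. indicator A (\<beta>, Suc k, x)"] im by (simp add: ins)
    also have "\<dots> = 0"
    proof -
      have "AE x in (\<Pi>\<^sub>M j\<in>{\<beta>..Suc k}. M). (\<beta>, Suc k, x) \<notin> A" using null b True by simp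
      then have "AE x in (\<Pi>\<^sub>M j\<in>{\<beta>..Suc k}. M). (indicator A (\<beta>, Suc k, x) :: ennreal) = 0"
        by eventually_elim simp
      then show ?thesis unfolding nn_integral_0_iff_AE[OF im] .
    qed
    finally have int0: "(\<integral>\<^sup>+x. \<integral>\<^sup>+y. ?i x y \<partial>M \<partial>?P) = 0" .
    have "(\<lambda>x. \<integral>\<^sup>+y. ?i x y \<partial>M) \<in> borel_measurable ?P"
      by (rule M.borel_measurable_nn_integral) (use ij in \<open>simp add: split_def\<close>)
    from int0[unfolded nn_integral_0_iff_AE[OF this]]
    have "AE x in ?P. (\<integral>\<^sup>+y. ?i x y \<partial>M) = 0" .
    moreover have "AE x in ?P. (\<beta>, k, x) \<notin> A" using null b True by simp
    ultimately have "AE x in ?P. (\<beta>, k, x) \<notin> B"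
      using AE_space
    proof eventually_elim
      fix x assume x: "(\<integral>\<^sup>+y. ?i x y \<partial>M) = 0" "(\<beta>, k, x) \<notin> A" "x \<in> space ?P"
      have bk: "\<beta> \<le> k" using b by simp
      have "?i x \<in> borel_measurable M"
        by (rule measurable_compose[OF extend_measurable2[OF bk x(3)] iA])
      from x(1)[unfolded nn_integral_0_iff_AE[OF this]]
      have "AE y in M. ?i x y = 0" .
      then have "(\<integral>\<^sup>+y. ennreal (tr (x k) y) * ?i x y \<partial>M) = (\<integral>\<^sup>+y. 0 \<partial>M)"
        by (intro nn_integral_cong_AE, eventually_elim) simp
      moreover have "emeasure (traj_step m k (\<beta>, k, x)) A = (\<integral>\<^sup>+Y. indicator A Y \<partial>traj_step m k (\<beta>, k, x))"
        using As sets_traj_step_alive[OF bk x(3)] by simp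
      ultimately show "(\<beta>, k, x) \<notin> B"
        using x(2) nn_integral_traj_step_alive[OF bk x(3) iA] by (simp add: B_def)
    qed
    then show ?thesis unfolding True .
  qed
  then have "B \<in> null_sets (Tr k)" unfolding null_sets_traj_space_iff[OF Bs] by blast
  then have "AE X in Tr k. X \<notin> B" by (rule AE_not_in)
  then show ?thesis using AE_space by eventually_elim (auto simp: B_def)
qed

sublocale step: markov_move "Tr k" "Tr (Suc k)" "traj_step m k" for k
proof -
  interpret T: diffuse_measure "Tr k" by (rule diffuse_Tr)
  interpret T': diffuse_measure "Tr (Suc k)" by (rule diffuse_Tr)
  show "markov_move (Tr k) (Tr (Suc k)) (traj_step m k)"
    by (intro markov_move.intro markov_move_axioms.intro T.diffuse_measure_axioms T'.sigma_finite_measure_axioms)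
       (rule traj_step_kernel, erule prob_space_traj_step, erule traj_step_nonsingular)
qed

end

text \<open>Superposition of independent Poisson processes: their generators commute and the sum of
  the generators has the sum of the intensities as weight.\<close>

lemma (in sigma_finite_measure) op_exp_ins_int_add:
  assumes g: "g \<in> borel_measurable M" and h: "h \<in> borel_measurable M"
    and G: "G \<in> fin_meas M" and A: "A \<in> fin_subsets M"
  shows "op_exp (ins_int M g) (op_exp (ins_int M h) G) A = op_exp (ins_int M (\<lambda>y. g y + h y)) G A"
proof -
  have gh: "(\<lambda>y. g y + h y) \<in> borel_measurable M" using g h by simp
  have pow: "((\<lambda>G A. ins_int M g G A + ins_int M h G A) ^^ n) G A = (ins_int M (\<lambda>y. g y + h y) ^^ n) G A"
    if "A \<in> fin_subsets M" for n A
    using that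
  proof (induction n arbitrary: A)
    case (Suc n)
    let ?P = "\<lambda>G A. ins_int M g G A + ins_int M h G A"
    have m: "(ins_int M (\<lambda>y. g y + h y) ^^ n) G \<in> fin_meas M"
      by (rule fin_opD(1)[OF fin_op_funpow[OF fin_op_ins_int[OF gh]] G])
    have "(?P ^^ Suc n) G A = ?P ((?P ^^ n) G) A" by simp
    also have "\<dots> = ?P ((ins_int M (\<lambda>y. g y + h y) ^^ n) G) A"
      using Suc by (intro arg_cong2[of _ _ _ _ "(+)"] ins_int_cong) auto
    also have "\<dots> = (ins_int M (\<lambda>y. g y + h y) ^^ Suc n) G A"
      using ins_int_add_weight[OF g h m Suc.prems] by simp
    finally show ?case .
  qed simp
  have "op_exp (ins_int M g) (op_exp (ins_int M h) G) A = op_exp (\<lambda>G A. ins_int M g G A + ins_int M h G A) G A"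
    by (rule op_exp_add[symmetric, OF fin_op_ins_int[OF g] fin_op_ins_int[OF h] ops_commute_ins_int[OF g h] G A])
  then show ?thesis using pow[OF A] by (simp add: op_exp_def)
qed

section \<open>Newborn targets\<close>

context point_targets
begin

abbreviation "blam \<equiv> birth_intensity m"
abbreviation "bmass \<equiv> (\<integral>x. blam x \<partial>M)"

lemma bmass_nonneg: "0 \<le> bmass"
  using model_simps(1) by (intro Bochner_Integration.integral_nonneg) (simp add: is_intensity_def)

lemma blam_measurable: "(\<lambda>y. ennreal (blam y)) \<in> borel_measurable M"
  using model_simps(1) by (auto simp: is_intensity_def)

lemma nn_integral_blam: "(\<integral>\<^sup>+y. ennreal (blam y) \<partial>M) = ennreal bmass"
  using model_simps(1) by (intro nn_integral_eq_integral) (auto simp: is_intensity_def intro!: AE_I2)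

lemma newborn_measurable: "\<alpha> \<le> k \<Longrightarrow> k \<le> \<gamma> \<Longrightarrow> newborn k \<in> measurable M (traj_space M \<alpha> \<gamma>)"
proof -
  assume k: "\<alpha> \<le> k" "k \<le> \<gamma>"
  have "(\<lambda>x. \<lambda>j\<in>{k..k}. x) \<in> measurable M (\<Pi>\<^sub>M j\<in>{k..k}. M)" by (rule measurable_restrict) simp
  from measurable_compose[OF this measurable_traj_Pair[of \<alpha> k k \<gamma>]] k
  show ?thesis by (simp add: newborn_def[abs_def])
qed

text \<open>A function of the state is transported to the one-step trajectories at time
  \<open>k\<close>, which form one component of the space. The general result type covers
  intensities in \<open>ennreal\<close> as well as real densities.\<close>

definition at_birth :: "nat \<Rightarrow> ('x \<Rightarrow> 'a::zero) \<Rightarrow> 'x traj \<Rightarrow> 'a" where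
  "at_birth k d = (\<lambda>(\<beta>, \<epsilon>, x). if \<beta> = k \<and> \<epsilon> = k then d (x k) else 0)"

lemma at_birth_measurable:
  fixes d :: "'x \<Rightarrow> 'a::{zero, topological_space}"
  assumes d: "d \<in> borel_measurable M"
  shows "at_birth k d \<in> borel_measurable (traj_space M \<alpha> \<gamma>)"
proof (rule measurable_traj_spaceI)
  fix \<beta> \<epsilon> :: nat
  show "(\<lambda>x. at_birth k d (\<beta>, \<epsilon>, x)) \<in> borel_measurable (\<Pi>\<^sub>M j\<in>{\<beta>..\<epsilon>}. M)"
  proof (cases "\<beta> = k \<and> \<epsilon> = k")
    case True
    then have "(\<lambda>x. x k) \<in> measurable (\<Pi>\<^sub>M j\<in>{\<beta>..\<epsilon>}. M) M" by simp
    from measurable_compose[OF this d] True show ?thesis by (simp add: at_birth_def)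
  next
    case False
    then have "(\<lambda>x. at_birth k d (\<beta>, \<epsilon>, x)) = (\<lambda>_. 0)" by (auto simp: at_birth_def)
    then show ?thesis by simp
  qed
qed

lemma nn_integral_at_birth:
  fixes d :: "'x \<Rightarrow> ennreal"
  assumes k: "\<alpha> \<le> k" "k \<le> \<gamma>" and d: "d \<in> borel_measurable M"
    and H: "H \<in> borel_measurable (traj_space M \<alpha> \<gamma>)"
  shows "(\<integral>\<^sup>+X. at_birth k d X * H X \<partial>traj_space M \<alpha> \<gamma>) = (\<integral>\<^sup>+y. d y * H (newborn k y) \<partial>M)"
proof -
  interpret P: product_sigma_finite "\<lambda>_::nat. M" ..
  let ?g = "at_birth k d"
  have "(\<integral>\<^sup>+X. ?g X * H X \<partial>traj_space M \<alpha> \<gamma>) =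
      (\<Sum>(\<beta>, \<epsilon>)\<in>traj_ivls \<alpha> \<gamma>. \<integral>\<^sup>+x. ?g (\<beta>, \<epsilon>, x) * H (\<beta>, \<epsilon>, x) \<partial>(\<Pi>\<^sub>M j\<in>{\<beta>..\<epsilon>}. M))"
    by (rule nn_integral_traj_space[OF borel_measurable_times_ennreal[OF at_birth_measurable[OF d] H]])
  also have "\<dots> = (\<Sum>i\<in>traj_ivls \<alpha> \<gamma>. if i = (k, k) then \<integral>\<^sup>+x. ?g (k, k, x) * H (k, k, x) \<partial>(\<Pi>\<^sub>M j\<in>{k..k}. M) else 0)"
  proof (intro sum.cong refl)
    fix i :: "nat \<times> nat"
    obtain \<beta> \<epsilon> where i: "i = (\<beta>, \<epsilon>)" by (cases i)
    have "?g (\<beta>, \<epsilon>, x) = 0" if "i \<noteq> (k, k)" for x using that by (auto simp: at_birth_def i)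
    then show "(case i of (\<beta>, \<epsilon>) \<Rightarrow> \<integral>\<^sup>+x. ?g (\<beta>, \<epsilon>, x) * H (\<beta>, \<epsilon>, x) \<partial>(\<Pi>\<^sub>M j\<in>{\<beta>..\<epsilon>}. M)) =
        (if i = (k, k) then \<integral>\<^sup>+x. ?g (k, k, x) * H (k, k, x) \<partial>(\<Pi>\<^sub>M j\<in>{k..k}. M) else 0)"
      by (cases "i = (k, k)") (auto simp: i)
  qed
  also have "\<dots> = (\<integral>\<^sup>+x. ?g (k, k, x) * H (k, k, x) \<partial>(\<Pi>\<^sub>M j\<in>{k..k}. M))"
    using k by (subst sum.delta[OF finite_traj_ivls]) simp
  also have "\<dots> = (\<integral>\<^sup>+x. d (x k) * H (newborn k (x k)) \<partial>(\<Pi>\<^sub>M j\<in>{k}. M))"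
  proof -
    have "H (k, k, x) = H (newborn k (x k))" if x: "x \<in> space (\<Pi>\<^sub>M j\<in>{k}. M)" for x
    proof -
      have "x = (\<lambda>j\<in>{k}. x k)"
        using x by (intro ext) (auto simp: space_PiM PiE_def extensional_def)
      then show ?thesis unfolding newborn_def by metis
    qed
    then have "(\<integral>\<^sup>+x. ?g (k, k, x) * H (k, k, x) \<partial>(\<Pi>\<^sub>M j\<in>{k}. M)) =
        (\<integral>\<^sup>+x. d (x k) * H (newborn k (x k)) \<partial>(\<Pi>\<^sub>M j\<in>{k}. M))"
      by (intro nn_integral_cong) (simp add: at_birth_def)
    then show ?thesis by simp
  qed
  also have "\<dots> = (\<integral>\<^sup>+y. d y * H (newborn k y) \<partial>M)"
    by (rule P.product_nn_integral_singleton)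
       (rule borel_measurable_times_ennreal[OF d measurable_compose[OF newborn_measurable[OF k] H]])
  finally show ?thesis .
qed

lemma newborn_intensity:
  "\<exists>g\<in>borel_measurable (Tr k). \<forall>H\<in>borel_measurable (Tr k).
    (\<integral>\<^sup>+X. g X * H X \<partial>Tr k) = (\<integral>\<^sup>+y. ennreal (blam y) * H (newborn k y) \<partial>M)"
  by (intro bexI[of _ "at_birth k (\<lambda>y. ennreal (blam y))"] ballI nn_integral_at_birth blam_measurable
      at_birth_measurable) simp_all

text \<open>The density serves as placeholder for tracks with existence probability 0. A transition
  density, carried over to trajectories of length one, provides it.\<close>

lemma ex_prob_density_traj_space:
  assumes "\<alpha> \<le> \<gamma>" "space M \<noteq> {}"
  shows "\<exists>p. is_prob_density (traj_space M \<alpha> \<gamma>) p"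
proof -
  obtain x0 where x0: "x0 \<in> space M" using assms(2) by blast
  have tr: "tr x0 \<in> borel_measurable M" "\<And>y. y \<in> space M \<Longrightarrow> 0 \<le> tr x0 y" "(\<integral>\<^sup>+y. ennreal (tr x0 y) \<partial>M) = 1"
    using model_simps(5)[OF x0] by (simp_all add: is_prob_density_def)
  have tm: "(\<lambda>y. ennreal (tr x0 y)) \<in> borel_measurable M" using tr(1) by simp
  have "ennreal (at_birth \<alpha> (tr x0) X) = at_birth \<alpha> (\<lambda>y. ennreal (tr x0 y)) X" for X
    by (simp add: at_birth_def split: prod.split)
  then have "(\<integral>\<^sup>+X. ennreal (at_birth \<alpha> (tr x0) X) \<partial>traj_space M \<alpha> \<gamma>) = 1"
    using nn_integral_at_birth[OF order_refl assms(1) tm, of "\<lambda>_. 1"] tr(3) by simp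
  moreover have "0 \<le> at_birth \<alpha> (tr x0) X" if "X \<in> space (traj_space M \<alpha> \<gamma>)" for X
    using that tr(2) by (auto simp: at_birth_def space_traj_space PiE_iff)
  ultimately have "is_prob_density (traj_space M \<alpha> \<gamma>) (at_birth \<alpha> (tr x0))"
    using at_birth_measurable[OF tr(1)] by (simp add: is_prob_density_def)
  then show ?thesis by (intro exI[of _ "at_birth \<alpha> (tr x0)"])
qed

lemma newborn_image_measurable:
  assumes A: "A \<in> fin_subsets (Tr k)"
  shows "(\<lambda>B. A \<union> newborn k ` B) \<in> measurable (finite_sets M) (finite_sets (Tr k))"
proof (rule measurable_finite_setsI)
  fix B assume "finite B" "B \<subseteq> space M"
  then show "A \<union> newborn k ` B \<in> fin_subsets (Tr k)"
    using A measurable_space[OF newborn_measurable[of 0 k k]] by (auto simp: space_finite_sets)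
next
  fix n :: nat
  have "(\<lambda>x. A \<union> (\<lambda>i. newborn k (x i)) ` {..<n}) \<in> finset_maps (\<Pi>\<^sub>M i\<in>{..<n}. M) (Tr k)"
  proof (intro finset_maps_Un finset_maps_const A finset_maps_image)
    fix i assume "i \<in> {..<n}"
    then have "(\<lambda>x. x i) \<in> measurable (\<Pi>\<^sub>M i\<in>{..<n}. M) M" by simp
    then show "(\<lambda>x. newborn k (x i)) \<in> measurable (\<Pi>\<^sub>M i\<in>{..<n}. M) (Tr k)"
      by (rule measurable_compose[OF _ newborn_measurable]) simp_all
  qed simp
  from finset_maps_measurable[OF this]
  show "(\<lambda>x. A \<union> newborn k ` x ` {..<n}) \<in> measurable (\<Pi>\<^sub>M i\<in>{..<n}. M) (finite_sets (Tr k))"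
    by (simp add: image_image)
qed

definition add_newborns :: "nat \<Rightarrow> 'x traj set \<Rightarrow> 'x traj set measure" where
  "add_newborns k A = ppp M blam \<bind> (\<lambda>B. return (finite_sets (Tr k)) (A \<union> newborn k ` B))"

lemma sets_ppp: "sets (ppp N lam) = sets (finite_sets N)"
  by (simp add: ppp_def)

lemma space_ppp: "space (ppp N lam) = fin_subsets N"
  by (simp add: ppp_def)

lemma measurable_ppp: "measurable (ppp N lam) L = measurable (finite_sets N) L"
  by (rule measurable_cong_sets) (simp_all add: sets_ppp)

lemma add_newborns_bind_measurable:
  assumes A: "A \<in> fin_subsets (Tr k)"
  shows "(\<lambda>B. return (finite_sets (Tr k)) (A \<union> newborn k ` B)) \<in>
    measurable (ppp M blam) (subprob_algebra (finite_sets (Tr k)))"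
  unfolding measurable_ppp by (rule measurable_compose[OF newborn_image_measurable[OF A] return_measurable])

lemma sets_add_newborns:
  "A \<in> fin_subsets (Tr k) \<Longrightarrow> sets (add_newborns k A) = sets (finite_sets (Tr k))"
  unfolding add_newborns_def
  by (rule sets_bind_measurable[OF add_newborns_bind_measurable]) (auto simp: space_ppp space_finite_sets)

text \<open>Inserting a state into \<open>B\<close> inserts its one-step trajectory into the union
  with \<open>A\<close>. Iterated, this carries the exponential on states over to one on
  trajectories, evaluated at \<open>A\<close> instead of the empty set.\<close>

lemma nn_integral_add_newborns:
  "\<exists>g\<in>borel_measurable (Tr k). (\<integral>\<^sup>+X. g X \<partial>Tr k) = ennreal bmass \<and>
    (\<forall>G\<in>fin_meas (Tr k). \<forall>A\<in>fin_subsets (Tr k).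
      (\<integral>\<^sup>+S. G S \<partial>add_newborns k A) = ennreal (exp (- bmass)) * op_exp (ins_int (Tr k) g) G A)"
proof -
  obtain g where g: "g \<in> borel_measurable (Tr k)" and int: "\<forall>H\<in>borel_measurable (Tr k).
    (\<integral>\<^sup>+X. g X * H X \<partial>Tr k) = (\<integral>\<^sup>+y. ennreal (blam y) * H (newborn k y) \<partial>M)"
    using newborn_intensity[of k] by blast
  have nbA: "A \<union> newborn k ` B \<in> fin_subsets (Tr k)"
    if "A \<in> fin_subsets (Tr k)" "B \<in> fin_subsets M" for A B
    by (rule measurable_space[OF newborn_image_measurable[OF that(1)] that(2)])
  have "(\<integral>\<^sup>+S. G S \<partial>add_newborns k A) = ennreal (exp (- bmass)) * op_exp (ins_int (Tr k) g) G A"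
    if G: "G \<in> fin_meas (Tr k)" and A: "A \<in> fin_subsets (Tr k)" for G A
  proof -
    let ?b = "\<lambda>y. ennreal (blam y)"
    have step: "ins_int M ?b (\<lambda>B. G (A \<union> newborn k ` B)) B = ins_int (Tr k) g G (A \<union> newborn k ` B)"
      if G: "G \<in> fin_meas (Tr k)" and B: "B \<in> fin_subsets M" for G B
      unfolding ins_int_def using bspec[OF int insert_measurable[OF G nbA[OF A B]]] by simp
    have pow: "(ins_int M ?b ^^ n) (\<lambda>B. G (A \<union> newborn k ` B)) {} = (ins_int (Tr k) g ^^ n) G A" for n
      using G
    proof (induction n arbitrary: G)
      case (Suc n)
      have "(ins_int M ?b ^^ Suc n) (\<lambda>B. G (A \<union> newborn k ` B)) {} =
          (ins_int M ?b ^^ n) (\<lambda>B. ins_int (Tr k) g G (A \<union> newborn k ` B)) {}"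
        unfolding funpow_Suc_right o_def
        by (rule fin_opD(2)[OF fin_op_funpow[OF M.fin_op_ins_int[OF blam_measurable]] empty_finite_sets])
           (rule step[OF Suc.prems])
      also have "\<dots> = (ins_int (Tr k) g ^^ Suc n) G A"
        unfolding funpow_Suc_right o_def by (intro Suc.IH step.N.ins_int_measurable g Suc.prems)
      finally show ?case .
    qed simp
    have "(\<integral>\<^sup>+S. G S \<partial>add_newborns k A) =
        (\<integral>\<^sup>+B. \<integral>\<^sup>+S. G S \<partial>return (finite_sets (Tr k)) (A \<union> newborn k ` B) \<partial>ppp M blam)"
      unfolding add_newborns_def by (rule nn_integral_bind[OF G add_newborns_bind_measurable[OF A]])
    also have "\<dots> = (\<integral>\<^sup>+B. G (A \<union> newborn k ` B) \<partial>ppp M blam)"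
      by (intro nn_integral_cong nn_integral_return nbA A G) (simp add: space_ppp)
    also have "\<dots> = ennreal (exp (- bmass)) * op_exp (ins_int M ?b) (\<lambda>B. G (A \<union> newborn k ` B)) {}"
      by (rule M.nn_integral_ppp[OF model_simps(1) measurable_compose[OF newborn_image_measurable[OF A] G]])
    also have "op_exp (ins_int M ?b) (\<lambda>B. G (A \<union> newborn k ` B)) {} = op_exp (ins_int (Tr k) g) G A"
      by (simp add: op_exp_def pow)
    finally show ?thesis .
  qed
  moreover have "(\<integral>\<^sup>+X. g X \<partial>Tr k) = ennreal bmass"
    using bspec[OF int, of "\<lambda>_. 1"] by (simp add: nn_integral_blam)
  ultimately show ?thesis by (intro bexI[OF _ g] conjI ballI)
qed

lemma add_newborns_kernel:
  "add_newborns k \<in> measurable (finite_sets (Tr k)) (subprob_algebra (finite_sets (Tr k)))"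
proof (rule measurable_subprob_algebra)
  obtain g where g: "g \<in> borel_measurable (Tr k)" and mass: "(\<integral>\<^sup>+X. g X \<partial>Tr k) = ennreal bmass"
    and int: "\<forall>G\<in>fin_meas (Tr k). \<forall>A\<in>fin_subsets (Tr k).
      (\<integral>\<^sup>+S. G S \<partial>add_newborns k A) = ennreal (exp (- bmass)) * op_exp (ins_int (Tr k) g) G A"
    using nn_integral_add_newborns[of k] by blast
  fix A assume A: "A \<in> fin_subsets (Tr k)"
  show "sets (add_newborns k A) = sets (finite_sets (Tr k))" by (rule sets_add_newborns[OF A])
  have "(\<integral>\<^sup>+S. 1 \<partial>add_newborns k A) = ennreal (exp (- bmass)) * op_exp (ins_int (Tr k) g) (\<lambda>_. 1) A"
    using int[THEN bspec, THEN bspec, OF _ A, of "\<lambda>_. 1"] by simp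
  also have "\<dots> = 1"
    by (simp add: step.N.op_exp_const[OF g mass bmass_nonneg A] ennreal_mult'[symmetric] exp_minus)
  finally show "subprob_space (add_newborns k A)"
    by (intro prob_space_imp_subprob_space prob_spaceI) simp
next
  obtain g where g: "g \<in> borel_measurable (Tr k)"
    and int: "\<forall>G\<in>fin_meas (Tr k). \<forall>A\<in>fin_subsets (Tr k).
      (\<integral>\<^sup>+S. G S \<partial>add_newborns k A) = ennreal (exp (- bmass)) * op_exp (ins_int (Tr k) g) G A"
    using nn_integral_add_newborns[of k] by blast
  fix E assume E: "E \<in> sets (finite_sets (Tr k))"
  then have iE: "(\<lambda>S. indicator E S :: ennreal) \<in> fin_meas (Tr k)" by simp
  have eq: "emeasure (add_newborns k A) E = ennreal (exp (- bmass)) * op_exp (ins_int (Tr k) g) (indicator E) A"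
    if "A \<in> fin_subsets (Tr k)" for A
    using int[THEN bspec, THEN bspec, OF iE that] sets_add_newborns[OF that] E by simp
  show "(\<lambda>A. emeasure (add_newborns k A) E) \<in> fin_meas (Tr k)"
  proof (subst measurable_cong[OF eq])
    show "(\<lambda>A. ennreal (exp (- bmass)) * op_exp (ins_int (Tr k) g) (indicator E) A) \<in> fin_meas (Tr k)"
      by (intro borel_measurable_times_ennreal op_exp_measurable[OF step.N.fin_op_ins_int[OF g]] iE) simp
  qed
qed

section \<open>The law of the set of all trajectories\<close>

definition advance :: "nat \<Rightarrow> 'x traj set \<Rightarrow> 'x traj set measure" where
  "advance k S = (\<Pi>\<^sub>M X\<in>S. traj_step m k X) \<bind> (\<lambda>h. add_newborns (Suc k) (h ` S))"

lemma all_trajs_Suc: "all_trajs m (Suc k) = all_trajs m k \<bind> advance k"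
  by (simp add: advance_def[abs_def] add_newborns_def)

lemma advance_bind_measurable:
  assumes S: "S \<in> fin_subsets (Tr k)"
  shows "(\<lambda>h. add_newborns (Suc k) (h ` S)) \<in>
    measurable (\<Pi>\<^sub>M X\<in>S. traj_step m k X) (subprob_algebra (finite_sets (Tr (Suc k))))"
  by (rule measurable_compose[OF finset_maps_measurable[OF step.move_image_measurable[OF S]] add_newborns_kernel])

lemma sets_advance:
  "S \<in> fin_subsets (Tr k) \<Longrightarrow> sets (advance k S) = sets (finite_sets (Tr (Suc k)))"
  unfolding advance_def
  by (rule sets_bind_measurable[OF advance_bind_measurable prob_space.not_empty[OF step.prob_space_PiM_kernel]])

lemma nn_integral_advance:
  assumes G: "G \<in> fin_meas (Tr (Suc k))" and S: "S \<in> fin_subsets (Tr k)"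
  shows "(\<integral>\<^sup>+A. G A \<partial>advance k S) = step.move k (\<lambda>A. \<integral>\<^sup>+A'. G A' \<partial>add_newborns (Suc k) A) S"
  unfolding advance_def nn_integral_bind[OF G advance_bind_measurable[OF S]] step.move_def ..

lemma add_newborns_int_measurable:
  assumes G: "G \<in> fin_meas (Tr k)"
  shows "(\<lambda>A. \<integral>\<^sup>+A'. G A' \<partial>add_newborns k A) \<in> fin_meas (Tr k)"
  by (rule measurable_compose[OF add_newborns_kernel nn_integral_measurable_subprob_algebra[OF G]])

lemma advance_kernel:
  "advance k \<in> measurable (finite_sets (Tr k)) (subprob_algebra (finite_sets (Tr (Suc k))))"
proof (rule measurable_subprob_algebra)
  fix S assume S: "S \<in> fin_subsets (Tr k)"
  show "sets (advance k S) = sets (finite_sets (Tr (Suc k)))" by (rule sets_advance[OF S])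
  interpret P: prob_space "\<Pi>\<^sub>M X\<in>S. traj_step m k X" by (rule step.prob_space_PiM_kernel[OF S])
  show "subprob_space (advance k S)"
    unfolding advance_def by (rule subprob_space_bind[OF P.subprob_space_axioms advance_bind_measurable[OF S]])
next
  fix E assume E: "E \<in> sets (finite_sets (Tr (Suc k)))"
  then have iE: "(\<lambda>S. indicator E S :: ennreal) \<in> fin_meas (Tr (Suc k))" by simp
  have eq: "emeasure (advance k S) E = step.move k (\<lambda>A. \<integral>\<^sup>+A'. indicator E A' \<partial>add_newborns (Suc k) A) S"
    if "S \<in> fin_subsets (Tr k)" for S
    using nn_integral_advance[OF iE that] sets_advance[OF that] E by simp
  show "(\<lambda>S. emeasure (advance k S) E) \<in> fin_meas (Tr k)"
    by (subst measurable_cong[OF eq]) (simp_all add: step.move_measurable[OF add_newborns_int_measurable[OF iE]])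
qed

text \<open>Displacement and superposition are alternated along time. The constant \<open>c\<close>
  is left open, because normalisation is later provided by the evidence; the finite mass of the
  intensity has to be carried along.\<close>

theorem all_trajs_poisson:
  "sets (all_trajs m k) = sets (finite_sets (Tr k)) \<and>
   (\<exists>g\<in>borel_measurable (Tr k). \<exists>c. (\<integral>\<^sup>+X. g X \<partial>Tr k) < \<infinity> \<and>
     (\<forall>G\<in>fin_meas (Tr k). (\<integral>\<^sup>+S. G S \<partial>all_trajs m k) = c * op_exp (ins_int (Tr k) g) G {}))"
proof (induction k)
  case 0
  have eq: "all_trajs m 0 = add_newborns 0 {}" by (simp add: add_newborns_def)
  obtain g where g: "g \<in> borel_measurable (Tr 0)" and mass: "(\<integral>\<^sup>+X. g X \<partial>Tr 0) = ennreal bmass"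
    and int: "\<forall>G\<in>fin_meas (Tr 0). \<forall>A\<in>fin_subsets (Tr 0).
      (\<integral>\<^sup>+S. G S \<partial>add_newborns 0 A) = ennreal (exp (- bmass)) * op_exp (ins_int (Tr 0) g) G A"
    using nn_integral_add_newborns[of 0] by blast
  show ?case
    unfolding eq
  proof (intro conjI bexI[OF _ g] exI ballI)
    show "(\<integral>\<^sup>+X. g X \<partial>Tr 0) < \<infinity>" by (simp add: mass)
    show "(\<integral>\<^sup>+S. G S \<partial>add_newborns 0 {}) = ennreal (exp (- bmass)) * op_exp (ins_int (Tr 0) g) G {}"
      if "G \<in> fin_meas (Tr 0)" for G
      using int[THEN bspec, THEN bspec, OF that empty_finite_sets] .
  qed (simp add: sets_add_newborns)
next
  case (Suc k)
  have sets: "sets (all_trajs m k) = sets (finite_sets (Tr k))" using Suc by (rule conjunct1)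
  obtain g c where g: "g \<in> borel_measurable (Tr k)" and gfin: "(\<integral>\<^sup>+X. g X \<partial>Tr k) < \<infinity>"
    and int: "\<forall>G\<in>fin_meas (Tr k). (\<integral>\<^sup>+S. G S \<partial>all_trajs m k) = c * op_exp (ins_int (Tr k) g) G {}"
    using conjunct2[OF Suc] by blast
  obtain g' where g': "g' \<in> borel_measurable (Tr (Suc k))"
    and mass': "(\<integral>\<^sup>+y. g' y \<partial>Tr (Suc k)) = (\<integral>\<^sup>+y. g y \<partial>Tr k)"
    and int': "\<forall>G\<in>fin_meas (Tr (Suc k)). op_exp (ins_int (Tr k) g) (step.move k G) {} = op_exp (ins_int (Tr (Suc k)) g') G {}"
    using step.op_exp_move[OF g] by blast
  obtain b where b: "b \<in> borel_measurable (Tr (Suc k))" and bmass: "(\<integral>\<^sup>+X. b X \<partial>Tr (Suc k)) = ennreal bmass"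
    and intb: "\<forall>G\<in>fin_meas (Tr (Suc k)). \<forall>A\<in>fin_subsets (Tr (Suc k)).
      (\<integral>\<^sup>+S. G S \<partial>add_newborns (Suc k) A) = ennreal (exp (- bmass)) * op_exp (ins_int (Tr (Suc k)) b) G A"
    using nn_integral_add_newborns[of "Suc k"] by blast
  have adv: "advance k \<in> measurable (all_trajs m k) (subprob_algebra (finite_sets (Tr (Suc k))))"
    using advance_kernel[of k] measurable_cong_sets[OF sets refl] by blast
  have space: "space (all_trajs m k) = fin_subsets (Tr k)" by (rule sets_eq_imp_space_eq[OF sets])
  have sets': "sets (all_trajs m (Suc k)) = sets (finite_sets (Tr (Suc k)))"
    unfolding all_trajs_Suc by (rule sets_bind_measurable[OF adv]) (auto simp: space space_finite_sets)
  have gb: "(\<lambda>X. g' X + b X) \<in> borel_measurable (Tr (Suc k))" using g' b by simp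
  have "(\<integral>\<^sup>+S. G S \<partial>all_trajs m (Suc k)) =
      c * ennreal (exp (- bmass)) * op_exp (ins_int (Tr (Suc k)) (\<lambda>X. g' X + b X)) G {}"
    if G: "G \<in> fin_meas (Tr (Suc k))" for G
  proof -
    let ?Q = "\<lambda>A. \<integral>\<^sup>+A'. G A' \<partial>add_newborns (Suc k) A"
    have Q: "?Q \<in> fin_meas (Tr (Suc k))" by (rule add_newborns_int_measurable[OF G])
    have "(\<integral>\<^sup>+S. G S \<partial>all_trajs m (Suc k)) = (\<integral>\<^sup>+S. \<integral>\<^sup>+A. G A \<partial>advance k S \<partial>all_trajs m k)"
      unfolding all_trajs_Suc by (rule nn_integral_bind[OF G adv])
    also have "\<dots> = (\<integral>\<^sup>+S. step.move k ?Q S \<partial>all_trajs m k)"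
      by (intro nn_integral_cong nn_integral_advance G) (simp add: space)
    also have "\<dots> = c * op_exp (ins_int (Tr k) g) (step.move k ?Q) {}"
      using int by (rule bspec) (rule step.move_measurable[OF Q])
    also have "op_exp (ins_int (Tr k) g) (step.move k ?Q) {} = op_exp (ins_int (Tr (Suc k)) g') ?Q {}"
      using int' Q by (rule bspec)
    also have "\<dots> = op_exp (ins_int (Tr (Suc k)) g') (\<lambda>A. ennreal (exp (- bmass)) * op_exp (ins_int (Tr (Suc k)) b) G A) {}"
      by (rule op_exp_cong[OF step.N.fin_op_ins_int[OF g'] empty_finite_sets]) (rule intb[THEN bspec, THEN bspec, OF G])
    also have "\<dots> = ennreal (exp (- bmass)) * op_exp (ins_int (Tr (Suc k)) g') (op_exp (ins_int (Tr (Suc k)) b) G) {}"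
      by (rule op_exp_cmult[OF step.N.fin_op_ins_int[OF g'] op_exp_measurable[OF step.N.fin_op_ins_int[OF b] G] empty_finite_sets])
    also have "op_exp (ins_int (Tr (Suc k)) g') (op_exp (ins_int (Tr (Suc k)) b) G) {} =
        op_exp (ins_int (Tr (Suc k)) (\<lambda>X. g' X + b X)) G {}"
      by (rule step.N.op_exp_ins_int_add[OF g' b G empty_finite_sets])
    finally show ?thesis by (simp add: mult.assoc)
  qed
  moreover have "(\<integral>\<^sup>+X. g' X + b X \<partial>Tr (Suc k)) < \<infinity>"
    using gfin by (simp add: nn_integral_add[OF g' b] mass' bmass)
  ultimately show ?case using sets' by (intro conjI bexI[OF _ gb] exI ballI)
qed

end

text \<open>The coordinates outside \<open>J\<close> are integrated out. Where the indicator of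
  \<open>E\<close> vanishes, the inner integral is 0 even if the remaining factor has infinite
  mass.\<close>

lemma (in product_sigma_finite) AE_PiM_restrict:
  assumes IJ: "J \<subseteq> I" "finite I" and E: "E \<in> null_sets (PiM J M)"
  shows "AE x in PiM I M. restrict x J \<notin> E"
proof -
  let ?K = "I - J"
  have J: "finite J" "J \<inter> ?K = {}" "J \<union> ?K = I" using IJ finite_subset by auto
  have Es: "E \<in> sets (PiM J M)" using E by auto
  have r: "(\<lambda>x. restrict x J) \<in> measurable (PiM I M) (PiM J M)" by (rule measurable_restrict_subset[OF IJ(1)])
  have iE: "(\<lambda>x. indicator E x :: ennreal) \<in> borel_measurable (PiM J M)" using Es by simp
  have im: "(\<lambda>x. indicator E (restrict x J) :: ennreal) \<in> borel_measurable (PiM I M)"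
    by (rule measurable_compose[OF r iE])
  have "(\<integral>\<^sup>+x. indicator E (restrict x J) \<partial>PiM (J \<union> ?K) M) =
      (\<integral>\<^sup>+x. \<integral>\<^sup>+y. indicator E (restrict (merge J ?K (x, y)) J) \<partial>PiM ?K M \<partial>PiM J M)"
    using im J IJ by (intro product_nn_integral_fold) auto
  also have "\<dots> = (\<integral>\<^sup>+x. \<integral>\<^sup>+y. indicator E x \<partial>PiM ?K M \<partial>PiM J M)"
  proof (intro nn_integral_cong)
    fix x y assume "x \<in> space (PiM J M)" "y \<in> space (PiM ?K M)"
    then have "restrict (merge J ?K (x, y)) J = x"
      by (intro ext) (auto simp: merge_def space_PiM PiE_def extensional_def)
    then show "indicator E (restrict (merge J ?K (x, y)) J) = (indicator E x :: ennreal)" by simp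
  qed
  also have "\<dots> = (\<integral>\<^sup>+x. 0 \<partial>PiM J M)"
    using AE_not_in[OF E] by (intro nn_integral_cong_AE, eventually_elim) simp
  finally have "(\<integral>\<^sup>+x. indicator E (restrict x J) \<partial>PiM I M) = 0" by (simp only: J(3) nn_integral_const mult_zero_left)
  from this[unfolded nn_integral_0_iff_AE[OF im]]
  show ?thesis by eventually_elim (simp add: indicator_def split: if_splits)
qed

section \<open>Measurement likelihoods and the posterior\<close>

context point_targets
begin

abbreviation "clut \<equiv> clutter_intensity m"
abbreviation "pd \<equiv> detection_prob m"
abbreviation "md \<equiv> meas_density m"
abbreviation "Zs \<equiv> meas_space m"

lemma meas_model_simps:
  "is_intensity Zs clut"
  "pd \<in> borel_measurable M" "\<And>x. x \<in> space M \<Longrightarrow> pd x \<in> {0..1}"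
  "(\<lambda>(x, z). md x z) \<in> borel_measurable (M \<Otimes>\<^sub>M Zs)"
  "\<And>x z. x \<in> space M \<Longrightarrow> z \<in> space Zs \<Longrightarrow> 0 \<le> md x z"
  using model by (simp_all add: point_target_model_def Let_def is_prob_density_def)

definition meas_lik :: "nat \<Rightarrow> 'z set \<Rightarrow> 'x traj set \<Rightarrow> ennreal" where
  "meas_lik k W S = set_conv (\<lambda>V. ennreal (ppp_density Zs clut V))
     (\<lambda>X V. ennreal (bernoulli_density (pd (state_at k X)) (md (state_at k X)) V)) {X \<in> S. alive k X} W"

text \<open>A target that is not alive takes the empty part with weight 1, so the insertion rule has
  one form for all targets.\<close>

definition target_lik :: "nat \<Rightarrow> 'z set \<Rightarrow> 'x traj \<Rightarrow> ennreal" where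
  "target_lik k V X = (if alive k X then ennreal (bernoulli_density (pd (state_at k X)) (md (state_at k X)) V)
     else if V = {} then 1 else 0)"

lemma meas_set_density_nonneg:
  assumes "S \<subseteq> space (Tr K)" "W \<subseteq> space Zs"
  shows "0 \<le> meas_set_density m k S W"
    and "ennreal (meas_set_density m k S W) = meas_lik k W S"
proof -
  have eq: "meas_set_density m k S W = set_conv (ppp_density Zs clut)
      (\<lambda>X V. bernoulli_density (pd (state_at k X)) (md (state_at k X)) V) {X \<in> S. alive k X} W"
    by (simp add: meas_set_density_def set_conv_def)
  have p: "0 \<le> ppp_density Zs clut B" if "B \<subseteq> W" for B
    using that assms(2) meas_model_simps(1) by (intro ppp_density_nonneg) (auto simp: is_intensity_def)
  have b: "0 \<le> bernoulli_density (pd (state_at k X)) (md (state_at k X)) B"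
    if "X \<in> {X \<in> S. alive k X}" "B \<subseteq> W" for X B
  proof -
    have "state_at k X \<in> space M" using that(1) assms(1) by (intro state_at_space[of X M 0 K]) auto
    then show ?thesis
      using that(2) assms(2) meas_model_simps(3,5) by (intro bernoulli_density_nonneg) auto
  qed
  show "0 \<le> meas_set_density m k S W" unfolding eq by (rule set_conv_nonneg[OF p b])
  show "ennreal (meas_set_density m k S W) = meas_lik k W S"
    unfolding eq meas_lik_def by (rule ennreal_set_conv[OF p b])
qed

lemma target_lik_measurable:
  assumes "V \<subseteq> space Zs"
  shows "target_lik k V \<in> borel_measurable (Tr K)"
proof -
  have "(\<lambda>x. ennreal (bernoulli_density (pd x) (md x) V)) \<in> borel_measurable M"
  proof (cases "is_singleton V")
    case True
    then obtain z where z: "V = {z}" by (auto simp: is_singleton_def)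
    have "(\<lambda>x. md x z) \<in> borel_measurable M"
      using measurable_Pair1[OF meas_model_simps(4), of z] assms z by simp
    then show ?thesis using meas_model_simps(2) by (simp add: z bernoulli_density_simps)
  next
    case False
    then show ?thesis
      using meas_model_simps(2) by (cases "V = {}") (simp_all add: bernoulli_density_def)
  qed
  from traj_function_measurable[OF this, of "if V = {} then 1 else 0"]
  show ?thesis by (simp add: target_lik_def[abs_def])
qed

text \<open>A new target that is alive adds an index to the convolution, whose part is the set of
  measurements it takes. Without targets only clutter is left, and its Poisson density is a product
  over the measurements.\<close>

lemma tilted_meas_lik:
  assumes W0: "finite W0" "W0 \<subseteq> space Zs"
  shows "tilted_measure (Tr K) (meas_lik k) (target_lik k) (\<lambda>z. ennreal (clut z)) W0"
proof (intro tilted_measure.intro tilted_measure_axioms.intro diffuse_Tr W0(1))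
  fix V assume "V \<subseteq> W0"
  then show "target_lik k V \<in> borel_measurable (Tr K)" using W0(2) by (intro target_lik_measurable) auto
next
  fix W X A assume W: "W \<subseteq> W0" and X: "X \<in> space (Tr K)" and A: "A \<in> fin_subsets (Tr K)" and XA: "X \<notin> A"
  have fin: "finite W" "finite {X \<in> A. alive k X}"
    using W W0(1) A by (auto simp: space_finite_sets intro: finite_subset)
  show "meas_lik k W (insert X A) = (\<Sum>V\<in>Pow W. target_lik k V X * meas_lik k (W - V) A)"
  proof (cases "alive k X")
    case True
    then have "{Y \<in> insert X A. alive k Y} = insert X {Y \<in> A. alive k Y}" by auto
    then show ?thesis
      unfolding meas_lik_def using XA fin True by (simp add: set_conv_insert target_lik_def)
  next
    case False
    then have eq: "{Y \<in> insert X A. alive k Y} = {Y \<in> A. alive k Y}" by auto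
    have "(\<Sum>V\<in>Pow W. target_lik k V X * meas_lik k (W - V) A) =
        (\<Sum>V\<in>{{}}. target_lik k V X * meas_lik k (W - V) A)"
      using fin False by (intro sum.mono_neutral_right) (auto simp: target_lik_def)
    also have "\<dots> = meas_lik k W A" using False by (simp add: target_lik_def)
    also have "\<dots> = meas_lik k W (insert X A)" by (simp only: meas_lik_def eq)
    finally show ?thesis by (rule sym)
  qed
next
  fix W w assume W: "W \<subseteq> W0" "w \<in> W"
  have "finite W" using W W0 finite_subset by blast
  then have "(\<Prod>z\<in>W. clut z) = clut w * (\<Prod>z\<in>W - {w}. clut z)" using W(2) by (rule prod.remove)
  moreover have "0 \<le> clut w" using W W0 meas_model_simps(1) by (auto simp: is_intensity_def)
  ultimately show "meas_lik k W {} = ennreal (clut w) * meas_lik k (W - {w}) {}"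
    by (simp add: meas_lik_def set_conv_empty ppp_density_def ennreal_mult'[symmetric] ac_simps)
qed

lemma target_lik_empty_le_1: "X \<in> space (Tr K) \<Longrightarrow> target_lik k {} X \<le> 1"
  using meas_model_simps(3)[OF state_at_space[of X M 0 K k]]
  by (auto simp: target_lik_def bernoulli_density_simps)

text \<open>Given the trajectories, the measurement sets at different times are independent, so the
  mixture is tilted once for each time. Each tilt multiplies the Poisson intensity by the weight of
  a target that yields no measurement at that time.\<close>

lemma pmb_mixture_likelihood:
  assumes g: "g \<in> borel_measurable (Tr K)" and J: "finite J"
    and Z: "\<And>k. k \<in> J \<Longrightarrow> finite (Z k) \<and> Z k \<subseteq> space Zs"
  shows "(\<lambda>X. g X * (\<Prod>k\<in>J. target_lik k {} X)) \<in> borel_measurable (Tr K)"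
    and "(\<lambda>S. \<Prod>k\<in>J. meas_lik k (Z k) S) \<in> fin_meas (Tr K)"
    and "pmb_mixture (Tr K) (\<lambda>X. g X * (\<Prod>k\<in>J. target_lik k {} X))
      (\<lambda>G. op_exp (ins_int (Tr K) g) (\<lambda>S. (\<Prod>k\<in>J. meas_lik k (Z k) S) * G S) {})"
proof -
  show gm: "(\<lambda>X. g X * (\<Prod>k\<in>J. target_lik k {} X)) \<in> borel_measurable (Tr K)" for J
    by (intro borel_measurable_times_ennreal borel_measurable_prod_ennreal g target_lik_measurable) simp
  have lm: "meas_lik k (Z k) \<in> fin_meas (Tr K)" if "k \<in> J" for k
    using tilted_measure.L_measurable[OF tilted_meas_lik, of "Z k"] Z[OF that] by blast
  then show "(\<lambda>S. \<Prod>k\<in>J. meas_lik k (Z k) S) \<in> fin_meas (Tr K)"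
    by (intro borel_measurable_prod_ennreal)
  show "pmb_mixture (Tr K) (\<lambda>X. g X * (\<Prod>k\<in>J. target_lik k {} X))
      (\<lambda>G. op_exp (ins_int (Tr K) g) (\<lambda>S. (\<Prod>k\<in>J. meas_lik k (Z k) S) * G S) {})"
    using J Z
  proof (induction J)
    case empty
    show ?case using pmb_mixture_single[of "[]" "Tr K" g] by simp
  next
    case (insert k J)
    have Zk: "finite (Z k)" "Z k \<subseteq> space Zs" using insert.prems by auto
    interpret tilted_measure "Tr K" "meas_lik k" "target_lik k" "\<lambda>z. ennreal (clut z)" "Z k"
      by (rule tilted_meas_lik[OF Zk])
    have "pmb_mixture (Tr K) (\<lambda>X. g X * (\<Prod>k\<in>J. target_lik k {} X))
        (\<lambda>G. op_exp (ins_int (Tr K) g) (\<lambda>S. (\<Prod>k\<in>J. meas_lik k (Z k) S) * G S) {})"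
      by (rule insert.IH) (use insert.prems in auto)
    from pmb_mixture_tilt[OF this gm order_refl]
    show ?case using insert.hyps by (simp add: ac_simps)
  qed
qed

lemma likelihood_eq:
  assumes "S \<in> fin_subsets (Tr K)" "\<And>k. k \<in> {\<xi>..\<eta>} \<Longrightarrow> Z k \<subseteq> space Zs"
  shows "likelihood m \<xi> \<eta> Z S = (\<Prod>k\<in>{\<xi>..\<eta>}. meas_lik k (Z k) S)"
proof -
  have S: "S \<subseteq> space (Tr K)" using assms(1) by (simp add: space_finite_sets)
  have "likelihood m \<xi> \<eta> Z S = (\<Prod>k\<in>{\<xi>..\<eta>}. ennreal (meas_set_density m k S (Z k)))"
    unfolding likelihood_def by (rule prod_ennreal[symmetric]) (rule meas_set_density_nonneg(1)[OF S assms(2)])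
  also have "\<dots> = (\<Prod>k\<in>{\<xi>..\<eta>}. meas_lik k (Z k) S)"
    by (intro prod.cong refl meas_set_density_nonneg(2)[OF S assms(2)])
  finally show ?thesis .
qed

text \<open>Bayes' rule tilts the Poisson law of all trajectories; the quotient of \<open>c\<close>
  and the evidence is absorbed into the weights. The new intensity has finite mass because the
  weights \<open>target_lik k {} X\<close> are at most 1.\<close>

lemma posterior_mixture:
  assumes Z: "\<And>k. k \<in> {\<xi>..\<eta>} \<Longrightarrow> finite (Z k) \<and> Z k \<subseteq> space Zs"
    and ev: "0 < evidence m K \<xi> \<eta> Z" "evidence m K \<xi> \<eta> Z < \<infinity>"
  shows "sets (posterior m K \<xi> \<eta> Z) = sets (finite_sets (Tr K))"
    and "(\<integral>\<^sup>+S. 1 \<partial>posterior m K \<xi> \<eta> Z) = 1"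
    and "\<exists>g\<in>borel_measurable (Tr K). (\<integral>\<^sup>+X. g X \<partial>Tr K) < \<infinity> \<and>
      pmb_mixture (Tr K) g (\<lambda>G. \<integral>\<^sup>+S. G S \<partial>posterior m K \<xi> \<eta> Z)"
proof -
  let ?e = "evidence m K \<xi> \<eta> Z" and ?L = "likelihood m \<xi> \<eta> Z" and ?J = "{\<xi>..\<eta>}"
  let ?l = "\<lambda>S. \<Prod>k\<in>?J. meas_lik k (Z k) S"
  note poisson = all_trajs_poisson[of K]
  have sets: "sets (all_trajs m K) = sets (finite_sets (Tr K))" using poisson by (rule conjunct1)
  have space: "space (all_trajs m K) = fin_subsets (Tr K)" by (rule sets_eq_imp_space_eq[OF sets])
  have meas: "borel_measurable (all_trajs m K) = fin_meas (Tr K)" by (rule measurable_cong_sets[OF sets refl])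
  obtain g c where g: "g \<in> borel_measurable (Tr K)" and gfin: "(\<integral>\<^sup>+X. g X \<partial>Tr K) < \<infinity>"
    and int: "\<forall>G\<in>fin_meas (Tr K). (\<integral>\<^sup>+S. G S \<partial>all_trajs m K) = c * op_exp (ins_int (Tr K) g) G {}"
    using conjunct2[OF poisson] by blast
  have Zs': "Z k \<subseteq> space Zs" if "k \<in> ?J" for k using Z[OF that] by simp
  have L: "?L S = ?l S" if "S \<in> fin_subsets (Tr K)" for S
    by (rule likelihood_eq[OF that Zs'])
  note mix = pmb_mixture_likelihood[where J = ?J and Z = Z, OF g _ Z]
  have lm: "?l \<in> fin_meas (Tr K)" by (rule mix(2)) simp_all
  have Lm: "?L \<in> fin_meas (Tr K)" by (subst measurable_cong[OF L]) (simp_all add: lm)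
  have Lem: "(\<lambda>S. ?L S / ?e) \<in> borel_measurable (all_trajs m K)"
    unfolding meas using Lm by simp
  show "sets (posterior m K \<xi> \<eta> Z) = sets (finite_sets (Tr K))"
    by (simp add: posterior_def sets)
  have post: "(\<integral>\<^sup>+S. G S \<partial>posterior m K \<xi> \<eta> Z) = (\<integral>\<^sup>+S. ?L S / ?e * G S \<partial>all_trajs m K)"
    if "G \<in> fin_meas (Tr K)" for G
    unfolding posterior_def by (rule nn_integral_density[OF Lem]) (simp add: meas that)
  have "(\<integral>\<^sup>+S. ?L S / ?e \<partial>all_trajs m K) = ?e / ?e"
    unfolding evidence_def by (rule nn_integral_divide) (simp add: meas Lm)
  also have "\<dots> = 1" using ev by (intro ennreal_divide_self) auto
  finally show "(\<integral>\<^sup>+S. 1 \<partial>posterior m K \<xi> \<eta> Z) = 1"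
    using post[of "\<lambda>_. 1"] by simp
  let ?g = "\<lambda>X. g X * (\<Prod>k\<in>?J. target_lik k {} X)"
  have "pmb_mixture (Tr K) ?g (\<lambda>G. (c / ?e) * op_exp (ins_int (Tr K) g) (\<lambda>S. ?l S * G S) {})"
    by (rule pmb_mixture_cmult[OF mix(3)]) simp_all
  then have "pmb_mixture (Tr K) ?g (\<lambda>G. \<integral>\<^sup>+S. G S \<partial>posterior m K \<xi> \<eta> Z)"
  proof (rule pmb_mixture_cong)
    fix G assume G: "G \<in> fin_meas (Tr K)"
    have lG: "(\<lambda>S. ?l S * G S) \<in> fin_meas (Tr K)" by (rule borel_measurable_times_ennreal[OF lm G])
    have "(\<integral>\<^sup>+S. G S \<partial>posterior m K \<xi> \<eta> Z) = (\<integral>\<^sup>+S. ?l S * G S / ?e \<partial>all_trajs m K)"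
      unfolding post[OF G] by (intro nn_integral_cong) (simp add: space L ennreal_divide_times ennreal_times_divide)
    also have "\<dots> = (\<integral>\<^sup>+S. ?l S * G S \<partial>all_trajs m K) / ?e"
      by (rule nn_integral_divide) (simp only: meas lG)
    also have "\<dots> = (c / ?e) * op_exp (ins_int (Tr K) g) (\<lambda>S. ?l S * G S) {}"
      unfolding bspec[OF int lG] by (simp add: ennreal_divide_times ennreal_times_divide)
    finally show "(\<integral>\<^sup>+S. G S \<partial>posterior m K \<xi> \<eta> Z) = \<dots>" .
  qed
  moreover have "(\<integral>\<^sup>+X. ?g X \<partial>Tr K) \<le> (\<integral>\<^sup>+X. g X \<partial>Tr K)"
  proof (rule nn_integral_mono)
    fix X assume X: "X \<in> space (Tr K)"
    have "(\<Prod>k\<in>?J. target_lik k {} X) \<le> 1"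
      by (rule prod_le_1) (simp add: target_lik_empty_le_1[OF X])
    then show "?g X \<le> g X" using mult_left_mono[of _ 1 "g X"] by simp
  qed
  moreover have "?g \<in> borel_measurable (Tr K)" by (rule mix(1)) simp_all
  ultimately show "\<exists>g\<in>borel_measurable (Tr K). (\<integral>\<^sup>+X. g X \<partial>Tr K) < \<infinity> \<and>
      pmb_mixture (Tr K) g (\<lambda>G. \<integral>\<^sup>+S. G S \<partial>posterior m K \<xi> \<eta> Z)"
    using gfin by (intro bexI[of _ ?g] conjI) (auto intro: le_less_trans)
qed

section \<open>Restriction to an interval and the constraints\<close>

lemma alive_traj_restrict:
  "k \<in> {\<alpha>..\<gamma>} \<Longrightarrow> alive k (traj_restrict \<alpha> \<gamma> X) = alive k X"
  by (cases X) (auto simp: alive_def traj_restrict_def)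

lemma state_at_traj_restrict:
  "k \<in> {\<alpha>..\<gamma>} \<Longrightarrow> alive k X \<Longrightarrow> state_at k (traj_restrict \<alpha> \<gamma> X) = state_at k X"
  by (cases X) (auto simp: alive_def state_at_def traj_restrict_def)

lemma sets_state_in:
  assumes "C \<in> sets M"
  shows "{X \<in> space (traj_space M \<alpha> \<gamma>). alive k X \<and> state_at k X \<in> C} \<in> sets (traj_space M \<alpha> \<gamma>)"
proof -
  have "(\<lambda>x. x \<in> C) \<in> measurable M (count_space UNIV)" using assms by simp
  from traj_function_measurable[OF this, of False k \<alpha> \<gamma>]
  have "(\<lambda>X. if alive k X then state_at k X \<in> C else False) -` {True} \<inter> space (traj_space M \<alpha> \<gamma>)
      \<in> sets (traj_space M \<alpha> \<gamma>)" by (intro measurable_sets) auto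
  moreover have "(\<lambda>X. if alive k X then state_at k X \<in> C else False) -` {True} \<inter> space (traj_space M \<alpha> \<gamma>) =
      {X \<in> space (traj_space M \<alpha> \<gamma>). alive k X \<and> state_at k X \<in> C}" by auto
  ultimately show ?thesis by simp
qed

context
  fixes I :: "'i set" and t :: "'i \<Rightarrow> nat" and C :: "'i \<Rightarrow> 'x set" and \<alpha> \<gamma> K :: nat and sat :: "'x traj \<Rightarrow> bool"
  assumes finI: "finite I" and tC: "\<And>i. i \<in> I \<Longrightarrow> t i \<in> {\<alpha>..\<gamma>} \<and> C i \<in> sets M"
    and sat: "sat = satisfies_conjunct I t C \<or> sat = satisfies_disjunct I t C"
    and \<alpha>\<gamma>: "\<alpha> \<le> \<gamma>" and \<gamma>K: "\<gamma> \<le> K"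
begin

text \<open>A common form of the two interpretations, whose first conjunct alone supplies a time at
  which the trajectory is alive.\<close>

lemma sat_iff:
  "sat X \<longleftrightarrow> (\<exists>i\<in>I. alive (t i) X) \<and> (if sat = satisfies_conjunct I t C
    then \<forall>i\<in>I. alive (t i) X \<longrightarrow> state_at (t i) X \<in> C i
    else \<exists>i\<in>I. alive (t i) X \<and> state_at (t i) X \<in> C i)"
  using sat by (cases "sat = satisfies_conjunct I t C") (auto simp: satisfies_conjunct_def satisfies_disjunct_def)

text \<open>Both interpretations demand a constraint time at which \<open>X\<close> is alive, and
  all these times lie in the interval. A selected trajectory hence has a nonempty
  restriction.\<close>

lemma sat_alive: "sat X \<Longrightarrow> \<exists>k\<in>{\<alpha>..\<gamma>}. alive k X"
  using sat_iff[of X] tC by blast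

text \<open>Constraints look only at times in the interval, where restriction changes nothing. They
  may therefore be tested before restricting, which makes the selection a thinning of the full
  trajectories.\<close>

lemma sat_traj_restrict: "sat (traj_restrict \<alpha> \<gamma> X) = sat X"
proof -
  have a: "alive (t i) (traj_restrict \<alpha> \<gamma> X) = alive (t i) X" if "i \<in> I" for i
    by (rule alive_traj_restrict) (use tC[OF that] in simp)
  have s: "state_at (t i) (traj_restrict \<alpha> \<gamma> X) = state_at (t i) X" if "i \<in> I" "alive (t i) X" for i
    by (rule state_at_traj_restrict) (use tC[OF that(1)] that(2) in simp_all)
  show ?thesis unfolding sat_iff[of X] sat_iff[of "traj_restrict \<alpha> \<gamma> X"] using a s by (simp cong: ball_cong bex_cong conj_cong imp_cong)
qed

definition sat_set :: "'x traj set" where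
  "sat_set = {X \<in> space (Tr K). sat X}"

lemma sat_set_measurable: "sat_set \<in> sets (Tr K)"
proof -
  let ?T = "Tr K"
  have ex: "{X \<in> space ?T. \<exists>i\<in>I. alive (t i) X} \<in> sets ?T"
    by (intro sets.sets_Collect_finite_Ex finI sets_alive)
  have st: "{X \<in> space ?T. alive (t i) X \<and> state_at (t i) X \<in> C i} \<in> sets ?T" if "i \<in> I" for i
    by (rule sets_state_in) (use tC[OF that] in simp)
  have imp: "{X \<in> space ?T. alive (t i) X \<longrightarrow> state_at (t i) X \<in> C i} \<in> sets ?T" if "i \<in> I" for i
  proof -
    have "{X \<in> space ?T. alive (t i) X \<longrightarrow> state_at (t i) X \<in> C i} =
        (space ?T - {X \<in> space ?T. alive (t i) X}) \<union> {X \<in> space ?T. alive (t i) X \<and> state_at (t i) X \<in> C i}"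
      by auto
    then show ?thesis using st[OF that] sets_alive[of M 0 K "t i"] by simp
  qed
  show ?thesis
  proof (cases "sat = satisfies_conjunct I t C")
    case True
    have "sat_set = {X \<in> space ?T. \<exists>i\<in>I. alive (t i) X} \<inter>
        {X \<in> space ?T. \<forall>i\<in>I. alive (t i) X \<longrightarrow> state_at (t i) X \<in> C i}"
      unfolding sat_set_def using True sat_iff by auto
    moreover have "{X \<in> space ?T. \<forall>i\<in>I. alive (t i) X \<longrightarrow> state_at (t i) X \<in> C i} \<in> sets ?T"
      by (intro sets.sets_Collect_finite_All finI imp)
    ultimately show ?thesis using ex by simp
  next
    case False
    have "sat_set = {X \<in> space ?T. \<exists>i\<in>I. alive (t i) X} \<inter>
        {X \<in> space ?T. \<exists>i\<in>I. alive (t i) X \<and> state_at (t i) X \<in> C i}"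
      unfolding sat_set_def using False sat_iff by auto
    moreover have "{X \<in> space ?T. \<exists>i\<in>I. alive (t i) X \<and> state_at (t i) X \<in> C i} \<in> sets ?T"
      by (intro sets.sets_Collect_finite_Ex finI st)
    ultimately show ?thesis using ex by simp
  qed
qed

lemma sat_set_restrict_space:
  assumes "X \<in> sat_set"
  shows "traj_restrict \<alpha> \<gamma> X \<in> space (traj_space M \<alpha> \<gamma>)"
proof -
  obtain \<beta> \<epsilon> x where X: "X = (\<beta>, \<epsilon>, x)" by (cases X)
  obtain k where "k \<in> {\<alpha>..\<gamma>}" "alive k X" using assms sat_alive[of X] by (auto simp: sat_set_def)
  then show ?thesis
    using assms by (auto simp: X alive_def sat_set_def space_traj_space traj_restrict_def)
qed

lemma traj_restrict_component:
  fixes \<beta> \<epsilon> :: nat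
  shows "(\<lambda>x. (\<beta>, \<epsilon>, x)) -` {X \<in> sat_set. traj_restrict \<alpha> \<gamma> X \<in> A} \<inter> space (\<Pi>\<^sub>M j\<in>{\<beta>..\<epsilon>}. M) \<subseteq>
    {x \<in> space (\<Pi>\<^sub>M j\<in>{\<beta>..\<epsilon>}. M). max \<alpha> \<beta> \<le> min \<gamma> \<epsilon> \<and>
      (max \<alpha> \<beta>, min \<gamma> \<epsilon>, restrict x {max \<alpha> \<beta>..min \<gamma> \<epsilon>}) \<in> A}"
proof
  fix x assume x: "x \<in> (\<lambda>x. (\<beta>, \<epsilon>, x)) -` {X \<in> sat_set. traj_restrict \<alpha> \<gamma> X \<in> A} \<inter> space (\<Pi>\<^sub>M j\<in>{\<beta>..\<epsilon>}. M)"
  then obtain k where "k \<in> {\<alpha>..\<gamma>}" "alive k (\<beta>, \<epsilon>, x)"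
    using sat_alive[of "(\<beta>, \<epsilon>, x)"] by (auto simp: sat_set_def)
  then show "x \<in> {x \<in> space (\<Pi>\<^sub>M j\<in>{\<beta>..\<epsilon>}. M). max \<alpha> \<beta> \<le> min \<gamma> \<epsilon> \<and>
      (max \<alpha> \<beta>, min \<gamma> \<epsilon>, restrict x {max \<alpha> \<beta>..min \<gamma> \<epsilon>}) \<in> A}"
    using x by (auto simp: alive_def traj_restrict_def)
qed

lemma sets_traj_restrict_vimage:
  assumes A: "A \<in> sets (traj_space M \<alpha> \<gamma>)"
  shows "{X \<in> sat_set. traj_restrict \<alpha> \<gamma> X \<in> A} \<in> sets (Tr K)"
proof -
  \<comment> \<open>The condition on the endpoints replaces \<open>sat\<close>, so that on each
    component \<open>B\<close> is empty or the preimage of \<open>A\<close> under a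
    projection.\<close>
  define B where "B = {X \<in> space (Tr K). (\<lambda>(\<beta>, \<epsilon>, x). max \<alpha> \<beta> \<le> min \<gamma> \<epsilon>) X \<and> traj_restrict \<alpha> \<gamma> X \<in> A}"
  have "B \<in> sets (Tr K)"
  proof (rule sets_traj_spaceI)
    fix \<beta> \<epsilon> assume b: "(0::nat) \<le> \<beta>" "\<beta> \<le> \<epsilon>" "\<epsilon> \<le> K"
    let ?P = "\<Pi>\<^sub>M j\<in>{\<beta>..\<epsilon>}. M" and ?J = "{max \<alpha> \<beta>..min \<gamma> \<epsilon>}"
    show "(\<lambda>x. (\<beta>, \<epsilon>, x)) -` B \<inter> space ?P \<in> sets ?P"
    proof (cases "max \<alpha> \<beta> \<le> min \<gamma> \<epsilon>")
      case True
      have "(\<lambda>x. restrict x ?J) \<in> measurable ?P (\<Pi>\<^sub>M j\<in>?J. M)" by (rule measurable_restrict_subset) auto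
      from measurable_compose[OF this measurable_traj_Pair[of \<alpha> "max \<alpha> \<beta>" "min \<gamma> \<epsilon>" \<gamma>]] True
      have "(\<lambda>x. (max \<alpha> \<beta>, min \<gamma> \<epsilon>, restrict x ?J)) \<in> measurable ?P (traj_space M \<alpha> \<gamma>)" by simp
      from measurable_sets[OF this A]
      have "(\<lambda>x. (max \<alpha> \<beta>, min \<gamma> \<epsilon>, restrict x ?J)) -` A \<inter> space ?P \<in> sets ?P" .
      also have "(\<lambda>x. (max \<alpha> \<beta>, min \<gamma> \<epsilon>, restrict x ?J)) -` A \<inter> space ?P = (\<lambda>x. (\<beta>, \<epsilon>, x)) -` B \<inter> space ?P"
        using True b by (auto simp: B_def traj_restrict_def space_traj_space space_PiM)
      finally show ?thesis .
    next
      case False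
      then have "(\<lambda>x. (\<beta>, \<epsilon>, x)) -` B \<inter> space ?P = {}" by (auto simp: B_def)
      then show ?thesis by simp
    qed
  qed (auto simp: B_def)
  moreover have "{X \<in> sat_set. traj_restrict \<alpha> \<gamma> X \<in> A} = sat_set \<inter> B"
  proof -
    have "(\<lambda>(\<beta>, \<epsilon>, x). max \<alpha> \<beta> \<le> min \<gamma> \<epsilon>) X" if X: "X \<in> sat_set" for X
    proof -
      obtain k where "k \<in> {\<alpha>..\<gamma>}" "alive k X" using X sat_alive[of X] by (auto simp: sat_set_def)
      then show ?thesis by (cases X) (auto simp: alive_def)
    qed
    then show ?thesis by (auto simp: B_def sat_set_def)
  qed
  ultimately show ?thesis using sat_set_measurable by simp
qed

text \<open>On each component the restriction is a projection of product spaces, and preimages of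
  null sets under projections are null.\<close>

lemma traj_restrict_nonsingular:
  assumes A: "A \<in> null_sets (traj_space M \<alpha> \<gamma>)"
  shows "{X \<in> sat_set. traj_restrict \<alpha> \<gamma> X \<in> A} \<in> null_sets (Tr K)"
proof -
  interpret P: product_sigma_finite "\<lambda>_::nat. M" ..
  have As: "A \<in> sets (traj_space M \<alpha> \<gamma>)" using A by auto
  let ?B = "{X \<in> sat_set. traj_restrict \<alpha> \<gamma> X \<in> A}"
  have Bs: "?B \<in> sets (Tr K)" by (rule sets_traj_restrict_vimage[OF As])
  have "AE x in (\<Pi>\<^sub>M j\<in>{\<beta>..\<epsilon>}. M). (\<beta>, \<epsilon>, x) \<notin> ?B" if b: "0 \<le> \<beta>" "\<beta> \<le> \<epsilon>" "\<epsilon> \<le> K" for \<beta> \<epsilon>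
  proof (cases "max \<alpha> \<beta> \<le> min \<gamma> \<epsilon>")
    case True
    let ?a = "max \<alpha> \<beta>" and ?b = "min \<gamma> \<epsilon>"
    let ?P = "\<Pi>\<^sub>M j\<in>{?a..?b}. M"
    define E where "E = (\<lambda>x. (?a, ?b, x)) -` A \<inter> space ?P"
    have ab: "\<alpha> \<le> ?a" "?a \<le> ?b" "?b \<le> \<gamma>" using True by auto
    have "AE x in ?P. (?a, ?b, x) \<notin> A"
      using A[unfolded null_sets_traj_space_iff[OF As]] ab by blast
    then have "AE x in ?P. x \<notin> E" by eventually_elim (simp add: E_def)
    then have "E \<in> null_sets ?P"
      using AE_iff_null_sets[OF measurable_sets[OF measurable_traj_Pair[OF ab] As]] unfolding E_def by blast
    then have "AE x in (\<Pi>\<^sub>M j\<in>{\<beta>..\<epsilon>}. M). restrict x {?a..?b} \<notin> E"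
      by (intro P.AE_PiM_restrict) auto
    then show ?thesis
      using AE_space
    proof eventually_elim
      fix x assume x: "restrict x {?a..?b} \<notin> E" "x \<in> space (\<Pi>\<^sub>M j\<in>{\<beta>..\<epsilon>}. M)"
      then have "restrict x {?a..?b} \<in> space ?P" by (auto simp: space_PiM)
      then have "(?a, ?b, restrict x {?a..?b}) \<notin> A" using x(1) by (auto simp: E_def)
      then show "(\<beta>, \<epsilon>, x) \<notin> ?B" by (simp add: traj_restrict_def)
    qed
  next
    case False
    have "(\<beta>, \<epsilon>, x) \<notin> ?B" if "x \<in> space (\<Pi>\<^sub>M j\<in>{\<beta>..\<epsilon>}. M)" for x
      using traj_restrict_component[of \<beta> \<epsilon> A] False that by blast
    then show ?thesis by (intro AE_I2)
  qed
  then show ?thesis unfolding null_sets_traj_space_iff[OF Bs] by blast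
qed

lemma thinned_image_traj_restrict:
  "thinned_image (Tr K) (traj_space M \<alpha> \<gamma>) sat_set (traj_restrict \<alpha> \<gamma>)"
proof -
  have meas: "traj_restrict \<alpha> \<gamma> \<in> measurable (restrict_space (Tr K) sat_set) (traj_space M \<alpha> \<gamma>)"
  proof (rule measurableI)
    fix X assume "X \<in> space (restrict_space (Tr K) sat_set)"
    then show "traj_restrict \<alpha> \<gamma> X \<in> space (traj_space M \<alpha> \<gamma>)"
      by (intro sat_set_restrict_space) (simp add: space_restrict_space)
  next
    fix A assume A: "A \<in> sets (traj_space M \<alpha> \<gamma>)"
    have "traj_restrict \<alpha> \<gamma> -` A \<inter> space (restrict_space (Tr K) sat_set) = {X \<in> sat_set. traj_restrict \<alpha> \<gamma> X \<in> A}"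
      by (auto simp: space_restrict_space sat_set_def)
    then show "traj_restrict \<alpha> \<gamma> -` A \<inter> space (restrict_space (Tr K) sat_set) \<in> sets (restrict_space (Tr K) sat_set)"
      using sets_traj_restrict_vimage[OF A] sat_set_measurable by (simp add: sets_restrict_space_iff)
  qed
  show ?thesis
    by (intro thinned_image.intro thinned_image_axioms.intro M.sigma_finite_traj_space sat_set_measurable meas
        traj_restrict_nonsingular)
qed

lemma sat_trajs_eq_image:
  assumes "S \<in> fin_subsets (Tr K)"
  shows "{X \<in> trajs_in \<alpha> \<gamma> S. sat X} = traj_restrict \<alpha> \<gamma> ` (S \<inter> sat_set)"
proof -
  have "{X \<in> trajs_in \<alpha> \<gamma> S. sat X} = traj_restrict \<alpha> \<gamma> ` {X \<in> S. sat X}"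
    using sat_alive by (auto simp: trajs_in_def sat_traj_restrict)
  also have "{X \<in> S. sat X} = S \<inter> sat_set" using assms by (auto simp: sat_set_def space_finite_sets)
  finally show ?thesis .
qed

text \<open>The posterior mixture is pushed through restriction and thinning, and the resulting
  expectation functional is represented by a PMBM density. Its mass is one because the posterior is
  normalised.\<close>

theorem posterior_sat_trajs_pmbm:
  assumes Z: "\<And>k. k \<in> {\<xi>..\<eta>} \<Longrightarrow> finite (Z k) \<and> Z k \<subseteq> space Zs"
    and ev: "0 < evidence m K \<xi> \<eta> Z" "evidence m K \<xi> \<eta> Z < \<infinity>"
  shows "\<exists>f. pmbm_density (traj_space M \<alpha> \<gamma>) f \<and>
    distributed (posterior m K \<xi> \<eta> Z) (finite_sets (traj_space M \<alpha> \<gamma>))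
      (\<lambda>S. {X \<in> trajs_in \<alpha> \<gamma> S. sat X}) (\<lambda>A. ennreal (f A))"
proof -
  let ?N = "traj_space M \<alpha> \<gamma>" and ?post = "posterior m K \<xi> \<eta> Z"
  let ?F = "\<lambda>S. {X \<in> trajs_in \<alpha> \<gamma> S. sat X}"
  interpret N: diffuse_measure ?N by (rule M.diffuse_traj_space)
  interpret im: thinned_image "Tr K" ?N sat_set "traj_restrict \<alpha> \<gamma>" by (rule thinned_image_traj_restrict)
  note post = posterior_mixture[OF Z ev]
  have sp: "space ?post = fin_subsets (Tr K)" by (rule sets_eq_imp_space_eq[OF post(1)])
  have F_im: "?F S = im.im S" if "S \<in> fin_subsets (Tr K)" for S
    unfolding im.im_def by (rule sat_trajs_eq_image[OF that])
  have Fm: "?F \<in> measurable ?post (finite_sets ?N)"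
  proof -
    have "?F \<in> measurable (finite_sets (Tr K)) (finite_sets ?N)"
      by (subst measurable_cong[OF F_im]) (simp_all add: im.im_measurable)
    then show ?thesis using measurable_cong_sets[OF post(1) refl] by blast
  qed
  define \<Psi> where "\<Psi> G = (\<integral>\<^sup>+S. G (im.im S) \<partial>?post)" for G
  have em: "emeasure (distr ?post (finite_sets ?N) ?F) A = \<Psi> (indicator A)" if A: "A \<in> sets (finite_sets ?N)" for A
  proof -
    have "emeasure (distr ?post (finite_sets ?N) ?F) A = (\<integral>\<^sup>+B. indicator A B \<partial>distr ?post (finite_sets ?N) ?F)"
      using A by simp
    also have "\<dots> = (\<integral>\<^sup>+S. indicator A (?F S) \<partial>?post)"
      by (rule nn_integral_distr[OF Fm]) (use A in simp)
    also have "\<dots> = \<Psi> (indicator A)"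
      unfolding \<Psi>_def by (intro nn_integral_cong) (simp add: sp F_im)
    finally show ?thesis .
  qed
  \<comment> \<open>Indicator functionals determine the law, so agreement of all expectations with
    the integrals against \<open>f\<close> suffices.\<close>
  have goal: ?thesis if f: "pmbm_density ?N f" "(\<lambda>A. ennreal (f A)) \<in> fin_meas ?N"
    "\<And>G. G \<in> fin_meas ?N \<Longrightarrow> \<Psi> G = (\<integral>\<^sup>+A. ennreal (f A) * G A \<partial>finite_sets ?N)" for f
  proof (intro exI[of _ f] conjI f(1))
    have "distr ?post (finite_sets ?N) ?F = density (finite_sets ?N) (\<lambda>A. ennreal (f A))"
    proof (rule measure_eqI)
      fix A assume "A \<in> sets (distr ?post (finite_sets ?N) ?F)"
      then have A: "A \<in> sets (finite_sets ?N)" by simp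
      show "emeasure (distr ?post (finite_sets ?N) ?F) A = emeasure (density (finite_sets ?N) (\<lambda>A. ennreal (f A))) A"
        unfolding em[OF A] emeasure_density[OF f(2) A] by (rule f(3)) (use A in simp)
    qed simp
    then show "distributed ?post (finite_sets ?N) ?F (\<lambda>A. ennreal (f A))"
      unfolding distributed_def using f(2) Fm by simp
  qed
  show ?thesis
  proof (cases "space M = {}")
    case False
    obtain p0 where p0: "is_prob_density ?N p0" using ex_prob_density_traj_space[OF \<alpha>\<gamma> False] by blast
    obtain g where g: "g \<in> borel_measurable (Tr K)" "(\<integral>\<^sup>+X. g X \<partial>Tr K) < \<infinity>"
      "pmb_mixture (Tr K) g (\<lambda>G. \<integral>\<^sup>+S. G S \<partial>?post)"
      using post(3) by blast
    obtain g' hs where g': "g' \<in> borel_measurable ?N" "(\<integral>\<^sup>+X. g' X \<partial>?N) < \<infinity>"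
      "\<forall>(c, bs)\<in>set hs. \<forall>(b, h)\<in>set bs. h \<in> borel_measurable ?N"
      "\<forall>G\<in>fin_meas ?N. \<Psi> G = (\<Sum>(c, bs)\<leftarrow>hs. c * op_exp (ins_int ?N g') (affine_inss ?N bs G) {})"
      using im.pmb_mixture_image[OF g(3,1,2)] unfolding \<Psi>_def[symmetric] by blast
    have one: "\<Psi> (\<lambda>_. 1) = 1" using post(2) by (simp add: \<Psi>_def)
    obtain f where "pmbm_density ?N f" "(\<lambda>A. ennreal (f A)) \<in> fin_meas ?N"
      "\<forall>G\<in>fin_meas ?N. \<Psi> G = (\<integral>\<^sup>+A. ennreal (f A) * G A \<partial>finite_sets ?N)"
      using N.pmbm_density_of_mixture[OF g'(1,2,3) p0 g'(4) one] by blast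
    then show ?thesis by (intro goal) simp_all
  next
    \<comment> \<open>Without states there is no probability density to pad tracks with. The empty
      set is then the only set of trajectories, and the constant density 1 is a PMBM density with
      intensity 0 and no tracks.\<close>
    case True
    have e: "space ?N = {}" "space (Tr K) = {}" using True by (auto simp: space_traj_space)
    have se: "fin_subsets ?N = {{}}" "fin_subsets (Tr K) = {{}}"
      using e by (auto simp: space_finite_sets)
    define f :: "'x traj set \<Rightarrow> real" where "f = (\<lambda>_. 1)"
    show ?thesis
    proof (rule goal)
      have fA: "f A = (\<Sum>D\<in>splits ({} :: nat set) A. ppp_density ?N (\<lambda>_. 0) (D None) *
          (\<Sum>a\<in>{\<lambda>_::nat. undefined :: nat}. 1 * (\<Prod>i\<in>{}. bernoulli_density 0 (\<lambda>_. 0) (D (Some i)))))"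
        if "A \<in> fin_subsets ?N" for A
        using set_conv_empty[of "ppp_density ?N (\<lambda>_. 0)" "\<lambda>i. bernoulli_density 0 (\<lambda>_. 0)" A] that
        by (simp add: f_def set_conv_def se ppp_density_def)
      show "pmbm_density ?N f"
        unfolding pmbm_density_def
        by (rule exI[of _ "\<lambda>_. 0"], rule exI[of _ "{}"], rule exI[of _ "{\<lambda>_. undefined}"],
            rule exI[of _ "\<lambda>_. 1"], rule exI[of _ "\<lambda>_ _. 0"], rule exI[of _ "\<lambda>_ _ _. 0"]) (simp add: fA is_intensity_def)
      show "(\<lambda>A. ennreal (f A)) \<in> fin_meas ?N" by (simp add: f_def)
      fix G assume G: "G \<in> fin_meas ?N"
      have "\<Psi> G = (\<integral>\<^sup>+S. G {} * 1 \<partial>?post)"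
        unfolding \<Psi>_def by (intro nn_integral_cong) (simp add: sp se im.im_def)
      also have "\<dots> = G {} * (\<integral>\<^sup>+S. 1 \<partial>?post)" by (rule nn_integral_cmult) simp
      also have "\<dots> = G {}" using post(2) by simp
      finally have "\<Psi> G = G {}" .
      moreover have "(\<integral>\<^sup>+A. ennreal (f A) * G A \<partial>finite_sets ?N) = G {}"
      proof -
        have z: "ins_int ?N (\<lambda>_. 1) H A = 0" for H A by (simp add: ins_int_def nn_integral_empty e)
        have "(\<integral>\<^sup>+A. ennreal (f A) * G A \<partial>finite_sets ?N) = op_exp (ins_int ?N (\<lambda>_. 1)) G {}"
          using N.nn_integral_finite_sets_eq_op_exp[OF G] by (simp add: f_def)
        also have "\<dots> = (\<Sum>n\<in>{0}. ennreal (1 / fact n) * (ins_int ?N (\<lambda>_. 1) ^^ n) G {})"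
          unfolding op_exp_def
        proof (rule suminf_finite)
          fix n :: nat assume "n \<notin> {0}"
          then obtain n' where "n = Suc n'" by (cases n) auto
          then show "ennreal (1 / fact n) * (ins_int ?N (\<lambda>_. 1) ^^ n) G {} = 0" by (simp add: z)
        qed simp
        finally show ?thesis by simp
      qed
      ultimately show "\<Psi> G = (\<integral>\<^sup>+A. ennreal (f A) * G A \<partial>finite_sets ?N)" by simp
    qed
  qed
qed

end

end

theorem theorem1:
  fixes m :: "('x, 'z) target_model"
    and \<alpha> \<gamma> \<xi> \<eta> K :: nat
    and Z :: "nat \<Rightarrow> 'z set"
    and I :: "'i set" and t :: "'i \<Rightarrow> nat" and C :: "'i \<Rightarrow> 'x set"
    and sat :: "'x traj \<Rightarrow> bool"
  assumes "point_target_model m"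
    and "\<xi> \<le> \<eta>" and "\<alpha> \<le> \<gamma>"
    and "\<eta> \<le> K" and "\<gamma> \<le> K"
    and "\<And>k. k \<in> {\<xi>..\<eta>} \<Longrightarrow> finite (Z k) \<and> Z k \<subseteq> space (meas_space m)"
    and "0 < evidence m K \<xi> \<eta> Z" and "evidence m K \<xi> \<eta> Z < \<infinity>"
    and "finite I"
    and "\<And>i. i \<in> I \<Longrightarrow> t i \<in> {\<alpha>..\<gamma>} \<and> C i \<in> sets (state_space m)"
    and "sat = satisfies_conjunct I t C \<or> sat = satisfies_disjunct I t C"
  shows "\<exists>f. pmbm_density (traj_space (state_space m) \<alpha> \<gamma>) f \<and>
    distributed (posterior m K \<xi> \<eta> Z) (finite_sets (traj_space (state_space m) \<alpha> \<gamma>))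
      (\<lambda>S. {X \<in> trajs_in \<alpha> \<gamma> S. sat X}) (\<lambda>A. ennreal (f A))"
proof -
  interpret point_targets m by standard (rule assms(1))
  show ?thesis
    by (rule posterior_sat_trajs_pmbm[OF assms(9,10,11,3,5,6,7,8)])
qed

end
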